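(* Let $(\mathcal{A},\varphi)$ be a non-commutative probability space, let $\Phi$ be the character on $T(T_+(\mathcal{A}))$ extending $\varphi$, and let $\beta$ be the infinitesimal character with $\Phi=\mathcal{E}_\succ(\beta)$. For any $t\in[0,1]$, consider the infinitesimal character $$\beta^{(t)}=\mathcal{E}_\succ(t\beta)\succ\beta\prec\mathcal{E}_\succ(t\beta)^{*-1}.$$ Then for any word $w=a_1\cdots a_n\in T_+(\mathcal{A})$, $$\beta^{(t)}(w)=b^{(t)}_n(a_1,\ldots,a_n).$$ In other words, $\beta^{(t)}$ is the infinitesimal character on $T(T_+(\mathcal{A}))$ associated to the $t$-Boolean cumulants $\{b_n^{(t)}\}_{n\ge1}$ of $(\mathcal{A},\varphi)$.
   Context: **Probability space.** A non-commutative probability space $(\mathcal{A},\varphi)$ is an associative unital complex algebra $\mathcal{A}$ with a linear functional $\varphi:\mathcal{A}\to\mathbb{C}$, $\varphi(1_{\mathcal{A}})=1$. **$t$-Boolean cumulants.** $\mathrm{NC}(n)$ is the set of non-crossing partitions of $[n]=\{1,\dots,n\}$. A block $V$ of $\pi$ is inner if some other block contains $a,b$ with $a<c<b$ for all $c\in V$; $\mathrm{inner}(\pi)$ is the number of inner blocks of $\pi$. For $t\in[0,1]$ the $t$-Boolean cumulants $\{b_n^{(t)}:\mathcal{A}^n\to\mathbb{C}\}_{n\ge1}$ are the multilinear functionals recursively defined by $\varphi(a_1\cdots a_n)=\sum_{\pi\in\mathrm{NC}(n)}t^{\mathrm{inner}(\pi)}b^{(t)}_\pi(a_1,\dots,a_n)$,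 where $b^{(t)}_\pi(a_1,\dots,a_n)=\prod_{V\in\pi}b^{(t)}_{|V|}(a_{i_1},\dots,a_{i_m})$ with $V=\{i_1<\dots<i_m\}$, and $0^0=1$. **Double tensor Hopf algebra.** $T_+(\mathcal{A})=\bigoplus_{n\ge1}\mathcal{A}^{\otimes n}$ and $T(T_+(\mathcal{A}))=\bigoplus_{n\ge0}T_+(\mathcal{A})^{\otimes n}$. A word $a_1\cdots a_n$ in $T_+(\mathcal{A})$ denotes $a_1\otimes\cdots\otimes a_n$; pure tensors in $T(T_+(\mathcal{A}))$ are written $w_1|\cdots|w_m$. The product is concatenation with $|$, with unit the empty word $\mathbf{1}$. For $w=a_1\cdots a_n$ and $S=\{s_1<\dots<s_l\}\subseteq[n]$ let $w_S=a_{s_1}\cdots a_{s_l}$ ($w_\emptyset=\mathbf{1}$), and let $J_1,\dots,J_r$ be the connected components (maximal intervals of consecutive integers) of $[n]\setminus S$, ordered by minimal elements. The coproduct is $\Delta(w)=\sum_{S\subseteq[n]}w_S\otimes w_{J_1}|\cdots|w_{J_r}$, extended multiplicatively; the counit $\epsilon$ is the unital algebra morphism vanishing on $T_+(\mathcal{A})$. Split $\Delta=\Delta_\prec+\Delta_\succ$ on the augmentation ideal, where $\Delta_\prec(w)=\sum_{1\in S\subseteq[n]}w_S\otimes w_{J_1}|\cdots|w_{J_r}$ on words and $\Delta_\prec(w_1|w_2|\cdots|w_m)=\Delta_\prec(w_1)\Delta(w_2|\cdots|w_m)$, and likewise for $\Delta_\succ$. **Products on the dual.** For linear forms $f,g$: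 $f*g=m_{\mathbb{C}}(f\otimes g)\Delta$ (associative, unit $\epsilon$), $f\prec g=m_{\mathbb{C}}(f\otimes g)\Delta_\prec$, $f\succ g=m_{\mathbb{C}}(f\otimes g)\Delta_\succ$, with $f\prec\epsilon=f=\epsilon\succ f$ and $\epsilon\prec f=0=f\succ\epsilon$ for $f\ne\epsilon$; half-shuffle products are only used when at least one factor vanishes on $\mathbf{1}$, and then they vanish on $\mathbf{1}$. They satisfy $(f\prec g)\prec h=f\prec(g*h)$, $(f\succ g)\prec h=f\succ(g\prec h)$, $f\succ(g\succ h)=(f*g)\succ h$. **Characters.** $G$ is the group (for $*$, with inverse $\Phi^{*-1}$) of characters, i.e. unital algebra morphisms $T(T_+(\mathcal{A}))\to\mathbb{C}$. $\mathfrak{g}$ is the space of infinitesimal characters: linear forms $\alpha$ with $\alpha(\mathbf{1})=0$ and $\alpha(w_1|\cdots|w_k)=0$ for all $k\ge2$, $w_i\in T_+(\mathcal{A})$. The map $\mathcal{E}_\succ(\alpha)=\sum_{n\ge0}\alpha^{\succ n}$ ($\alpha^{\succ0}=\epsilon$, $\alpha^{\succ n}=\alpha^{\succ(n-1)}\succ\alpha$) is a bijection $\mathfrak{g}\to G$. The character extending $\varphi$ is the $\Phi\in G$ with $\Phi(w)=\varphi(a_1\cdots a_n)$ (product in $\mathcal{A}$) for every word $w=a_1\cdots a_n$. *)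

theory Defs
  imports Complex_Main "HOL-Library.Poly_Mapping" "HOL-Library.Disjoint_Sets"
begin

section \<open>Complex vector spaces and complex algebras\<close>

class complex_vector = ab_group_add +
  fixes scaleC :: "complex \<Rightarrow> 'a \<Rightarrow> 'a"  (infixr \<open>*\<^sub>C\<close> 75)
  assumes scaleC_add_right: "a *\<^sub>C (x + y) = a *\<^sub>C x + a *\<^sub>C y"
    and scaleC_add_left: "(a + b) *\<^sub>C x = a *\<^sub>C x + b *\<^sub>C x"
    and scaleC_scaleC: "a *\<^sub>C b *\<^sub>C x = (a * b) *\<^sub>C x"
    and scaleC_one: "1 *\<^sub>C x = x"

class complex_algebra = complex_vector + ring +
  assumes mult_scaleC_left [simp]: "(a *\<^sub>C x) * y = a *\<^sub>C (x * y)"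
    and mult_scaleC_right [simp]: "x * (a *\<^sub>C y) = a *\<^sub>C (x * y)"

class complex_algebra_1 = complex_algebra + ring_1

instantiation complex :: complex_algebra_1
begin

definition scaleC_complex :: "complex \<Rightarrow> complex \<Rightarrow> complex"
  where scaleC_complex_def [simp]: "scaleC_complex c x = c * x"

instance by standard (simp_all add: algebra_simps)

end

global_interpretation cvs: vector_space "scaleC :: complex \<Rightarrow> 'a \<Rightarrow> 'a::complex_vector"
  by unfold_locales (simp_all add: scaleC_add_right scaleC_add_left scaleC_scaleC scaleC_one)

abbreviation clinear :: "('a::complex_vector \<Rightarrow> 'b::complex_vector) \<Rightarrow> bool"
  where "clinear \<equiv> Vector_Spaces.linear (*\<^sub>C) (*\<^sub>C)"

lemma clinear_iff:
  "clinear f \<longleftrightarrow> (\<forall>x y. f (x + y) = f x + f y) \<and> (\<forall>c x. f (c *\<^sub>C x) = c *\<^sub>C f x)"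
  by (simp add: Vector_Spaces.linear_iff cvs.vector_space_axioms)

lemma clinearI:
  assumes "\<And>x y. f (x + y) = f x + f y" "\<And>c x. f (c *\<^sub>C x) = c *\<^sub>C f x"
  shows "clinear f"
  using assms by (simp add: clinear_iff)

lemma clinear_add: "clinear f \<Longrightarrow> f (x + y) = f x + f y"
  and clinear_scale: "clinear f \<Longrightarrow> f (c *\<^sub>C x) = c *\<^sub>C f x"
  by (auto simp: clinear_iff)

lemma clinear_zero: "clinear f \<Longrightarrow> f 0 = 0"
  using clinear_scale[of f 0 0] by simp

lemma clinear_diff: "clinear f \<Longrightarrow> f (x - y) = f x - f y"
  using clinear_add[of f "x - y" y] by (simp add: algebra_simps)

lemma clinear_sum: "clinear f \<Longrightarrow> f (\<Sum>i\<in>I. g i) = (\<Sum>i\<in>I. f (g i))"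
  by (induction I rule: infinite_finite_induct) (simp_all add: clinear_zero clinear_add)

lemma clinear_eq_0_on_span:
  assumes "clinear f" "\<And>r. r \<in> R \<Longrightarrow> f r = 0" "p \<in> cvs.span R"
  shows "f p = 0"
  using assms(3)
  by (induction rule: cvs.span_induct_alt)
    (simp_all add: assms clinear_zero clinear_add clinear_scale)

definition bilinear_map ::
    "('a::complex_vector \<Rightarrow> 'b::complex_vector \<Rightarrow> 'c::complex_vector) \<Rightarrow> bool"
  where "bilinear_map h \<longleftrightarrow> (\<forall>x. clinear (h x)) \<and> (\<forall>y. clinear (\<lambda>x. h x y))"


section \<open>Free vector spaces\<close>

instantiation poly_mapping :: (type, complex_vector) complex_vector
begin

definition scaleC_poly_mapping :: "complex \<Rightarrow> ('a \<Rightarrow>\<^sub>0 'b) \<Rightarrow> ('a \<Rightarrow>\<^sub>0 'b)"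
  where "scaleC_poly_mapping c p = Poly_Mapping.map (scaleC c) p"

lemma lookup_scaleC [simp]:
  "Poly_Mapping.lookup (c *\<^sub>C p) k = c *\<^sub>C Poly_Mapping.lookup (p :: 'a \<Rightarrow>\<^sub>0 'b) k"
  by (simp add: scaleC_poly_mapping_def Poly_Mapping.map.rep_eq when_def)

instance
  by standard
    (auto intro!: poly_mapping_eqI simp: lookup_add scaleC_add_right scaleC_add_left
      scaleC_scaleC scaleC_one)

end

definition lin_ext :: "('k \<Rightarrow> 'v::complex_vector) \<Rightarrow> ('k \<Rightarrow>\<^sub>0 complex) \<Rightarrow> 'v"
  where "lin_ext g p = (\<Sum>k\<in>Poly_Mapping.keys p. Poly_Mapping.lookup p k *\<^sub>C g k)"

lemma lin_ext_superset:
  assumes "finite A" "Poly_Mapping.keys p \<subseteq> A"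
  shows "lin_ext g p = (\<Sum>k\<in>A. Poly_Mapping.lookup p k *\<^sub>C g k)"
  unfolding lin_ext_def
  by (rule sum.mono_neutral_left) (use assms in \<open>auto simp: in_keys_iff\<close>)

lemma clinear_lin_ext: "clinear (lin_ext g)"
proof (rule clinearI)
  fix p q :: "'a \<Rightarrow>\<^sub>0 complex"
  let ?A = "Poly_Mapping.keys p \<union> Poly_Mapping.keys q"
  show "lin_ext g (p + q) = lin_ext g p + lin_ext g q"
    using Poly_Mapping.keys_add[of p q]
    by (simp add: lin_ext_superset[of ?A] lookup_add scaleC_add_left sum.distrib)
next
  fix c and p :: "'a \<Rightarrow>\<^sub>0 complex"
  have "Poly_Mapping.keys (c *\<^sub>C p) \<subseteq> Poly_Mapping.keys p"
    by (auto simp: in_keys_iff)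
  then show "lin_ext g (c *\<^sub>C p) = c *\<^sub>C lin_ext g p"
    by (simp add: lin_ext_superset[of "Poly_Mapping.keys p"] cvs.scale_sum_right scaleC_scaleC)
qed

lemma lin_ext_single [simp]: "lin_ext g (Poly_Mapping.single k c) = c *\<^sub>C g k"
  by (simp add: lin_ext_superset[of "{k}"])

lemma clinear_lin_ext_unique:
  assumes "clinear f"
  shows "f p = lin_ext (\<lambda>k. f (Poly_Mapping.single k 1)) p"
proof -
  have "p = (\<Sum>k\<in>Poly_Mapping.keys p. Poly_Mapping.lookup p k *\<^sub>C Poly_Mapping.single k 1)"
    by (rule poly_mapping_eqI)
      (auto simp: lookup_sum lookup_single when_def in_keys_iff if_distrib cong: if_cong)
  then have "f p = f (\<Sum>k\<in>Poly_Mapping.keys p. Poly_Mapping.lookup p k *\<^sub>C Poly_Mapping.single k 1)"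
    by simp
  then show ?thesis
    by (simp add: clinear_sum[OF assms] clinear_scale[OF assms] lin_ext_def)
qed


section \<open>Tensor product of two vector spaces\<close>

definition tensor_relators :: "(('a::complex_vector \<times> 'b::complex_vector) \<Rightarrow>\<^sub>0 complex) set"
  where "tensor_relators =
    {Poly_Mapping.single (x + x', y) 1 - Poly_Mapping.single (x, y) 1 - Poly_Mapping.single (x', y) 1
      | x x' y. True} \<union>
    {Poly_Mapping.single (x, y + y') 1 - Poly_Mapping.single (x, y) 1 - Poly_Mapping.single (x, y') 1
      | x y y'. True} \<union>
    {Poly_Mapping.single (c *\<^sub>C x, y) 1 - c *\<^sub>C Poly_Mapping.single (x, y) 1 | c x y. True} \<union>
    {Poly_Mapping.single (x, c *\<^sub>C y) 1 - c *\<^sub>C Poly_Mapping.single (x, y) 1 | c x y. True}"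

definition tensor_rel ::
    "(('a::complex_vector \<times> 'b::complex_vector) \<Rightarrow>\<^sub>0 complex) \<Rightarrow> ('a \<times> 'b \<Rightarrow>\<^sub>0 complex) \<Rightarrow> bool"
  where "tensor_rel p q \<longleftrightarrow> p - q \<in> cvs.span tensor_relators"

lemma span_rel_equivp: "equivp (\<lambda>p q. p - q \<in> cvs.span R)"
proof (rule equivpI)
  show "reflp (\<lambda>p q. p - q \<in> cvs.span R)"
    by (simp add: reflp_def cvs.span_zero)
  show "symp (\<lambda>p q. p - q \<in> cvs.span R)"
  proof (rule sympI)
    fix p q assume "p - q \<in> cvs.span R"
    from cvs.span_neg[OF this] show "q - p \<in> cvs.span R" by simp
  qed
  show "transp (\<lambda>p q. p - q \<in> cvs.span R)"
  proof (rule transpI)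
    fix p q r assume "p - q \<in> cvs.span R" "q - r \<in> cvs.span R"
    from cvs.span_add[OF this] show "p - r \<in> cvs.span R" by simp
  qed
qed

lemma span_rel_add:
  "p - p' \<in> cvs.span R \<Longrightarrow> q - q' \<in> cvs.span R \<Longrightarrow> (p + q) - (p' + q') \<in> cvs.span R"
  using cvs.span_add[of "p - p'" R "q - q'"] by (simp add: algebra_simps)

lemma span_rel_diff:
  "p - p' \<in> cvs.span R \<Longrightarrow> q - q' \<in> cvs.span R \<Longrightarrow> (p - q) - (p' - q') \<in> cvs.span R"
  using cvs.span_diff[of "p - p'" R "q - q'"] by (simp add: algebra_simps)

lemma span_rel_minus: "p - p' \<in> cvs.span R \<Longrightarrow> (- p) - (- p') \<in> cvs.span R"
  using cvs.span_neg[of "p - p'" R] by (simp add: algebra_simps)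

lemma span_rel_scale: "p - p' \<in> cvs.span R \<Longrightarrow> c *\<^sub>C p - c *\<^sub>C p' \<in> cvs.span R"
  using cvs.span_scale[of "p - p'" R c] by (simp add: cvs.scale_right_diff_distrib)

quotient_type (overloaded) ('a, 'b) tensor =
  "(('a::complex_vector \<times> 'b::complex_vector) \<Rightarrow>\<^sub>0 complex)" / tensor_rel
  unfolding tensor_rel_def by (rule span_rel_equivp)

instantiation tensor :: (complex_vector, complex_vector) complex_vector
begin

lift_definition zero_tensor :: "('a, 'b) tensor" is 0 .
lift_definition plus_tensor :: "('a, 'b) tensor \<Rightarrow> ('a, 'b) tensor \<Rightarrow> ('a, 'b) tensor" is "(+)"
  unfolding tensor_rel_def by (rule span_rel_add)
lift_definition minus_tensor :: "('a, 'b) tensor \<Rightarrow> ('a, 'b) tensor \<Rightarrow> ('a, 'b) tensor" is "(-)"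
  unfolding tensor_rel_def by (rule span_rel_diff)
lift_definition uminus_tensor :: "('a, 'b) tensor \<Rightarrow> ('a, 'b) tensor" is uminus
  unfolding tensor_rel_def by (rule span_rel_minus)
lift_definition scaleC_tensor :: "complex \<Rightarrow> ('a, 'b) tensor \<Rightarrow> ('a, 'b) tensor" is "(*\<^sub>C)"
  unfolding tensor_rel_def by (rule span_rel_scale)

instance
  by standard
    (transfer, simp add: tensor_rel_def cvs.span_zero algebra_simps)+

end

lift_definition pure_tensor :: "'a::complex_vector \<Rightarrow> 'b::complex_vector \<Rightarrow> ('a, 'b) tensor"
    (infix \<open>\<otimes>\<close> 75)
  is "\<lambda>x y. Poly_Mapping.single (x, y) 1" .

text \<open>The linear map out of a tensor product given by a bilinear map.\<close>

definition tensor_ext ::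
    "('a \<Rightarrow> 'b \<Rightarrow> 'c) \<Rightarrow> ('a::complex_vector, 'b::complex_vector) tensor \<Rightarrow> 'c::complex_vector"
  where "tensor_ext h z = lin_ext (\<lambda>(x, y). h x y) (rep_tensor z)"

lemma bilinear_pure_tensor: "bilinear_map (\<otimes>)"
proof -
  have "(x + x') \<otimes> y = x \<otimes> y + x' \<otimes> y" "x \<otimes> (y + y') = x \<otimes> y + x \<otimes> y'"
    "(c *\<^sub>C x) \<otimes> y = c *\<^sub>C (x \<otimes> y)" "x \<otimes> (c *\<^sub>C y) = c *\<^sub>C (x \<otimes> y)"
    for x x' :: 'a and y y' :: 'b and c
    by (transfer, unfold tensor_rel_def, rule cvs.span_base,
        unfold tensor_relators_def diff_diff_add[symmetric], blast)+
  then show ?thesis by (simp add: bilinear_map_def clinear_iff)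
qed

lemma lin_ext_tensor_rel:
  assumes "bilinear_map h" "tensor_rel p q"
  shows "lin_ext (\<lambda>(x, y). h x y) p = lin_ext (\<lambda>(x, y). h x y) q"
proof -
  let ?L = "lin_ext (\<lambda>(x, y). h x y)"
  note lin = clinear_lin_ext[of "\<lambda>(x, y). h x y"]
  have "?L (p - q) = 0"
  proof (rule clinear_eq_0_on_span[OF lin])
    show "p - q \<in> cvs.span tensor_relators" using assms(2) by (simp add: tensor_rel_def)
    show "?L r = 0" if "r \<in> tensor_relators" for r
      using that assms(1) unfolding tensor_relators_def bilinear_map_def clinear_iff
      by (auto simp: clinear_diff[OF lin] clinear_scale[OF lin] scaleC_one)
  qed
  then show ?thesis by (simp add: clinear_diff[OF lin])
qed

lemma tensor_ext_abs:
  assumes "bilinear_map h"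
  shows "tensor_ext h (abs_tensor p) = lin_ext (\<lambda>(x, y). h x y) p"
  unfolding tensor_ext_def
  by (rule lin_ext_tensor_rel[OF assms])
    (simp add: rep_abs_rsp_left[OF Quotient3_tensor] Quotient3_rep_abs[OF Quotient3_tensor] equivp_reflp[OF tensor_equivp])

lemma tensor_ext_pure: "bilinear_map h \<Longrightarrow> tensor_ext h (x \<otimes> y) = h x y"
  by (simp add: pure_tensor.abs_eq tensor_ext_abs scaleC_one)

lemma clinear_tensor_ext:
  assumes "bilinear_map h"
  shows "clinear (tensor_ext h)"
proof (rule clinearI)
  fix x y :: "('a, 'b) tensor" and c
  obtain p q where "x = abs_tensor p" "y = abs_tensor q"
    by (metis Quotient3_abs_rep Quotient3_tensor)
  then show "tensor_ext h (x + y) = tensor_ext h x + tensor_ext h y"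
    "tensor_ext h (c *\<^sub>C x) = c *\<^sub>C tensor_ext h x"
    by (simp_all add: plus_tensor.abs_eq scaleC_tensor.abs_eq tensor_ext_abs[OF assms]
        clinear_add[OF clinear_lin_ext] clinear_scale[OF clinear_lin_ext])
qed

lemma clinear_tensor_eqI:
  assumes "clinear f" "clinear g" "\<And>x y. f (x \<otimes> y) = g (x \<otimes> y)"
  shows "f z = g z"
proof -
  obtain p where z: "z = abs_tensor p" by (metis Quotient3_abs_rep Quotient3_tensor)
  have lin: "clinear (\<lambda>p. h (abs_tensor p))" if "clinear h"
    for h :: "('a, 'b) tensor \<Rightarrow> 'c"
    using that by (simp add: clinear_iff flip: plus_tensor.abs_eq scaleC_tensor.abs_eq)
  have "(\<lambda>k. f (abs_tensor (Poly_Mapping.single k 1))) = (\<lambda>k. g (abs_tensor (Poly_Mapping.single k 1)))"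
    using assms(3) by (auto simp: fun_eq_iff pure_tensor.abs_eq)
  then show ?thesis
    using clinear_lin_ext_unique[OF lin[OF assms(1)], of p]
      clinear_lin_ext_unique[OF lin[OF assms(2)], of p] by (simp add: z)
qed

lemma tensor_induct [case_names pure add scale]:
  assumes "\<And>x y. P (x \<otimes> y)" "\<And>z z'. P z \<Longrightarrow> P z' \<Longrightarrow> P (z + z')" "\<And>c z. P z \<Longrightarrow> P (c *\<^sub>C z)"
  shows "P (z :: ('a::complex_vector, 'b::complex_vector) tensor)"
proof -
  have "z = tensor_ext (\<otimes>) z"
    by (rule clinear_tensor_eqI[where f = "\<lambda>z. z"])
      (simp_all add: clinear_tensor_ext bilinear_pure_tensor tensor_ext_pure clinearI)
  moreover have "P (\<Sum>k\<in>K. c k *\<^sub>C (case k of (x, y) \<Rightarrow> x \<otimes> y))" if "finite K" for K c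
    using that
  proof (induction K rule: finite_induct)
    case empty
    show ?case using assms(3)[OF assms(1), of 0 0 0] by simp
  next
    case (insert k K)
    then show ?case by (cases k) (simp add: assms)
  qed
  ultimately show ?thesis by (metis finite_keys lin_ext_def tensor_ext_def)
qed

lemma lin_ext_fun_add: "lin_ext (\<lambda>k. g k + h k) p = lin_ext g p + lin_ext h p"
  by (simp add: lin_ext_def scaleC_add_right sum.distrib)

lemma lin_ext_fun_scale: "lin_ext (\<lambda>k. c *\<^sub>C g k) p = c *\<^sub>C lin_ext g p"
  by (simp add: lin_ext_def cvs.scale_sum_right scaleC_scaleC mult.commute)

lemma tensor_ext_fun_add: "tensor_ext (\<lambda>x y. g x y + h x y) z = tensor_ext g z + tensor_ext h z"
  by (simp add: tensor_ext_def split_def lin_ext_fun_add)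

lemma tensor_ext_fun_scale: "tensor_ext (\<lambda>x y. c *\<^sub>C g x y) z = c *\<^sub>C tensor_ext g z"
  by (simp add: tensor_ext_def split_def lin_ext_fun_scale)

lemma pure_tensor_add_left: "(x + x') \<otimes> y = x \<otimes> y + x' \<otimes> y"
  and pure_tensor_add_right: "x \<otimes> (y + y') = x \<otimes> y + x \<otimes> y'"
  and pure_tensor_scale_left: "(c *\<^sub>C x) \<otimes> y = c *\<^sub>C (x \<otimes> y)"
  and pure_tensor_scale_right: "x \<otimes> (c *\<^sub>C y) = c *\<^sub>C (x \<otimes> y)"
  by (simp_all add: bilinear_pure_tensor[unfolded bilinear_map_def clinear_iff])

lemmas pure_tensor_bilinear =
  pure_tensor_add_left pure_tensor_add_right pure_tensor_scale_left pure_tensor_scale_right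

text \<open>The tensor product of two algebras, with \<open>(x \<otimes> y) (x' \<otimes> y') = x x' \<otimes> y y'\<close>.\<close>

instantiation tensor :: (complex_algebra_1, complex_algebra_1) "{times, one}"
begin

definition times_tensor :: "('a, 'b) tensor \<Rightarrow> ('a, 'b) tensor \<Rightarrow> ('a, 'b) tensor"
  where "times_tensor s t =
    tensor_ext (\<lambda>x y. tensor_ext (\<lambda>x' y'. (x * x') \<otimes> (y * y')) t) s"

definition one_tensor :: "('a, 'b) tensor"
  where "one_tensor = 1 \<otimes> 1"

instance ..

end

lemma times_tensor_bilinear_inner: "bilinear_map (\<lambda>x' y'. (x * x') \<otimes> (y * y'))"
  for x :: "'a::complex_algebra_1" and y :: "'b::complex_algebra_1"
  by (simp add: bilinear_map_def clinear_iff pure_tensor_bilinear algebra_simps)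

lemma times_tensor_bilinear_outer:
  "bilinear_map (\<lambda>x y. tensor_ext (\<lambda>x' y'. (x * x') \<otimes> (y * y')) t)"
  for t :: "('a::complex_algebra_1, 'b::complex_algebra_1) tensor"
  by (simp add: bilinear_map_def clinear_iff pure_tensor_bilinear algebra_simps
      tensor_ext_fun_add tensor_ext_fun_scale)

lemma times_pure_tensor: "(x \<otimes> y) * (x' \<otimes> y') = (x * x') \<otimes> (y * y')"
  for x x' :: "'a::complex_algebra_1" and y y' :: "'b::complex_algebra_1"
  unfolding times_tensor_def
  by (subst tensor_ext_pure[OF times_tensor_bilinear_outer],
      subst tensor_ext_pure[OF times_tensor_bilinear_inner], rule refl)

instance tensor :: (complex_algebra_1, complex_algebra_1) "{complex_algebra, monoid_mult}"
proof
  fix a b c :: "('a, 'b) tensor" and k :: complex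
  show dl: "(a + b) * c = a * c + b * c" for a b c :: "('a, 'b) tensor"
    by (simp add: times_tensor_def clinear_add[OF clinear_tensor_ext[OF times_tensor_bilinear_outer]])
  show sl: "(k *\<^sub>C a) * b = k *\<^sub>C (a * b)" for k and a b :: "('a, 'b) tensor"
    by (simp add: times_tensor_def clinear_scale[OF clinear_tensor_ext[OF times_tensor_bilinear_outer]])
  show dr: "a * (b + c) = a * b + a * c" for a b c :: "('a, 'b) tensor"
    by (simp add: times_tensor_def clinear_add[OF clinear_tensor_ext[OF times_tensor_bilinear_inner]]
        tensor_ext_fun_add)
  show sr: "a * (k *\<^sub>C b) = k *\<^sub>C (a * b)" for k and a b :: "('a, 'b) tensor"
    by (simp add: times_tensor_def clinear_scale[OF clinear_tensor_ext[OF times_tensor_bilinear_inner]]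
        tensor_ext_fun_scale)
  show "a * b * c = a * (b * c)"
  proof (induction a rule: tensor_induct)
    case (pure x y)
    show ?case
    proof (induction b rule: tensor_induct)
      case (pure x' y')
      show ?case
        by (induction c rule: tensor_induct) (simp_all add: times_pure_tensor mult.assoc dr sr)
    qed (simp_all add: dl dr sl sr)
  qed (simp_all add: dl sl)
  show "1 * a = a"
    by (induction a rule: tensor_induct) (simp_all add: one_tensor_def times_pure_tensor dr sr)
  show "a * 1 = a"
    by (induction a rule: tensor_induct) (simp_all add: one_tensor_def times_pure_tensor dl sl)
qed


section \<open>The double tensor algebra\<close>

text \<open>A word \<open>a\<^sub>1 \<cdots> a\<^sub>n\<close> with \<open>n \<ge> 1\<close> letters.\<close>

typedef 'a word = "{as :: 'a list. as \<noteq> []}" morphisms letters Word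
  by blast

lemma letters_Word [simp]: "as \<noteq> [] \<Longrightarrow> letters (Word as) = as"
  by (simp add: Word_inverse)

lemma letters_not_Nil [simp]: "letters w \<noteq> []"
  using letters by auto

text \<open>
  The double tensor algebra is the direct sum, over all \<open>m \<ge> 0\<close> and \<open>n\<^sub>1, \<dots>, n\<^sub>m \<ge> 1\<close>, of the spaces
  \<open>A\<^bsup>\<otimes> n\<^sub>1\<^esup> \<otimes> \<cdots> \<otimes> A\<^bsup>\<otimes> n\<^sub>m\<^esup>\<close>. It is presented as the space freely generated by the barred words
  \<open>w\<^sub>1 | \<cdots> | w\<^sub>m\<close>, modulo linearity in each letter of each word.
\<close>

definition double_tensor_relators :: "('a::complex_vector word list \<Rightarrow>\<^sub>0 complex) set"
  where "double_tensor_relators =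
    {Poly_Mapping.single (us @ Word (xs @ (a + b) # ys) # vs) 1
       - Poly_Mapping.single (us @ Word (xs @ a # ys) # vs) 1
       - Poly_Mapping.single (us @ Word (xs @ b # ys) # vs) 1 | us xs a b ys vs. True} \<union>
    {Poly_Mapping.single (us @ Word (xs @ (c *\<^sub>C a) # ys) # vs) 1
       - c *\<^sub>C Poly_Mapping.single (us @ Word (xs @ a # ys) # vs) 1 | us xs c a ys vs. True}"

definition double_tensor_rel ::
    "('a::complex_vector word list \<Rightarrow>\<^sub>0 complex) \<Rightarrow> ('a word list \<Rightarrow>\<^sub>0 complex) \<Rightarrow> bool"
  where "double_tensor_rel p q \<longleftrightarrow> p - q \<in> cvs.span double_tensor_relators"

quotient_type (overloaded) 'a double_tensor =
  "'a::complex_vector word list \<Rightarrow>\<^sub>0 complex" / double_tensor_rel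
  unfolding double_tensor_rel_def by (rule span_rel_equivp)

instantiation double_tensor :: (complex_vector) complex_vector
begin

lift_definition zero_double_tensor :: "'a double_tensor" is 0 .
lift_definition plus_double_tensor :: "'a double_tensor \<Rightarrow> 'a double_tensor \<Rightarrow> 'a double_tensor"
  is "(+)" unfolding double_tensor_rel_def by (rule span_rel_add)
lift_definition minus_double_tensor :: "'a double_tensor \<Rightarrow> 'a double_tensor \<Rightarrow> 'a double_tensor"
  is "(-)" unfolding double_tensor_rel_def by (rule span_rel_diff)
lift_definition uminus_double_tensor :: "'a double_tensor \<Rightarrow> 'a double_tensor"
  is uminus unfolding double_tensor_rel_def by (rule span_rel_minus)
lift_definition scaleC_double_tensor :: "complex \<Rightarrow> 'a double_tensor \<Rightarrow> 'a double_tensor"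
  is "(*\<^sub>C)" unfolding double_tensor_rel_def by (rule span_rel_scale)

instance
  by standard (transfer, simp add: double_tensor_rel_def cvs.span_zero algebra_simps)+

end

lift_definition barred :: "'a::complex_vector word list \<Rightarrow> 'a double_tensor"
  is "\<lambda>ws. Poly_Mapping.single ws 1" .

abbreviation word_tensor :: "'a::complex_vector word \<Rightarrow> 'a double_tensor"
  where "word_tensor w \<equiv> barred [w]"

definition letter_multilinear :: "('a::complex_vector word list \<Rightarrow> 'b::complex_vector) \<Rightarrow> bool"
  where "letter_multilinear g \<longleftrightarrow>
    (\<forall>us xs ys vs. clinear (\<lambda>a. g (us @ Word (xs @ a # ys) # vs)))"

text \<open>The linear map out of the double tensor algebra given by a letterwise multilinear map.\<close>

definition dt_ext ::
    "('a::complex_vector word list \<Rightarrow> 'b::complex_vector) \<Rightarrow> 'a double_tensor \<Rightarrow> 'b"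
  where "dt_ext g z = lin_ext g (rep_double_tensor z)"

lemma letter_multilinear_barred: "letter_multilinear barred"
proof -
  have "barred (us @ Word (xs @ (a + b) # ys) # vs)
      = barred (us @ Word (xs @ a # ys) # vs) + barred (us @ Word (xs @ b # ys) # vs)"
    "barred (us @ Word (xs @ (c *\<^sub>C a) # ys) # vs) = c *\<^sub>C barred (us @ Word (xs @ a # ys) # vs)"
    for us vs :: "'a word list" and xs ys a b c
    by (transfer, unfold double_tensor_rel_def, rule cvs.span_base,
        unfold double_tensor_relators_def diff_diff_add[symmetric], blast)+
  then show ?thesis by (simp add: letter_multilinear_def clinear_iff)
qed

lemma dt_ext_abs:
  assumes "letter_multilinear g"
  shows "dt_ext g (abs_double_tensor p) = lin_ext g p"
proof -
  note lin = clinear_lin_ext[of g]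
  let ?q = "rep_double_tensor (abs_double_tensor p)"
  have "lin_ext g (?q - p) = 0"
  proof (rule clinear_eq_0_on_span[OF lin])
    have "double_tensor_rel ?q p"
      by (simp add: Quotient3_rep_abs[OF Quotient3_double_tensor] equivp_reflp[OF double_tensor_equivp])
    then show "?q - p \<in> cvs.span double_tensor_relators" by (simp add: double_tensor_rel_def)
    show "lin_ext g r = 0" if "r \<in> double_tensor_relators" for r
      using that assms unfolding double_tensor_relators_def letter_multilinear_def clinear_iff
      by (auto simp: clinear_diff[OF lin] clinear_scale[OF lin])
  qed
  then show ?thesis by (simp add: clinear_diff[OF lin] dt_ext_def)
qed

lemma dt_ext_barred: "letter_multilinear g \<Longrightarrow> dt_ext g (barred ws) = g ws"
  by (simp add: barred.abs_eq dt_ext_abs)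

lemma clinear_dt_ext:
  assumes "letter_multilinear g"
  shows "clinear (dt_ext g)"
proof (rule clinearI)
  fix x y :: "'a double_tensor" and c
  obtain p q where "x = abs_double_tensor p" "y = abs_double_tensor q"
    by (metis Quotient3_abs_rep Quotient3_double_tensor)
  then show "dt_ext g (x + y) = dt_ext g x + dt_ext g y" "dt_ext g (c *\<^sub>C x) = c *\<^sub>C dt_ext g x"
    by (simp_all add: plus_double_tensor.abs_eq scaleC_double_tensor.abs_eq dt_ext_abs[OF assms]
        clinear_add[OF clinear_lin_ext] clinear_scale[OF clinear_lin_ext])
qed

lemma clinear_dt_eqI:
  assumes "clinear f" "clinear g" "\<And>ws. f (barred ws) = g (barred ws)"
  shows "f z = g z"
proof -
  obtain p where z: "z = abs_double_tensor p" by (metis Quotient3_abs_rep Quotient3_double_tensor)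
  have lin: "clinear (\<lambda>p. h (abs_double_tensor p))" if "clinear h" for h :: "'a double_tensor \<Rightarrow> 'b"
    using that by (simp add: clinear_iff flip: plus_double_tensor.abs_eq scaleC_double_tensor.abs_eq)
  have "(\<lambda>k. f (abs_double_tensor (Poly_Mapping.single k 1)))
      = (\<lambda>k. g (abs_double_tensor (Poly_Mapping.single k 1)))"
    using assms(3) by (auto simp: fun_eq_iff barred.abs_eq)
  then show ?thesis
    using clinear_lin_ext_unique[OF lin[OF assms(1)], of p]
      clinear_lin_ext_unique[OF lin[OF assms(2)], of p] by (simp add: z)
qed

lemma double_tensor_induct [case_names barred add scale]:
  assumes "\<And>ws. P (barred ws)" "\<And>z z'. P z \<Longrightarrow> P z' \<Longrightarrow> P (z + z')" "\<And>c z. P z \<Longrightarrow> P (c *\<^sub>C z)"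
  shows "P (z :: 'a::complex_vector double_tensor)"
proof -
  have "z = dt_ext barred z"
    by (rule clinear_dt_eqI[where f = "\<lambda>z. z"])
      (simp_all add: clinear_dt_ext letter_multilinear_barred dt_ext_barred clinearI)
  moreover have "P (\<Sum>k\<in>K. c k *\<^sub>C barred k)" if "finite K" for K c
    using that
  proof (induction K rule: finite_induct)
    case empty
    show ?case using assms(3)[OF assms(1), of 0 "[]"] by simp
  qed (simp add: assms)
  ultimately show ?thesis by (metis finite_keys lin_ext_def dt_ext_def)
qed

lemma dt_ext_fun_add: "dt_ext (\<lambda>ws. g ws + h ws) z = dt_ext g z + dt_ext h z"
  by (simp add: dt_ext_def lin_ext_fun_add)

lemma dt_ext_fun_scale: "dt_ext (\<lambda>ws. c *\<^sub>C g ws) z = c *\<^sub>C dt_ext g z"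
  by (simp add: dt_ext_def lin_ext_fun_scale)

lemma clinear_barred: "clinear (\<lambda>a. barred (us @ Word (xs @ a # ys) # vs))"
  by (rule letter_multilinear_barred[unfolded letter_multilinear_def, rule_format])

text \<open>The product is concatenation of barred words, the unit is the empty barred word.\<close>

instantiation double_tensor :: (complex_vector) "{times, one}"
begin

definition times_double_tensor :: "'a double_tensor \<Rightarrow> 'a double_tensor \<Rightarrow> 'a double_tensor"
  where "times_double_tensor x y = dt_ext (\<lambda>us. dt_ext (\<lambda>vs. barred (us @ vs)) y) x"

definition one_double_tensor :: "'a double_tensor"
  where "one_double_tensor = barred []"

instance ..

end

definition counit :: "'a::complex_vector double_tensor \<Rightarrow> complex"
  where "counit = dt_ext (\<lambda>ws. if ws = [] then 1 else 0)"

lemma letter_multilinear_counit: "letter_multilinear (\<lambda>ws. if ws = [] then 1 else 0 :: complex)"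
  by (simp add: letter_multilinear_def clinear_iff)

lemma counit_barred: "counit (barred ws) = (if ws = [] then 1 else 0)"
  by (simp add: counit_def dt_ext_barred letter_multilinear_counit)

lemma clinear_counit: "clinear counit"
  by (simp add: counit_def clinear_dt_ext letter_multilinear_counit)

lemma times_dt_inner: "letter_multilinear (\<lambda>vs. barred (us @ vs))"
  using clinear_barred[of "us @ us'" for us'] by (simp add: letter_multilinear_def)

lemma times_dt_outer: "letter_multilinear (\<lambda>us. dt_ext (\<lambda>vs. barred (us @ vs)) y)"
  by (simp add: letter_multilinear_def clinear_iff dt_ext_fun_add dt_ext_fun_scale
      clinear_barred[unfolded clinear_iff])

lemma times_barred: "barred us * barred vs = barred (us @ vs)"
  unfolding times_double_tensor_def
  by (subst dt_ext_barred[OF times_dt_outer], subst dt_ext_barred[OF times_dt_inner], rule refl)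

instance double_tensor :: (complex_vector) complex_algebra_1
proof
  fix a b c :: "'a double_tensor" and k :: complex
  show dl: "(a + b) * c = a * c + b * c" for a b c :: "'a double_tensor"
    by (simp add: times_double_tensor_def clinear_add[OF clinear_dt_ext[OF times_dt_outer]])
  show sl: "(k *\<^sub>C a) * b = k *\<^sub>C (a * b)" for k and a b :: "'a double_tensor"
    by (simp add: times_double_tensor_def clinear_scale[OF clinear_dt_ext[OF times_dt_outer]])
  show dr: "a * (b + c) = a * b + a * c" for a b c :: "'a double_tensor"
    by (simp add: times_double_tensor_def clinear_add[OF clinear_dt_ext[OF times_dt_inner]] dt_ext_fun_add)
  show sr: "a * (k *\<^sub>C b) = k *\<^sub>C (a * b)" for k and a b :: "'a double_tensor"
    by (simp add: times_double_tensor_def clinear_scale[OF clinear_dt_ext[OF times_dt_inner]] dt_ext_fun_scale)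
  show "a * b * c = a * (b * c)"
  proof (induction a rule: double_tensor_induct)
    case (barred us)
    show ?case
    proof (induction b rule: double_tensor_induct)
      case (barred vs)
      show ?case
        by (induction c rule: double_tensor_induct) (simp_all add: times_barred dr sr)
    qed (simp_all add: dl dr sl sr)
  qed (simp_all add: dl sl)
  show "1 * a = a"
    by (induction a rule: double_tensor_induct) (simp_all add: one_double_tensor_def times_barred dr sr)
  show "a * 1 = a"
    by (induction a rule: double_tensor_induct) (simp_all add: one_double_tensor_def times_barred dl sl)
  show "(0 :: 'a double_tensor) \<noteq> 1"
    by (metis clinear_counit clinear_zero counit_barred one_double_tensor_def zero_neq_one)
qed


section \<open>The coproduct\<close>

text \<open>
  The positions of a word \<open>w\<close> with \<open>n\<close> letters are numbered \<open>0, \<dots>, n - 1\<close>. For a set \<open>S\<close> of positions,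
  \<open>subword w S\<close> is \<open>w\<^sub>S\<close> as a barred word; it is the empty barred word for \<open>S = {}\<close>.
\<close>

abbreviation positions :: "'a word \<Rightarrow> nat set"
  where "positions w \<equiv> {..<length (letters w)}"

definition subword :: "'a word \<Rightarrow> nat set \<Rightarrow> 'a word list"
  where "subword w S = (let as = nths (letters w) S in if as = [] then [] else [Word as])"

text \<open>
  The connected components of a finite set \<open>U\<close> of positions, in increasing order: one for each left
  endpoint, i.e. each \<open>m \<in> U\<close> that is not the successor of an element of \<open>U\<close>.
\<close>

definition left_endpoints :: "nat set \<Rightarrow> nat set"
  where "left_endpoints U = {m \<in> U. \<forall>k\<in>U. Suc k \<noteq> m}"

definition component_from :: "nat set \<Rightarrow> nat \<Rightarrow> nat set"
  where "component_from U m = {k. m \<le> k \<and> {m..k} \<subseteq> U}"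

definition components :: "nat set \<Rightarrow> nat set list"
  where "components U = map (component_from U) (sorted_list_of_set (left_endpoints U))"

lemma component_from_unique:
  assumes "m \<in> left_endpoints U" "m' \<in> left_endpoints U" "p \<in> component_from U m" "p \<in> component_from U m'"
  shows "m = m'"
proof -
  have False if "m < m'" "m' \<in> left_endpoints U" "p \<in> component_from U m" "p \<in> component_from U m'" for m m'
  proof -
    from that have "m' - 1 \<in> {m..p}" by (auto simp: component_from_def)
    then have "m' - 1 \<in> U" using that(3) by (auto simp: component_from_def)
    moreover have "Suc (m' - 1) = m'" using that(1) by simp
    ultimately show False using that(2) by (auto simp: left_endpoints_def)
  qed
  with assms show ?thesis by (metis linorder_neqE_nat)
qed

lemma ex_left_endpoint:
  assumes "p \<in> U"
  shows "\<exists>m\<in>left_endpoints U. p \<in> component_from U m"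
proof -
  define m where "m = (LEAST m. m \<le> p \<and> {m..p} \<subseteq> U)"
  have m: "m \<le> p" "{m..p} \<subseteq> U"
    using LeastI[of "\<lambda>m. m \<le> p \<and> {m..p} \<subseteq> U" p] assms by (auto simp: m_def)
  have "False" if "k \<in> U" "Suc k = m" for k
  proof -
    have "{k..p} = insert k {m..p}" using that m by auto
    then have "k \<le> p \<and> {k..p} \<subseteq> U" using that m by auto
    then have "m \<le> k" unfolding m_def by (rule Least_le)
    with that show False by simp
  qed
  then have "m \<in> left_endpoints U" using m by (auto simp: left_endpoints_def)
  then show ?thesis using m by (auto simp: component_from_def)
qed

text \<open>These are indeed the maximal nonempty intervals contained in \<open>U\<close>, ordered by their minima.\<close>

lemma set_components:
  assumes "finite U"
  shows "set (components U) =
    {{i..j} | i j. i \<le> j \<and> {i..j} \<subseteq> U \<and> (\<forall>i' j'. {i..j} \<subseteq> {i'..j'} \<and> {i'..j'} \<subseteq> U \<longrightarrow> {i'..j'} = {i..j})}"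
    (is "_ = ?M")
proof -
  have fin: "finite (left_endpoints U)" using assms by (simp add: left_endpoints_def)
  have comp: "\<exists>j\<ge>m. component_from U m = {m..j} \<and> Suc j \<notin> U" if m: "m \<in> left_endpoints U" for m
  proof -
    have "component_from U m \<subseteq> U" by (auto simp: component_from_def)
    then have f: "finite (component_from U m)" using assms finite_subset by blast
    have mm: "m \<in> component_from U m" using m by (auto simp: component_from_def left_endpoints_def)
    define j where "j = Max (component_from U m)"
    have j: "j \<in> component_from U m" unfolding j_def using f mm by (intro Max_in) auto
    have "component_from U m = {m..j}"
    proof (intro equalityI subsetI)
      fix k assume "k \<in> component_from U m"
      then show "k \<in> {m..j}" using Max_ge[OF f] by (auto simp: j_def component_from_def)
    next
      fix k assume k: "k \<in> {m..j}"
      then have "{m..k} \<subseteq> {m..j}" by auto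
      then show "k \<in> component_from U m" using k j by (auto simp: component_from_def)
    qed
    moreover have "Suc j \<notin> U"
    proof
      assume "Suc j \<in> U"
      moreover have "{m..Suc j} = insert (Suc j) {m..j}" using j by (auto simp: component_from_def)
      ultimately have "Suc j \<in> component_from U m" using j by (auto simp: component_from_def)
      then show False using Max_ge[OF f, of "Suc j"] by (simp add: j_def)
    qed
    ultimately show ?thesis using j by (auto simp: component_from_def)
  qed
  have "component_from U ` left_endpoints U = ?M"
  proof (intro equalityI subsetI)
    fix J assume "J \<in> component_from U ` left_endpoints U"
    then obtain m j where m: "m \<in> left_endpoints U" "J = {m..j}" "m \<le> j" "Suc j \<notin> U"
        "component_from U m = {m..j}"
      using comp by blast
    have "{m..j} \<subseteq> U" using m(5) by (auto simp: component_from_def)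
    moreover have "{i'..j'} = {m..j}" if "{m..j} \<subseteq> {i'..j'}" "{i'..j'} \<subseteq> U" for i' j'
    proof -
      have le: "i' \<le> m" "j \<le> j'" using that(1) m(3) by auto
      have "i' = m"
      proof (rule ccontr)
        assume "i' \<noteq> m"
        then have "m - 1 \<in> {i'..j'}" "Suc (m - 1) = m" using le m(3) by auto
        then show False using that(2) m(1) by (auto simp: left_endpoints_def)
      qed
      moreover have "j' = j"
      proof (rule ccontr)
        assume "j' \<noteq> j"
        then have "Suc j \<in> {i'..j'}" using le m(3) by auto
        then show False using that(2) m(4) by auto
      qed
      ultimately show ?thesis by simp
    qed
    ultimately show "J \<in> ?M"
      unfolding mem_Collect_eq using m(2,3)
      by - (rule exI[of _ m], rule exI[of _ j], intro conjI allI impI, simp_all only:)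
  next
    fix J assume "J \<in> ?M"
    then obtain i j where J: "J = {i..j}" "i \<le> j" "{i..j} \<subseteq> U"
        and all: "\<forall>i' j'. {i..j} \<subseteq> {i'..j'} \<and> {i'..j'} \<subseteq> U \<longrightarrow> {i'..j'} = {i..j}"
      unfolding mem_Collect_eq by (elim exE conjE)
    have max: "{i..j} \<subseteq> {i'..j'} \<Longrightarrow> {i'..j'} \<subseteq> U \<Longrightarrow> {i'..j'} = {i..j}" for i' j'
      by (rule all[rule_format]) (rule conjI)
    have "i \<in> U" using J by auto
    obtain m where m: "m \<in> left_endpoints U" "i \<in> component_from U m"
      using ex_left_endpoint[OF \<open>i \<in> U\<close>] by blast
    obtain j' where j': "component_from U m = {m..j'}" "Suc j' \<notin> U" using comp[OF m(1)] by blast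
    have "j \<le> j'"
    proof (rule ccontr)
      assume "\<not> j \<le> j'"
      then have "Suc j' \<in> {i..j}" using m(2) j'(1) by auto
      then show False using J(3) j'(2) by auto
    qed
    then have "{i..j} \<subseteq> {m..j'}" using m(2) j'(1) by auto
    moreover have "{m..j'} \<subseteq> U" using j'(1) by (auto simp: component_from_def)
    ultimately have "{m..j'} = {i..j}" by (rule max)
    then show "J \<in> component_from U ` left_endpoints U" using m j' J by auto
  qed
  then show ?thesis using fin by (simp add: components_def)
qed

lemma sorted_components:
  assumes "finite U"
  shows "sorted_wrt (<) (map Min (components U))"
proof -
  have fin: "finite (left_endpoints U)" using assms by (simp add: left_endpoints_def)
  have "Min (component_from U m) = m" if "m \<in> left_endpoints U" for m
  proof (rule Min_eqI)
    have "component_from U m \<subseteq> U" by (auto simp: component_from_def)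
    then show "finite (component_from U m)" using assms finite_subset by blast
    show "m \<in> component_from U m" using that by (auto simp: component_from_def left_endpoints_def)
  qed (auto simp: component_from_def)
  then have "map Min (components U) = sorted_list_of_set (left_endpoints U)"
    using fin by (simp add: components_def o_def) (rule map_idI, simp)
  then show ?thesis by simp
qed

definition component_words :: "'a word \<Rightarrow> nat set \<Rightarrow> 'a word list"
  where "component_words w S = map (\<lambda>J. Word (nths (letters w) J)) (components (positions w - S))"

definition coproduct_term ::
    "'a::complex_vector word \<Rightarrow> nat set \<Rightarrow> ('a double_tensor, 'a double_tensor) tensor"
  where "coproduct_term w S = barred (subword w S) \<otimes> barred (component_words w S)"

definition coproduct_word :: "'a::complex_vector word \<Rightarrow> ('a double_tensor, 'a double_tensor) tensor"
  where "coproduct_word w = (\<Sum>S\<in>Pow (positions w). coproduct_term w S)"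

definition coproduct_word_left :: "'a::complex_vector word \<Rightarrow> ('a double_tensor, 'a double_tensor) tensor"
  where "coproduct_word_left w = (\<Sum>S | S \<subseteq> positions w \<and> 0 \<in> S. coproduct_term w S)"

definition coproduct_word_right :: "'a::complex_vector word \<Rightarrow> ('a double_tensor, 'a double_tensor) tensor"
  where "coproduct_word_right w = (\<Sum>S | S \<subseteq> positions w \<and> 0 \<notin> S. coproduct_term w S)"

definition coproduct :: "'a::complex_vector double_tensor \<Rightarrow> ('a double_tensor, 'a double_tensor) tensor"
  where "coproduct = dt_ext (\<lambda>ws. prod_list (map coproduct_word ws))"

text \<open>
  The half-coproducts live on the augmentation ideal; they are extended to the whole double tensor
  algebra by \<open>0\<close> on the unit, so that half-shuffle products vanish there.
\<close>

definition coproduct_left :: "'a::complex_vector double_tensor \<Rightarrow> ('a double_tensor, 'a double_tensor) tensor"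
  where "coproduct_left = dt_ext (\<lambda>ws. case ws of [] \<Rightarrow> 0
    | w # ws' \<Rightarrow> coproduct_word_left w * prod_list (map coproduct_word ws'))"

definition coproduct_right :: "'a::complex_vector double_tensor \<Rightarrow> ('a double_tensor, 'a double_tensor) tensor"
  where "coproduct_right = dt_ext (\<lambda>ws. case ws of [] \<Rightarrow> 0
    | w # ws' \<Rightarrow> coproduct_word_right w * prod_list (map coproduct_word ws'))"

text \<open>The defining formulas respect linearity in each letter.\<close>

lemma nths_append_Cons:
  "nths (xs @ a # ys) S = nths xs S @ (if length xs \<in> S then [a] else []) @ nths ys {j. Suc (length xs + j) \<in> S}"
  by (simp add: nths_append nths_Cons add.commute)

lemma components_split:
  assumes "finite U" "p \<in> U"
  shows "\<exists>Js J Ks. components U = Js @ J # Ks \<and> p \<in> J \<and> (\<forall>K\<in>set Js \<union> set Ks. p \<notin> K)"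
proof -
  obtain m where m: "m \<in> left_endpoints U" "p \<in> component_from U m"
    using ex_left_endpoint[OF assms(2)] by blast
  have fin: "finite (left_endpoints U)" using assms by (simp add: left_endpoints_def)
  then obtain ms ns where ms: "sorted_list_of_set (left_endpoints U) = ms @ m # ns"
    using m by (metis set_sorted_list_of_set split_list)
  have "distinct (ms @ m # ns)" by (metis ms distinct_sorted_list_of_set)
  moreover have "set (ms @ m # ns) = left_endpoints U" using fin by (simp flip: ms)
  ultimately have "p \<notin> component_from U k" if "k \<in> set ms \<union> set ns" for k
    using that component_from_unique[OF m(1) _ m(2)] by auto
  then show ?thesis
    using m(2) by (intro exI[of _ "map (component_from U) ms"] exI[of _ "component_from U m"]
        exI[of _ "map (component_from U) ns"]) (auto simp: components_def ms)
qed

lemma clinear_coproduct_term: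
  assumes "S \<subseteq> {..<length xs + Suc (length ys)}"
  shows "clinear (\<lambda>a. coproduct_term (Word (xs @ a # ys)) S)"
proof (cases "length xs \<in> S")
  case True
  have not: "length xs \<notin> J" if "J \<in> set (components ({..<length xs + Suc (length ys)} - S))" for J
    using that True by (auto simp: components_def component_from_def)
  have *: "component_words (Word (xs @ a # ys)) S =
      map (\<lambda>J. Word (nths xs J @ nths ys {j. Suc (length xs + j) \<in> J})) (components ({..<length xs + Suc (length ys)} - S))" for a
    unfolding component_words_def using not by (auto simp: nths_append_Cons)
  have "subword (Word (xs @ a # ys)) S = [Word (nths xs S @ a # nths ys {j. Suc (length xs + j) \<in> S})]" for a
    using True by (simp add: subword_def nths_append_Cons)
  then show ?thesis
    using clinear_barred[of "[]" "nths xs S" "nths ys {j. Suc (length xs + j) \<in> S}" "[]"]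
    by (simp add: coproduct_term_def * clinear_iff pure_tensor_bilinear)
next
  case False
  have "length xs \<in> {..<length xs + Suc (length ys)} - S" using False by simp
  then obtain Js J Ks where c: "components ({..<length xs + Suc (length ys)} - S) = Js @ J # Ks"
      "length xs \<in> J" "\<forall>K\<in>set Js \<union> set Ks. length xs \<notin> K"
    using components_split by (metis finite_Diff finite_lessThan)
  let ?W = "\<lambda>J. Word (nths xs J @ nths ys {j. Suc (length xs + j) \<in> J})"
  have *: "component_words (Word (xs @ a # ys)) S =
      map ?W Js @ Word (nths xs J @ a # nths ys {j. Suc (length xs + j) \<in> J}) # map ?W Ks" for a
    using c by (auto simp: component_words_def nths_append_Cons)
  have **: "subword (Word (xs @ a # ys)) S =
      (let as = nths xs S @ nths ys {j. Suc (length xs + j) \<in> S} in if as = [] then [] else [Word as])" for a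
    using False by (simp add: subword_def nths_append_Cons)
  show ?thesis
    using clinear_barred[of "map ?W Js" "nths xs J" "nths ys {j. Suc (length xs + j) \<in> J}" "map ?W Ks"]
    by (simp add: coproduct_term_def * ** clinear_iff pure_tensor_bilinear)
qed

lemma clinear_coproduct_term_sum:
  assumes "\<And>S. S \<in> A \<Longrightarrow> S \<subseteq> {..<length xs + Suc (length ys)}"
  shows "clinear (\<lambda>a. \<Sum>S\<in>A. coproduct_term (Word (xs @ a # ys)) S)"
  using clinear_coproduct_term[of _ xs ys] assms
  by (simp add: clinear_iff sum.distrib cvs.scale_sum_right)

lemma clinear_coproduct_word: "clinear (\<lambda>a. coproduct_word (Word (xs @ a # ys)))"
  and clinear_coproduct_word_left: "clinear (\<lambda>a. coproduct_word_left (Word (xs @ a # ys)))"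
  and clinear_coproduct_word_right: "clinear (\<lambda>a. coproduct_word_right (Word (xs @ a # ys)))"
  unfolding coproduct_word_def coproduct_word_left_def coproduct_word_right_def
  by (simp_all, (rule clinear_coproduct_term_sum, auto)+)

lemma coproduct_multilinear: "letter_multilinear (\<lambda>ws. prod_list (map coproduct_word ws))"
  by (simp add: letter_multilinear_def clinear_iff algebra_simps
      clinear_coproduct_word[unfolded clinear_iff])

lemma half_coproduct_multilinear:
  assumes "\<And>xs ys. clinear (\<lambda>a. d (Word (xs @ a # ys)))"
  shows "letter_multilinear (\<lambda>ws. case ws of [] \<Rightarrow> 0 | w # ws' \<Rightarrow> d w * prod_list (map coproduct_word ws'))"
  unfolding letter_multilinear_def
proof (intro allI)
  fix us vs and xs ys :: "'a list"
  show "clinear (\<lambda>a. case us @ Word (xs @ a # ys) # vs of [] \<Rightarrow> 0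
    | w # ws' \<Rightarrow> d w * prod_list (map coproduct_word ws'))"
    using assms
    by (cases us) (simp_all add: clinear_iff algebra_simps
      clinear_coproduct_word[unfolded clinear_iff])
qed

lemma coproduct_barred: "coproduct (barred ws) = prod_list (map coproduct_word ws)"
  by (simp add: coproduct_def dt_ext_barred coproduct_multilinear)

lemma coproduct_left_barred:
  "coproduct_left (barred ws) = (case ws of [] \<Rightarrow> 0
    | w # ws' \<Rightarrow> coproduct_word_left w * prod_list (map coproduct_word ws'))"
  unfolding coproduct_left_def
  by (rule dt_ext_barred, rule half_coproduct_multilinear, rule clinear_coproduct_word_left)

lemma coproduct_right_barred:
  "coproduct_right (barred ws) = (case ws of [] \<Rightarrow> 0
    | w # ws' \<Rightarrow> coproduct_word_right w * prod_list (map coproduct_word ws'))"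
  unfolding coproduct_right_def
  by (rule dt_ext_barred, rule half_coproduct_multilinear, rule clinear_coproduct_word_right)

lemma clinear_coproduct: "clinear coproduct"
  and clinear_coproduct_left: "clinear coproduct_left"
  and clinear_coproduct_right: "clinear coproduct_right"
  unfolding coproduct_def coproduct_left_def coproduct_right_def
  by (intro clinear_dt_ext coproduct_multilinear half_coproduct_multilinear
      clinear_coproduct_word_left clinear_coproduct_word_right)+

lemma coproduct_mult: "coproduct (x * y) = coproduct x * coproduct y"
proof (induction x rule: double_tensor_induct)
  case (barred us)
  show ?case
  proof (induction y rule: double_tensor_induct)
    case (barred vs)
    show ?case by (simp add: times_barred coproduct_barred)
  qed (simp_all add: distrib_left clinear_add[OF clinear_coproduct] clinear_scale[OF clinear_coproduct])
qed (simp_all add: distrib_right clinear_add[OF clinear_coproduct] clinear_scale[OF clinear_coproduct])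

lemma coproduct_word_split: "coproduct_word w = coproduct_word_left w + coproduct_word_right w"
proof -
  have "Pow (positions w) = {S. S \<subseteq> positions w \<and> 0 \<in> S} \<union> {S. S \<subseteq> positions w \<and> 0 \<notin> S}"
    by auto
  moreover have "finite {S. S \<subseteq> positions w \<and> 0 \<in> S}" "finite {S. S \<subseteq> positions w \<and> 0 \<notin> S}"
    by (rule finite_subset[of _ "Pow (positions w)"]; auto)+
  ultimately show ?thesis
    unfolding coproduct_word_def coproduct_word_left_def coproduct_word_right_def
    by (simp only:) (rule sum.union_disjoint, auto)
qed

lemma coproduct_split_barred:
  "ws \<noteq> [] \<Longrightarrow> coproduct (barred ws) = coproduct_left (barred ws) + coproduct_right (barred ws)"
  by (cases ws)
    (simp_all add: coproduct_barred coproduct_left_barred coproduct_right_barred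
      coproduct_word_split distrib_right)


section \<open>Products of linear forms\<close>

definition tensor_map ::
    "('a::complex_vector \<Rightarrow> 'c::complex_vector) \<Rightarrow> ('b::complex_vector \<Rightarrow> 'd::complex_vector)
      \<Rightarrow> ('a, 'b) tensor \<Rightarrow> ('c, 'd) tensor"
  where "tensor_map f g = tensor_ext (\<lambda>x y. f x \<otimes> g y)"

definition mult_complex :: "(complex, complex) tensor \<Rightarrow> complex"
  where "mult_complex = tensor_ext (*)"

lemma tensor_map_pure:
  assumes "clinear f" "clinear g"
  shows "tensor_map f g (x \<otimes> y) = f x \<otimes> g y"
  unfolding tensor_map_def
  by (rule tensor_ext_pure)
    (use assms in \<open>simp add: bilinear_map_def clinear_iff pure_tensor_bilinear\<close>)

lemma mult_complex_pure: "mult_complex (x \<otimes> y) = x * y"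
  unfolding mult_complex_def
  by (rule tensor_ext_pure) (simp add: bilinear_map_def clinear_iff algebra_simps)

type_synonym 'a form = "'a double_tensor \<Rightarrow> complex"

definition conv :: "'a::complex_vector form \<Rightarrow> 'a form \<Rightarrow> 'a form"  (infixl \<open>\<star>\<close> 70)
  where "f \<star> g = (\<lambda>x. mult_complex (tensor_map f g (coproduct x)))"

definition left_half_shuffle :: "'a::complex_vector form \<Rightarrow> 'a form \<Rightarrow> 'a form"  (infixl \<open>\<prec>\<close> 70)
  where "f \<prec> g = (\<lambda>x. mult_complex (tensor_map f g (coproduct_left x)))"

definition right_half_shuffle :: "'a::complex_vector form \<Rightarrow> 'a form \<Rightarrow> 'a form"  (infixl \<open>\<succ>\<close> 70)
  where "f \<succ> g = (\<lambda>x. mult_complex (tensor_map f g (coproduct_right x)))"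

definition character :: "'a::complex_vector form \<Rightarrow> bool"
  where "character \<Phi> \<longleftrightarrow> clinear \<Phi> \<and> \<Phi> 1 = 1 \<and> (\<forall>x y. \<Phi> (x * y) = \<Phi> x * \<Phi> y)"

definition infinitesimal_character :: "'a::complex_vector form \<Rightarrow> bool"
  where "infinitesimal_character \<alpha> \<longleftrightarrow>
    clinear \<alpha> \<and> \<alpha> 1 = 0 \<and> (\<forall>ws. length ws \<ge> 2 \<longrightarrow> \<alpha> (barred ws) = 0)"

definition conv_inverse :: "'a::complex_vector form \<Rightarrow> 'a form"
  where "conv_inverse \<Phi> = (THE \<Psi>. character \<Psi> \<and> \<Phi> \<star> \<Psi> = counit \<and> \<Psi> \<star> \<Phi> = counit)"

primrec right_half_power :: "'a::complex_vector form \<Rightarrow> nat \<Rightarrow> 'a form"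
  where
    "right_half_power \<alpha> 0 = counit"
  | "right_half_power \<alpha> (Suc n) = right_half_power \<alpha> n \<succ> \<alpha>"

text \<open>
  For an infinitesimal character \<open>\<alpha>\<close> only finitely many summands are nonzero at any given argument,
  so the series is summed pointwise as a finite sum over its nonzero terms.
\<close>

definition right_half_exp :: "'a::complex_vector form \<Rightarrow> 'a form"  (\<open>\<E>\<^sub>\<succ>\<close>)
  where "right_half_exp \<alpha> = (\<lambda>x. Sum_any (\<lambda>n. right_half_power \<alpha> n x))"


section \<open>\<open>t\<close>-Boolean cumulants\<close>

definition noncrossing :: "nat set set \<Rightarrow> bool"
  where "noncrossing \<pi> \<longleftrightarrow>
    \<not> (\<exists>V\<in>\<pi>. \<exists>W\<in>\<pi>. V \<noteq> W \<and> (\<exists>a\<in>V. \<exists>b\<in>W. \<exists>c\<in>V. \<exists>d\<in>W. a < b \<and> b < c \<and> c < d))"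

text \<open>Noncrossing partitions of \<open>{0, \<dots>, n - 1}\<close>.\<close>

definition NC :: "nat \<Rightarrow> nat set set set"
  where "NC n = {\<pi>. partition_on {..<n} \<pi> \<and> noncrossing \<pi>}"

definition inner_blocks :: "nat set set \<Rightarrow> nat set set"
  where "inner_blocks \<pi> = {V \<in> \<pi>. \<exists>W\<in>\<pi>. W \<noteq> V \<and> (\<exists>a\<in>W. \<exists>b\<in>W. \<forall>c\<in>V. a < c \<and> c < b)}"

definition inner :: "nat set set \<Rightarrow> nat"
  where "inner \<pi> = card (inner_blocks \<pi>)"

lemma length_nths_block:
  assumes "\<pi> \<in> NC n - {{{..<n}}}" "V \<in> \<pi>" "n = length as"
  shows "length (nths as V) < length as"
proof -
  have p: "partition_on {..<n} \<pi>" using assms by (simp add: NC_def)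
  then have sub: "V \<subseteq> {..<n}" using assms(2) by (auto simp: partition_on_def)
  have "V \<noteq> {..<n}"
  proof
    assume V: "V = {..<n}"
    have "W = V" if "W \<in> \<pi>" for W
    proof (rule ccontr)
      assume "W \<noteq> V"
      then have "W \<inter> V = {}" "W \<subseteq> {..<n}" "W \<noteq> {}"
        using p that assms(2) unfolding partition_on_def disjoint_def by auto
      then show False using V by auto
    qed
    then have "\<pi> = {V}" using assms(2) by blast
    then show False using assms(1) V by simp
  qed
  then have "V \<subset> {..<n}" using sub by blast
  then have "card V < n" using psubset_card_mono[of "{..<n}" V] by simp
  moreover have "{i. i < length as \<and> i \<in> V} = V" using sub assms(3) by auto
  ultimately show ?thesis by (simp add: length_nths assms(3))
qed

text \<open>
  The \<open>t\<close>-Boolean cumulant \<open>b\<^sub>n(a\<^sub>1, \<dots>, a\<^sub>n)\<close> is obtained by solving the moment-cumulant formula for the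
  term of the one-block partition, whose block is not inner. The value at the empty list is irrelevant.
\<close>

function t_boolean_cumulant :: "('a::monoid_mult \<Rightarrow> complex) \<Rightarrow> real \<Rightarrow> 'a list \<Rightarrow> complex"
  where "t_boolean_cumulant \<phi> t as = \<phi> (prod_list as)
    - (\<Sum>\<pi>\<in>NC (length as) - {{{..<length as}}}.
        of_real t ^ inner \<pi> * (\<Prod>V\<in>\<pi>. t_boolean_cumulant \<phi> t (nths as V)))"
  by auto
termination
  by (relation "measure (\<lambda>(\<phi>, t, as). length as)") (auto intro: length_nths_block)

declare t_boolean_cumulant.simps [simp del]

lemma finite_NC: "finite (NC n)"
proof (rule finite_subset)
  show "NC n \<subseteq> Pow (Pow {..<n})" by (auto simp: NC_def partition_on_def)
qed simp

lemma moment_t_boolean_cumulant: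
  assumes "as \<noteq> []"
  shows "\<phi> (prod_list as) =
    (\<Sum>\<pi>\<in>NC (length as). of_real t ^ inner \<pi> * (\<Prod>V\<in>\<pi>. t_boolean_cumulant \<phi> t (nths as V)))"
proof -
  let ?one = "{{..<length as}}"
  have "?one \<in> NC (length as)"
    using assms by (simp add: NC_def partition_on_def noncrossing_def eq_commute[of "{}"] lessThan_empty_iff)
  moreover have "inner ?one = 0" by (simp add: inner_def inner_blocks_def)
  moreover have "(\<Prod>V\<in>?one. t_boolean_cumulant \<phi> t (nths as V)) = t_boolean_cumulant \<phi> t as"
    by simp
  ultimately have "(\<Sum>\<pi>\<in>NC (length as). of_real t ^ inner \<pi> * (\<Prod>V\<in>\<pi>. t_boolean_cumulant \<phi> t (nths as V)))
    = t_boolean_cumulant \<phi> t as + (\<Sum>\<pi>\<in>NC (length as) - {?one}.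
        of_real t ^ inner \<pi> * (\<Prod>V\<in>\<pi>. t_boolean_cumulant \<phi> t (nths as V)))"
    by (simp add: sum.remove[OF finite_NC] del: prod.insert)
  then show ?thesis
    by (subst (asm) (2) t_boolean_cumulant.simps) simp
qed

end

theory Submission
  imports Defs
begin

text \<open>
  Write \<open>\<Phi>\<^sub>t = \<E>\<^sub>\<succ>(t\<beta>)\<close> and \<open>\<gamma> = \<Phi>\<^sub>t \<succ> \<beta>\<close>, so that \<open>\<beta>\<^sub>t = \<gamma> \<prec> \<Phi>\<^sub>t\<^sup>-\<^sup>1\<close>. Since \<open>\<beta>\<close> is infinitesimal, only one
  component can survive in \<open>\<Delta>\<^sub>\<succ>\<close>, namely a prefix, and \<open>\<gamma>(w) = \<Sum> \<beta>(u) \<Phi>\<^sub>t(v)\<close> over the splittings \<open>w = u v\<close>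
  with \<open>u\<close> nonempty. The same sum, with \<open>t\<beta>\<close> or with \<open>\<beta>\<close> and the character itself, computes \<open>\<Phi>\<^sub>t(w)\<close>
  and \<open>\<Phi>(w)\<close>: the form \<open>\<beta>\<close> is the Boolean cumulant form of \<open>\<Phi>\<close>, and \<open>t\<beta>\<close> that of \<open>\<Phi>\<^sub>t\<close>. Undoing the right
  factor gives \<open>\<gamma> = \<beta>\<^sub>t \<prec> \<Phi>\<^sub>t\<close>. Hence \<open>\<Phi>\<^sub>t = \<epsilon> + t\<beta>\<^sub>t \<prec> \<Phi>\<^sub>t\<close>, which says that \<open>t\<beta>\<^sub>t\<close> are the free
  cumulants of \<open>\<Phi>\<^sub>t\<close>, i.e.
  \<open>\<Phi>\<^sub>t(w) = \<Sum> t\<^bsup>|\<pi>|\<^esup> \<beta>\<^bsub>t,\<pi>\<^esub>(w)\<close>, summed over the noncrossing partitions \<open>\<pi>\<close>.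

  Consequently the Boolean cumulant \<open>\<beta>(w)\<close> is the sum of \<open>t\<^bsup>|\<pi>| - 1\<^esup> \<beta>\<^bsub>t,\<pi>\<^esub>(w)\<close> over the noncrossing
  partitions with a single outer block, where \<open>|\<pi>| - 1\<close> counts the inner blocks. To avoid dividing by
  \<open>t\<close>, this is read off from the two expressions of \<open>\<gamma>\<close>: cutting \<open>\<beta>\<^sub>t \<prec> \<Phi>\<^sub>t\<close> behind the last
  letter of the block of the first letter gives \<open>\<gamma>(w) = \<Sum> I(u) \<Phi>\<^sub>t(v)\<close>, where \<open>I\<close>
  denotes that sum over partitions with a single outer block, and comparing with
  \<open>\<gamma>(w) = \<Sum> \<beta>(u) \<Phi>\<^sub>t(v)\<close> yields \<open>I = \<beta>\<close> by induction on the length. Finally \<open>\<Phi>\<close> is the sum of products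
  of the \<open>I(u)\<close> over all factorisations of \<open>w\<close>, i.e. the sum of \<open>t\<^bsup>inner(\<pi>)\<^esup> \<beta>\<^bsub>t,\<pi>\<^esub>\<close> over all noncrossing
  partitions. This is the moment-cumulant formula that characterises the \<open>t\<close>-Boolean cumulants.

  Everything is carried out with functions of lists of letters. A character is determined by its
  values on words, and a coproduct followed by a product of values becomes the sum \<open>gap_sum\<close>, which
  has a recursion on the first letter. Its associativity (\<open>gap_conv_assoc\<close>) makes the characters a
  group and yields \<open>\<gamma> = \<beta>\<^sub>t \<prec> \<Phi>\<^sub>t\<close> (\<open>conjugate_on_list\<close>); its behaviour under cutting (\<open>gap_sum_cut\<close>)
  gives \<open>I\<close>; and the decomposition of a noncrossing partition along the block of the first point
  (\<open>nc_moment_Cons\<close>) expresses the partition sums through it. The argument comparing the three sums is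
  \<open>nc_moment_of_conjugate\<close>.
\<close>

section \<open>Sums over the gaps of a subword\<close>

text \<open>
  A subword \<open>s\<^sub>1 \<cdots> s\<^sub>l\<close> of \<open>w\<close> determines a factorisation \<open>w = u\<^sub>0 s\<^sub>1 u\<^sub>1 \<cdots> s\<^sub>l u\<^sub>l\<close> with possibly empty
  gaps \<open>u\<^sub>i\<close>. For \<open>l \<ge> 1\<close> it contributes \<open>p(u\<^sub>0) f(s\<^sub>1 \<cdots> s\<^sub>l) g(u\<^sub>1) \<cdots> g(u\<^bsub>l-1\<^esub>) m(u\<^sub>l)\<close>, and the empty
  subword contributes \<open>f([]) l(w)\<close>. The first letter of the word is either appended to the
  gap under construction, which changes \<open>p\<close> and \<open>l\<close>, or taken into the subword, which changes \<open>f\<close> and opens a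
  new gap. The separate weight of the final gap is what distinguishes outer from inner blocks later on.
\<close>

fun gap_sum :: "('b list \<Rightarrow> 'c::comm_ring_1) \<Rightarrow> ('b list \<Rightarrow> 'c) \<Rightarrow> ('b list \<Rightarrow> 'c)
    \<Rightarrow> ('b list \<Rightarrow> 'c) \<Rightarrow> ('b list \<Rightarrow> 'c) \<Rightarrow> 'b list \<Rightarrow> 'c"
  where
    "gap_sum f p l g m [] = f [] * l []"
  | "gap_sum f p l g m (a # x) =
      gap_sum f (\<lambda>u. p (a # u)) (\<lambda>u. l (a # u)) g m x + p [] * gap_sum (\<lambda>v. f (a # v)) g m g m x"

text \<open>
  With \<open>p = g\<close> this is the convolution of \<open>f\<close> with a character \<open>g\<close>, evaluated on a word. A different
  weight \<open>p\<close> for the first gap is needed to make the associativity law provable by induction.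
\<close>

abbreviation gap_conv :: "('b list \<Rightarrow> 'c::comm_ring_1) \<Rightarrow> ('b list \<Rightarrow> 'c) \<Rightarrow> ('b list \<Rightarrow> 'c)
    \<Rightarrow> 'b list \<Rightarrow> 'c"
  where "gap_conv f p g \<equiv> gap_sum f p p g g"

abbreviation empty_indicator :: "'b list \<Rightarrow> 'c::comm_ring_1"
  where "empty_indicator \<equiv> (\<lambda>u. if u = [] then 1 else 0)"

lemma gap_sum_add_word:
  "gap_sum (\<lambda>v. f v + f' v) p l g m x = gap_sum f p l g m x + gap_sum f' p l g m x"
proof (induction x arbitrary: f f' p l)
  case Nil
  show ?case by (simp add: algebra_simps)
next
  case (Cons a x)
  show ?case
    unfolding gap_sum.simps Cons.IH by (simp only: distrib_left add.assoc add.left_commute)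
qed

lemma gap_sum_scale_word:
  "gap_sum (\<lambda>v. c * f v) p l g m x = c * gap_sum f p l g m x"
proof (induction x arbitrary: f p l)
  case Nil
  show ?case by (simp add: algebra_simps)
next
  case (Cons a x)
  show ?case
    unfolding gap_sum.simps Cons.IH by (simp only: distrib_left mult.left_commute)
qed

lemma gap_sum_zero_word: "gap_sum (\<lambda>v. 0) p l g m x = 0"
  using gap_sum_scale_word[of 0 "\<lambda>v. 0"] by simp

lemma gap_conv_add_first:
  "gap_conv f (\<lambda>u. p u + p' u) g x = gap_conv f p g x + gap_conv f p' g x"
proof (induction x arbitrary: p p')
  case Nil
  show ?case by (simp add: algebra_simps)
next
  case (Cons a x)
  show ?case
    unfolding gap_sum.simps Cons.IH by (simp only: distrib_right add.assoc add.left_commute)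
qed

lemma gap_conv_scale_first: "gap_conv f (\<lambda>u. c * p u) g x = c * gap_conv f p g x"
proof (induction x arbitrary: p)
  case Nil
  show ?case by (simp add: algebra_simps)
next
  case (Cons a x)
  show ?case
    unfolding gap_sum.simps Cons.IH by (simp only: distrib_left mult.assoc)
qed

text \<open>
  Coassociativity of the coproduct. Both sides sum over nested subwords: on the right the inner
  subword is chosen first and then the gaps are refined. Because the weight of the first gap is
  free, both sides obey the same recursion on the first letter, so no bookkeeping of the nested gaps
  is required.
\<close>

lemma gap_conv_assoc:
  "gap_conv (gap_conv f p g) q h x = gap_conv f (gap_conv p q h) (gap_conv g h h) x"
proof (induction x arbitrary: f p g q)
  case Nil
  show ?case by (simp add: mult.assoc)
next
  case (Cons a x)
  show ?case
    unfolding gap_sum.simps gap_sum_add_word gap_sum_scale_word gap_conv_add_first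
      gap_conv_scale_first Cons.IH
    by (simp only: distrib_left mult.assoc mult.left_commute add.assoc)
qed

text \<open>
  The empty subword is split off; this is the only summand in which a gap weight is applied to the
  whole word, so the remaining sum depends only on values on shorter words
  (\<open>gap_sum_proper_cong\<close>).
\<close>

lemma gap_sum_split_whole: "gap_sum f p l g m x = f [] * l x + gap_sum f p (\<lambda>u. 0) g m x"
proof (induction x arbitrary: p l)
  case Nil
  show ?case by simp
next
  case (Cons a x)
  show ?case
    using Cons.IH[of "\<lambda>u. p (a # u)" "\<lambda>u. l (a # u)"] by (simp only: gap_sum.simps add.assoc)
qed

lemma gap_sum_cong:
  assumes "\<And>u. length u \<le> length x \<Longrightarrow> p u = p' u" "\<And>u. length u \<le> length x \<Longrightarrow> l u = l' u"
    "\<And>u. length u \<le> length x \<Longrightarrow> g u = g' u" "\<And>u. length u \<le> length x \<Longrightarrow> m u = m' u"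
  shows "gap_sum f p l g m x = gap_sum f p' l' g' m' x"
  using assms
proof (induction x arbitrary: f p l p' l')
  case Nil
  then show ?case by simp
next
  case (Cons a x)
  have "gap_sum f (\<lambda>u. p (a # u)) (\<lambda>u. l (a # u)) g m x
      = gap_sum f (\<lambda>u. p' (a # u)) (\<lambda>u. l' (a # u)) g' m' x"
    by (rule Cons.IH) (simp_all add: Cons.prems)
  moreover have "gap_sum (\<lambda>v. f (a # v)) g m g m x = gap_sum (\<lambda>v. f (a # v)) g' m' g' m' x"
    by (rule Cons.IH) (simp_all add: Cons.prems)
  ultimately show ?case by (simp add: Cons.prems)
qed

lemma gap_sum_proper_cong:
  assumes "\<And>u. length u < length x \<Longrightarrow> p u = p' u"
    "\<And>u. length u < length x \<Longrightarrow> g u = g' u" "\<And>u. length u < length x \<Longrightarrow> m u = m' u"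
  shows "gap_sum f p (\<lambda>u. 0) g m x = gap_sum f p' (\<lambda>u. 0) g' m' x"
  using assms
proof (induction x arbitrary: p p')
  case Nil
  then show ?case by simp
next
  case (Cons a x)
  have "gap_sum f (\<lambda>u. p (a # u)) (\<lambda>u. 0) g m x = gap_sum f (\<lambda>u. p' (a # u)) (\<lambda>u. 0) g' m' x"
    by (rule Cons.IH) (simp_all add: Cons.prems)
  moreover have "gap_sum (\<lambda>v. f (a # v)) g m g m x = gap_sum (\<lambda>v. f (a # v)) g' m' g' m' x"
    by (rule gap_sum_cong) (simp_all add: Cons.prems)
  ultimately show ?case by (simp add: Cons.prems)
qed

lemma gap_conv_empty_word:
  fixes p :: "'a list \<Rightarrow> 'b::comm_ring_1"
  shows "gap_conv empty_indicator p g x = p x"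
proof (cases x)
  case (Cons a y)
  have "gap_sum empty_indicator p (\<lambda>u. 0) g g x = 0" for p :: "'a list \<Rightarrow> 'b"
    by (induction x arbitrary: p) (simp_all add: gap_sum_zero_word)
  then show ?thesis by (subst gap_sum_split_whole) simp
qed simp

lemma gap_conv_zero_first: "gap_conv f (\<lambda>u. 0) g x = 0"
  using gap_conv_scale_first[of f 0 "\<lambda>u. 0"] by simp

lemma gap_conv_empty_gaps: "gap_conv f empty_indicator empty_indicator x = f x"
  by (induction x arbitrary: f) (simp_all add: gap_conv_zero_first)

text \<open>
  Every nonempty subword has a last letter; the index \<open>i\<close> is the position just behind it, and the
  indicator of the empty word as weight of the final gap forces the subword to end at \<open>i\<close>.
\<close>

lemma gap_sum_cut_proper:
  "gap_sum f p (\<lambda>u. 0) g m x =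
    (\<Sum>i\<le>length x. gap_sum f p (\<lambda>u. 0) g empty_indicator (take i x) * m (drop i x))"
proof (induction x arbitrary: f p)
  case Nil
  show ?case by simp
next
  case (Cons a x)
  let ?P = "\<lambda>f p. gap_sum f p (\<lambda>u. 0) g empty_indicator"
  have "gap_sum (\<lambda>v. f (a # v)) g m g m x =
      f [a] * m x + (\<Sum>i\<le>length x. ?P (\<lambda>v. f (a # v)) g (take i x) * m (drop i x))"
    by (subst gap_sum_split_whole) (simp add: Cons.IH)
  also have "f [a] * m x = (\<Sum>i\<le>length x. f [a] * empty_indicator (take i x) * m (drop i x))"
  proof -
    have "(\<Sum>i\<le>length x. f [a] * empty_indicator (take i x) * m (drop i x))
        = (\<Sum>i\<in>{0}. f [a] * empty_indicator (take i x) * m (drop i x))"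
      by (rule sum.mono_neutral_right) auto
    then show ?thesis by simp
  qed
  also have "\<dots> + (\<Sum>i\<le>length x. ?P (\<lambda>v. f (a # v)) g (take i x) * m (drop i x))
      = (\<Sum>i\<le>length x. gap_sum (\<lambda>v. f (a # v)) g empty_indicator g empty_indicator (take i x)
          * m (drop i x))"
    by (subst gap_sum_split_whole[of _ _ "empty_indicator"])
      (simp add: sum.distrib algebra_simps)
  finally have "gap_sum f p (\<lambda>u. 0) g m (a # x) =
      (\<Sum>i\<le>length x. ?P f p (a # take i x) * m (drop i x))"
    using Cons.IH[of f "\<lambda>u. p (a # u)"]
    by (simp add: sum.distrib sum_distrib_left algebra_simps)
  then show ?case by (simp add: sum.atMost_Suc_shift del: sum.atMost_Suc gap_sum.simps(2))
qed

text \<open>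
  In this form the subword is thought of as preceded by one more letter in front of \<open>x\<close>, so that the
  empty subword is also cut behind its last letter, namely at \<open>i = 0\<close>.
\<close>

lemma gap_sum_cut:
  "gap_sum f g m g m x =
    (\<Sum>i\<le>length x. gap_sum f g empty_indicator g empty_indicator (take i x) * m (drop i x))"
proof -
  have "(\<Sum>i\<le>length x. f [] * empty_indicator (take i x) * m (drop i x))
      = (\<Sum>i\<in>{0}. f [] * empty_indicator (take i x) * m (drop i x))"
    by (rule sum.mono_neutral_right) auto
  then have "f [] * m x = (\<Sum>i\<le>length x. f [] * empty_indicator (take i x) * m (drop i x))"
    by simp
  then show ?thesis
    by (subst gap_sum_split_whole, subst gap_sum_split_whole[of _ _ "empty_indicator"])
      (simp add: gap_sum_cut_proper[of f g g m] sum.distrib algebra_simps)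
qed

section \<open>Gap sums as sums over sets of positions\<close>

lemma insert_0_Suc_inject: "insert 0 (Suc ` S) = insert 0 (Suc ` T) \<longleftrightarrow> S = T"
proof
  assume *: "insert 0 (Suc ` S) = insert 0 (Suc ` T)"
  have "A = {k. Suc k \<in> insert 0 (Suc ` A)}" for A by auto
  with * show "S = T" by metis
qed simp

lemma sum_Pow_Suc:
  "(\<Sum>S\<in>Pow {..<Suc n}. h S) =
    (\<Sum>S\<in>Pow {..<n}. h (Suc ` S)) + (\<Sum>S\<in>Pow {..<n}. h (insert 0 (Suc ` S)))"
proof -
  have Pow: "Pow {..<Suc n} = (`) Suc ` Pow {..<n} \<union> (\<lambda>S. insert 0 (Suc ` S)) ` Pow {..<n}"
    by (simp add: lessThan_Suc_eq_insert_0 Pow_insert image_Pow_surj[of Suc "{..<n}", OF refl, symmetric]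
        image_image)
  have inj: "inj_on (\<lambda>S. insert 0 (Suc ` S)) (Pow {..<n})"
    by (rule inj_onI) (simp add: insert_0_Suc_inject)
  have inj2: "inj_on ((`) Suc) (Pow {..<n})" by (rule inj_onI) (simp add: inj_image_eq_iff)
  show ?thesis
    unfolding Pow
    by (subst sum.union_disjoint) (auto simp: sum.reindex[OF inj] sum.reindex[OF inj2])
qed

text \<open>
  The contribution of the gaps, with the union of the gaps given as a set \<open>U\<close> of positions. The
  components of \<open>U\<close> are indexed by their left endpoints; the one at \<open>0\<close>, possibly empty, is the first
  gap, and the final gap is the one that contains the last position.
\<close>

definition gap_weight :: "('b list \<Rightarrow> 'c::comm_ring_1) \<Rightarrow> ('b list \<Rightarrow> 'c)
    \<Rightarrow> ('b list \<Rightarrow> 'c) \<Rightarrow> ('b list \<Rightarrow> 'c) \<Rightarrow> 'b list \<Rightarrow> nat set \<Rightarrow> 'c"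
  where "gap_weight p l g m w U =
    (if U = {..<length w} then l w else p (nths w (component_from U 0))) *
    (\<Prod>j\<in>left_endpoints U - {0}.
      (if length w \<in> Suc ` component_from U j then m else g) (nths w (component_from U j)))"

lemma Suc_image_atLeastAtMost_subset:
  "{Suc m..Suc k} \<subseteq> Suc ` U \<longleftrightarrow> {m..k} \<subseteq> U"
  by (simp flip: image_Suc_atLeastAtMost add: inj_image_subset_iff del: image_Suc_atLeastAtMost)

lemma component_from_Suc: "component_from (Suc ` U) (Suc j) = Suc ` component_from U j"
proof -
  have "k \<in> component_from (Suc ` U) (Suc j) \<longleftrightarrow> k \<in> Suc ` component_from U j" for k
    by (cases k) (auto simp: component_from_def Suc_image_atLeastAtMost_subset
        simp del: image_Suc_atLeastAtMost)
  then show ?thesis by blast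
qed

lemma component_from_insert_Suc:
  "component_from (insert 0 (Suc ` U)) (Suc j) = Suc ` component_from U j"
proof -
  have "{Suc j..k} \<subseteq> insert 0 (Suc ` U) \<longleftrightarrow> {Suc j..k} \<subseteq> Suc ` U" for k by auto
  then show ?thesis
    unfolding component_from_Suc[symmetric] by (simp add: component_from_def)
qed

lemma component_from_insert_0:
  "component_from (insert 0 (Suc ` U)) 0 = insert 0 (Suc ` component_from U 0)"
proof -
  have "k \<in> component_from (insert 0 (Suc ` U)) 0 \<longleftrightarrow> k \<in> insert 0 (Suc ` component_from U 0)" for k
  proof (cases k)
    case (Suc k')
    have "{0..Suc k'} = insert 0 {Suc 0..Suc k'}" by auto
    moreover have "{Suc 0..Suc k'} \<subseteq> insert 0 (Suc ` U) \<longleftrightarrow> {Suc 0..Suc k'} \<subseteq> Suc ` U" by auto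
    ultimately show ?thesis
      using Suc by (auto simp: component_from_def Suc_image_atLeastAtMost_subset
          simp del: image_Suc_atLeastAtMost)
  qed (simp add: component_from_def)
  then show ?thesis by blast
qed

lemma left_endpoints_Suc: "left_endpoints (Suc ` U) = Suc ` left_endpoints U"
  by (auto simp: left_endpoints_def)

lemma left_endpoints_insert_0: "left_endpoints (insert 0 (Suc ` U)) - {0} = Suc ` (left_endpoints U - {0})"
  by (auto simp: left_endpoints_def)

lemma nths_Cons_Suc: "nths (a # x) (Suc ` A) = nths x A"
  and nths_Cons_insert_0: "nths (a # x) (insert 0 (Suc ` A)) = a # nths x A"
  by (simp_all add: nths_Cons image_iff)

lemma insert_0_Suc_eq_lessThan: "insert 0 (Suc ` U) = {..<Suc n} \<longleftrightarrow> U = {..<n}"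
  unfolding lessThan_Suc_eq_insert_0 insert_0_Suc_inject by (rule refl)

lemma gap_weight_insert_0:
  "gap_weight p l g m (a # x) (insert 0 (Suc ` U)) = gap_weight (\<lambda>u. p (a # u)) (\<lambda>u. l (a # u)) g m x U"
  unfolding gap_weight_def left_endpoints_insert_0
  by (simp add: insert_0_Suc_eq_lessThan component_from_insert_0 component_from_insert_Suc
      prod.reindex nths_Cons_Suc nths_Cons_insert_0 inj_image_mem_iff)

text \<open>
  Empty gaps are not components, so the weights have to be \<open>1\<close> on the empty word.
\<close>

lemma prod_components_eq_gap_weight:
  assumes U: "U \<subseteq> {..<length w}" and unit: "g [] = 1" "m [] = 1"
  shows "(\<Prod>J\<leftarrow>components U. (if length w \<in> Suc ` J then m else g) (nths w J)) = gap_weight g m g m w U"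
proof -
  let ?h = "\<lambda>J. (if length w \<in> Suc ` J then m else g) (nths w J)"
  have fin: "finite (left_endpoints U)"
    using U by (auto simp: left_endpoints_def intro: finite_subset)
  have "(\<Prod>J\<leftarrow>components U. ?h J) = (\<Prod>j\<in>left_endpoints U. ?h (component_from U j))"
    using prod.distinct_set_conv_list[of "sorted_list_of_set (left_endpoints U)" "\<lambda>j. ?h (component_from U j)"] fin
    by (simp add: components_def o_def)
  also have "\<dots> = gap_weight g m g m w U"
  proof (cases "0 \<in> U")
    case True
    then have 0: "0 \<in> left_endpoints U" by (simp add: left_endpoints_def)
    have *: "length w \<in> Suc ` component_from U 0 \<longleftrightarrow> U = {..<length w}"
    proof
      assume "length w \<in> Suc ` component_from U 0"
      then obtain k where "length w = Suc k" "{0..k} \<subseteq> U" by (auto simp: component_from_def)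
      with U show "U = {..<length w}" by (auto simp: subset_eq)
    next
      assume "U = {..<length w}"
      with True show "length w \<in> Suc ` component_from U 0"
        by (cases w) (auto simp: component_from_def intro!: image_eqI[of _ _ "length w - 1"])
    qed
    have **: "nths w (component_from U 0) = w" if "U = {..<length w}"
    proof -
      have "component_from U 0 = U" using that by (auto simp: component_from_def)
      then show ?thesis using that by (simp add: nths_all)
    qed
    show ?thesis
      unfolding gap_weight_def prod.remove[OF fin 0] using * ** by auto
  next
    case False
    then have "left_endpoints U - {0} = left_endpoints U" "component_from U 0 = {}"
      by (auto simp: left_endpoints_def component_from_def)
    moreover have "w = []" if "U = {..<length w}" using that False by (cases w) auto
    ultimately show ?thesis unfolding gap_weight_def using unit by auto
  qed
  finally show ?thesis .
qed

lemma gap_weight_Suc: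
  assumes U: "U \<subseteq> {..<length x}" and unit: "g [] = 1" "m [] = 1"
  shows "gap_weight p l g m (a # x) (Suc ` U) = p [] * gap_weight g m g m x U"
proof -
  have fin: "finite (left_endpoints U)"
    using U by (auto simp: left_endpoints_def intro: finite_subset)
  have "Suc ` U \<noteq> {..<Suc (length x)}" by auto
  moreover have "component_from (Suc ` U) 0 = {}" by (force simp: component_from_def)
  moreover have "left_endpoints (Suc ` U) - {0} = Suc ` left_endpoints U"
    by (auto simp: left_endpoints_Suc)
  moreover have "(\<Prod>J\<leftarrow>components U. (if length x \<in> Suc ` J then m else g) (nths x J))
      = (\<Prod>j\<in>left_endpoints U. (if length x \<in> Suc ` component_from U j then m else g)
          (nths x (component_from U j)))"
    using prod.distinct_set_conv_list[of "sorted_list_of_set (left_endpoints U)"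
        "\<lambda>j. (if length x \<in> Suc ` component_from U j then m else g) (nths x (component_from U j))"] fin
    by (simp add: components_def o_def)
  ultimately show ?thesis
    unfolding prod_components_eq_gap_weight[where g = g and m = m, OF assms, symmetric]
    by (simp add: gap_weight_def component_from_Suc prod.reindex nths_Cons_Suc inj_image_mem_iff)
qed

lemma complement_Suc_image:
  "{..<Suc n} - Suc ` S = insert 0 (Suc ` ({..<n} - S))"
  "{..<Suc n} - insert 0 (Suc ` S) = Suc ` ({..<n} - S)"
  unfolding lessThan_Suc_eq_insert_0 by auto

text \<open>
  The link between the recursion and the coproduct, which sums over sets of positions: the sets
  \<open>S \<subseteq> {0..n}\<close> are \<open>S' + 1\<close> and \<open>{0} \<union> (S' + 1)\<close> for \<open>S' \<subseteq> {0..n-1}\<close>, matching the two summands of the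
  recursion.
\<close>

lemma gap_sum_eq_sum_positions:
  assumes unit: "g [] = 1" "m [] = 1"
  shows "(\<Sum>S\<in>Pow {..<length w}. f (nths w S) * gap_weight p l g m w ({..<length w} - S))
    = gap_sum f p l g m w"
proof (induction w arbitrary: f p l)
  case Nil
  show ?case by (simp add: gap_weight_def left_endpoints_def)
next
  case (Cons a x)
  show ?case
    unfolding list.size add_Suc_right add_0_right sum_Pow_Suc complement_Suc_image
      gap_weight_insert_0 nths_Cons_Suc nths_Cons_insert_0
    by (simp add: gap_weight_Suc[where g = g and m = m, OF _ unit] Cons.IH[symmetric] sum_distrib_left algebra_simps
        cong: sum.cong)
qed

lemma gap_conv_eq_sum_positions:
  assumes "g [] = 1"
  shows "(\<Sum>S\<in>Pow {..<length w}. f (nths w S) * (\<Prod>J\<leftarrow>components ({..<length w} - S). g (nths w J)))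
    = gap_conv f g g w"
  using gap_sum_eq_sum_positions[where g = g and m = g and p = g and l = g]
    prod_components_eq_gap_weight[where g = g and m = g] assms
  by (simp cong: sum.cong)

lemma gap_sum_eq_sum_positions_from_first:
  assumes unit: "g [] = 1" "m [] = 1" and w: "w = a # x"
  shows "(\<Sum>S | S \<subseteq> {..<length w} \<and> 0 \<in> S. f (nths w S) *
      (\<Prod>J\<leftarrow>components ({..<length w} - S). (if length w \<in> Suc ` J then m else g) (nths w J)))
    = gap_sum (\<lambda>v. f (a # v)) g m g m x"
proof -
  let ?h = "\<lambda>S. f (nths w S) * gap_weight g m g m w ({..<length w} - S)"
  have inj: "inj_on (\<lambda>S. insert 0 (Suc ` S)) (Pow {..<length x})"
    by (rule inj_onI) (simp add: insert_0_Suc_inject)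
  have "{S. S \<subseteq> {..<length w} \<and> 0 \<in> S} = (\<lambda>S. insert 0 (Suc ` S)) ` Pow {..<length x}"
  proof (intro equalityI subsetI)
    fix S assume S: "S \<in> {S. S \<subseteq> {..<length w} \<and> 0 \<in> S}"
    then have "S = insert 0 (Suc ` {k. Suc k \<in> S})"
      by (auto simp: image_iff) (metis not0_implies_Suc)
    moreover have "{k. Suc k \<in> S} \<in> Pow {..<length x}" using S w by auto
    ultimately show "S \<in> (\<lambda>S. insert 0 (Suc ` S)) ` Pow {..<length x}" by blast
  qed (auto simp: w)
  then have "(\<Sum>S | S \<subseteq> {..<length w} \<and> 0 \<in> S. ?h S) = (\<Sum>S\<in>Pow {..<length x}. ?h (insert 0 (Suc ` S)))"
    by (simp add: sum.reindex[OF inj])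
  also have "\<dots> = (\<Sum>S\<in>Pow {..<length x}. f (a # nths x S) * gap_weight g m g m x ({..<length x} - S))"
    by (rule sum.cong) (auto simp: w complement_Suc_image gap_weight_Suc[where g = g and m = m, OF _ unit] unit nths_Cons_insert_0)
  also have "\<dots> = gap_sum (\<lambda>v. f (a # v)) g m g m x"
    by (rule gap_sum_eq_sum_positions[where g = g and m = m, OF unit])
  finally show ?thesis
    using prod_components_eq_gap_weight[where g = g and m = m, OF _ unit] by simp
qed

section \<open>Evaluating products of linear forms on words\<close>

abbreviation tensor_eval :: "('a::complex_vector \<Rightarrow> complex) \<Rightarrow> ('b::complex_vector \<Rightarrow> complex)
    \<Rightarrow> ('a, 'b) tensor \<Rightarrow> complex"
  where "tensor_eval f g z \<equiv> mult_complex (tensor_map f g z)"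

lemma tensor_eval_pure: "clinear f \<Longrightarrow> clinear g \<Longrightarrow> tensor_eval f g (x \<otimes> y) = f x * g y"
  by (simp add: tensor_map_pure mult_complex_pure)

lemma clinear_tensor_eval:
  assumes "clinear f" "clinear g"
  shows "clinear (tensor_eval f g)"
proof -
  have "clinear (tensor_map f g)"
    unfolding tensor_map_def
    by (rule clinear_tensor_ext) (use assms in \<open>simp add: bilinear_map_def clinear_iff pure_tensor_bilinear del: scaleC_complex_def\<close>)
  moreover have "clinear mult_complex"
    unfolding mult_complex_def
    by (rule clinear_tensor_ext) (simp add: bilinear_map_def clinear_iff algebra_simps)
  ultimately show ?thesis by (simp add: clinear_iff)
qed

text \<open>
  Multiplicativity in the generality needed for forms that are multiplicative only with respect to
  particular left factors, such as infinitesimal characters or \<open>\<Phi> \<succ> \<beta>\<close>.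
\<close>

lemma tensor_eval_pure_mult:
  assumes lin: "clinear f" "clinear g" "clinear f'" "clinear g'"
    and f: "\<And>x. f (a * x) = c * f' x" and g: "\<And>y. g (b * y) = d * g' y"
  shows "tensor_eval f g ((a \<otimes> b) * z) = c * d * tensor_eval f' g' z"
proof (induction z rule: tensor_induct)
  case (pure x y)
  show ?case by (simp add: times_pure_tensor tensor_eval_pure lin f g)
next
  case (add z z')
  then show ?case
    by (simp add: distrib_left clinear_add[OF clinear_tensor_eval] lin)
next
  case (scale k z)
  then show ?case
    by (simp add: clinear_scale[OF clinear_tensor_eval] lin)
qed

lemma clinear_conv: "clinear f \<Longrightarrow> clinear g \<Longrightarrow> clinear (f \<star> g)"
  for f g :: "'a::complex_vector form"
  using clinear_tensor_eval[of f g]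
  by (simp add: conv_def clinear_iff clinear_add[OF clinear_coproduct] clinear_scale[OF clinear_coproduct])

lemma clinear_left_half_shuffle: "clinear f \<Longrightarrow> clinear g \<Longrightarrow> clinear (f \<prec> g)"
  for f g :: "'a::complex_vector form"
  using clinear_tensor_eval[of f g]
  by (simp add: left_half_shuffle_def clinear_iff clinear_add[OF clinear_coproduct_left] clinear_scale[OF clinear_coproduct_left])

lemma clinear_right_half_shuffle: "clinear f \<Longrightarrow> clinear g \<Longrightarrow> clinear (f \<succ> g)"
  for f g :: "'a::complex_vector form"
  using clinear_tensor_eval[of f g]
  by (simp add: right_half_shuffle_def clinear_iff clinear_add[OF clinear_coproduct_right] clinear_scale[OF clinear_coproduct_right])

definition as_words :: "'a list \<Rightarrow> 'a word list"
  where "as_words as = (if as = [] then [] else [Word as])"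

text \<open>
  The values of a form on words, with the empty list standing for the unit: this is how a possibly
  empty subword enters the coproduct.
\<close>

definition on_list :: "'a::complex_vector form \<Rightarrow> 'a list \<Rightarrow> complex"
  where "on_list f as = f (barred (as_words as))"

lemma on_list_Nil: "on_list f [] = f 1"
  by (simp add: on_list_def as_words_def one_double_tensor_def)

lemma on_list_letters: "on_list f (letters w) = f (word_tensor w)"
  by (simp add: on_list_def as_words_def letters_inverse)

lemma on_list_nonempty: "as \<noteq> [] \<Longrightarrow> on_list f as = f (word_tensor (Word as))"
  by (simp add: on_list_def as_words_def)

lemma as_words_letters: "as_words (letters w) = [w]"
  by (simp add: as_words_def letters_inverse)

lemma subword_eq_as_words: "subword w S = as_words (nths (letters w) S)"
  by (simp add: subword_def as_words_def Let_def)

lemma clinear_character: "character \<Phi> \<Longrightarrow> clinear \<Phi>"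
  and character_1: "character \<Phi> \<Longrightarrow> \<Phi> 1 = 1"
  and character_mult: "character \<Phi> \<Longrightarrow> \<Phi> (x * y) = \<Phi> x * \<Phi> y"
  by (simp_all add: character_def)

lemma on_list_character_Nil: "character \<Psi> \<Longrightarrow> on_list \<Psi> [] = 1"
  by (simp add: on_list_Nil character_1)

lemma character_barred:
  assumes "character \<Phi>"
  shows "\<Phi> (barred ws) = (\<Prod>w\<leftarrow>ws. on_list \<Phi> (letters w))"
proof (induction ws)
  case Nil
  show ?case using character_1[OF assms] by (simp add: one_double_tensor_def)
next
  case (Cons w ws)
  have "barred (w # ws) = word_tensor w * barred ws" by (simp add: times_barred)
  then show ?case by (simp add: character_mult[OF assms] Cons.IH on_list_letters)
qed

lemma character_eqI:
  assumes "character \<Phi>" "character \<Psi>" "\<And>as. on_list \<Phi> as = on_list \<Psi> as"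
  shows "\<Phi> = \<Psi>"
proof
  fix x show "\<Phi> x = \<Psi> x"
    by (rule clinear_dt_eqI) (simp_all add: assms clinear_character character_barred)
qed

lemma character_counit: "character counit"
proof -
  have "counit (x * y) = counit x * counit y" for x y :: "'a double_tensor"
  proof (induction x rule: double_tensor_induct)
    case (barred us)
    show ?case
      by (induction y rule: double_tensor_induct)
        (simp_all add: times_barred counit_barred distrib_left
          clinear_add[OF clinear_counit] clinear_scale[OF clinear_counit])
  qed (simp_all add: distrib_right clinear_add[OF clinear_counit] clinear_scale[OF clinear_counit])
  then show ?thesis
    by (simp add: character_def clinear_counit one_double_tensor_def counit_barred)
qed

lemma on_list_counit: "on_list counit = empty_indicator"
  by (rule ext) (simp add: on_list_def as_words_def counit_barred)

lemma coproduct_1: "coproduct (1 :: 'a::complex_vector double_tensor) = 1 \<otimes> 1"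
  by (simp add: one_double_tensor_def coproduct_barred one_tensor_def)

lemma character_conv:
  assumes "character \<Phi>" "character \<Psi>"
  shows "character (\<Phi> \<star> \<Psi>)"
proof -
  note lin = assms[THEN clinear_character]
  have mult: "tensor_eval \<Phi> \<Psi> (z * z') = tensor_eval \<Phi> \<Psi> z * tensor_eval \<Phi> \<Psi> z'" for z z'
  proof (induction z rule: tensor_induct)
    case (pure x y)
    show ?case
      by (subst tensor_eval_pure_mult[of \<Phi> \<Psi> \<Phi> \<Psi> x "\<Phi> x" y "\<Psi> y"])
        (simp_all add: lin character_mult[OF assms(1)] character_mult[OF assms(2)] tensor_eval_pure)
  qed (simp_all add: distrib_right clinear_add[OF clinear_tensor_eval[OF lin]]
      clinear_scale[OF clinear_tensor_eval[OF lin]])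
  have "(\<Phi> \<star> \<Psi>) 1 = 1"
    by (simp add: conv_def coproduct_1 tensor_eval_pure lin character_1 assms)
  then show ?thesis
    using clinear_conv[OF lin] by (simp add: character_def conv_def coproduct_mult mult)
qed

lemma components_nonempty: "J \<in> set (components U) \<Longrightarrow> finite U \<Longrightarrow> J \<noteq> {} \<and> J \<subseteq> U"
  by (auto simp: components_def component_from_def left_endpoints_def)

lemma nths_nonempty: "J \<noteq> {} \<Longrightarrow> J \<subseteq> {..<length as} \<Longrightarrow> nths as J \<noteq> []"
  by (auto simp: set_nths simp flip: set_empty)

lemma character_component_words:
  assumes "character \<Psi>"
  shows "\<Psi> (barred (component_words w S))
    = (\<Prod>J\<leftarrow>components (positions w - S). on_list \<Psi> (nths (letters w) J))"
proof -
  have "nths (letters w) J \<noteq> []" if "J \<in> set (components (positions w - S))" for J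
    using components_nonempty[OF that] by (intro nths_nonempty) auto
  then show ?thesis
    unfolding character_barred[OF assms] component_words_def map_map
    by (intro arg_cong[where f = prod_list] map_cong) auto
qed

lemma tensor_eval_coproduct_term:
  assumes "clinear f" "character \<Psi>"
  shows "tensor_eval f \<Psi> (coproduct_term w S) = on_list f (nths (letters w) S) *
    (\<Prod>J\<leftarrow>components (positions w - S). on_list \<Psi> (nths (letters w) J))"
  by (simp add: coproduct_term_def tensor_eval_pure assms clinear_character
      character_component_words subword_eq_as_words on_list_def)

lemma conv_on_list:
  assumes "clinear f" "character \<Psi>"
  shows "on_list (f \<star> \<Psi>) as = gap_conv (on_list f) (on_list \<Psi>) (on_list \<Psi>) as"
proof (cases "as = []")
  case True
  then show ?thesis
    by (simp add: on_list_Nil conv_def coproduct_1 tensor_eval_pure assms clinear_character)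
next
  case False
  have "on_list (f \<star> \<Psi>) as = tensor_eval f \<Psi> (coproduct_word (Word as))"
    using False by (simp add: on_list_nonempty conv_def coproduct_barred)
  also have "\<dots> = (\<Sum>S\<in>Pow {..<length as}. tensor_eval f \<Psi> (coproduct_term (Word as) S))"
    using False
    by (simp add: coproduct_word_def clinear_sum[OF clinear_tensor_eval] assms clinear_character)
  also have "\<dots> = gap_conv (on_list f) (on_list \<Psi>) (on_list \<Psi>) as"
    using gap_conv_eq_sum_positions[where g = "on_list \<Psi>" and w = as and f = "on_list f"] False
    by (simp add: tensor_eval_coproduct_term assms on_list_Nil character_1)
  finally show ?thesis .
qed

lemma coproduct_left_word: "coproduct_left (word_tensor w) = coproduct_word_left w"
  by (simp add: coproduct_left_barred)

lemma left_half_shuffle_on_list: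
  assumes "clinear f" "character \<Psi>"
  shows "on_list (f \<prec> \<Psi>) (a # x) =
    gap_conv (\<lambda>v. on_list f (a # v)) (on_list \<Psi>) (on_list \<Psi>) x"
proof -
  have "on_list (f \<prec> \<Psi>) (a # x) = tensor_eval f \<Psi> (coproduct_word_left (Word (a # x)))"
    by (simp add: on_list_nonempty left_half_shuffle_def coproduct_left_word)
  also have "\<dots> = (\<Sum>S | S \<subseteq> {..<length (a # x)} \<and> 0 \<in> S. tensor_eval f \<Psi> (coproduct_term (Word (a # x)) S))"
    by (simp add: coproduct_word_left_def clinear_sum[OF clinear_tensor_eval] assms clinear_character)
  also have "\<dots> = gap_conv (\<lambda>v. on_list f (a # v)) (on_list \<Psi>) (on_list \<Psi>) x"
    using gap_sum_eq_sum_positions_from_first[where g = "on_list \<Psi>" and m = "on_list \<Psi>"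
        and w = "a # x" and f = "on_list f"]
    by (simp add: tensor_eval_coproduct_term assms on_list_Nil character_1)
  finally show ?thesis .
qed

lemma left_half_shuffle_1: "clinear f \<Longrightarrow> clinear g \<Longrightarrow> (f \<prec> g) 1 = 0"
  by (simp add: left_half_shuffle_def one_double_tensor_def coproduct_left_barred
      clinear_zero[OF clinear_tensor_eval])

lemma right_half_shuffle_1: "clinear f \<Longrightarrow> clinear g \<Longrightarrow> (f \<succ> g) 1 = 0"
  by (simp add: right_half_shuffle_def one_double_tensor_def coproduct_right_barred
      clinear_zero[OF clinear_tensor_eval])

text \<open>
  The subwords in \<open>\<Delta>\<^sub>\<prec>(w)\<close> are nonempty, so multiplicativity of \<open>f\<close> behind a nonempty word suffices.
\<close>

lemma left_half_shuffle_barred_Cons: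
  assumes lin: "clinear f" "clinear f'" and \<Psi>: "character \<Psi>"
    and f: "\<And>w x. f (word_tensor w * x) = f (word_tensor w) * f' x"
  shows "(f \<prec> \<Psi>) (barred (w # ws)) = (f \<prec> \<Psi>) (word_tensor w) * (f' \<star> \<Psi>) (barred ws)"
proof -
  let ?\<S> = "{S. S \<subseteq> positions w \<and> 0 \<in> S}"
  have summand: "tensor_eval f \<Psi> (coproduct_term w S * coproduct (barred ws))
      = tensor_eval f \<Psi> (coproduct_term w S) * (f' \<star> \<Psi>) (barred ws)" if "S \<in> ?\<S>" for S
  proof -
    have "nths (letters w) S \<noteq> []" using that by (intro nths_nonempty) auto
    then have "subword w S = [Word (nths (letters w) S)]" by (simp add: subword_def)
    then show ?thesis
      unfolding coproduct_term_def conv_def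
      by (subst tensor_eval_pure_mult[where f' = f' and g' = \<Psi> and
            c = "f (word_tensor (Word (nths (letters w) S)))" and d = "\<Psi> (barred (component_words w S))"])
        (simp_all add: lin clinear_character[OF \<Psi>] f character_mult[OF \<Psi>] tensor_eval_pure)
  qed
  have "(f \<prec> \<Psi>) (barred (w # ws)) = (\<Sum>S\<in>?\<S>. tensor_eval f \<Psi> (coproduct_term w S * coproduct (barred ws)))"
    by (simp add: left_half_shuffle_def coproduct_left_barred coproduct_word_left_def
        coproduct_barred sum_distrib_right clinear_sum[OF clinear_tensor_eval] lin clinear_character[OF \<Psi>])
  also have "\<dots> = (\<Sum>S\<in>?\<S>. tensor_eval f \<Psi> (coproduct_term w S)) * (f' \<star> \<Psi>) (barred ws)"
    by (simp add: summand sum_distrib_right)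
  also have "(\<Sum>S\<in>?\<S>. tensor_eval f \<Psi> (coproduct_term w S)) = (f \<prec> \<Psi>) (word_tensor w)"
    by (simp add: left_half_shuffle_def coproduct_left_word coproduct_word_left_def
        clinear_sum[OF clinear_tensor_eval] lin clinear_character[OF \<Psi>])
  finally show ?thesis .
qed

lemma nths_cong: "A \<inter> {..<length as} = B \<inter> {..<length as} \<Longrightarrow> nths as A = nths as B"
proof -
  assume *: "A \<inter> {..<length as} = B \<inter> {..<length as}"
  have AB: "i \<in> A \<longleftrightarrow> i \<in> B" if "i < length as" for i using * that by blast
  have "filter (\<lambda>p. snd p \<in> A) (zip as [0..<length as]) = filter (\<lambda>p. snd p \<in> B) (zip as [0..<length as])"
  proof (rule filter_cong[OF refl])
    fix p assume "p \<in> set (zip as [0..<length as])"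
    then have "snd p < length as" by (metis atLeastLessThan_iff prod.collapse set_upt set_zip_rightD)
    then show "snd p \<in> A \<longleftrightarrow> snd p \<in> B" by (rule AB)
  qed
  then show ?thesis by (simp add: nths_def)
qed

lemma nths_atLeastLessThan_length: "nths as {k..<length as} = drop k as"
  unfolding drop_eq_nths by (rule nths_cong) auto

lemma left_endpoints_lessThan: "left_endpoints {..<Suc i} = {0}"
proof -
  have "m = 0" if "m \<in> left_endpoints {..<Suc i}" for m
    using that by (cases m) (auto simp: left_endpoints_def)
  then show ?thesis by (auto simp: left_endpoints_def)
qed

lemma components_lessThan: "components {..<Suc i} = [{..<Suc i}]"
  by (auto simp: components_def left_endpoints_lessThan component_from_def)

lemma components_eq_Nil: "finite U \<Longrightarrow> components U = [] \<longleftrightarrow> U = {}"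
proof -
  assume "finite U"
  then have "finite (left_endpoints U)" by (simp add: left_endpoints_def)
  then have "components U = [] \<longleftrightarrow> left_endpoints U = {}" by (simp add: components_def)
  then show ?thesis using ex_left_endpoint[of _ U] by (auto simp: left_endpoints_def)
qed

lemma single_component_eq_lessThan:
  assumes U: "finite U" "0 \<in> U" and len: "length (components U) = 1"
  shows "\<exists>i. U = {..<Suc i}"
proof -
  have fin: "finite (left_endpoints U)" using U by (simp add: left_endpoints_def)
  have 0: "0 \<in> left_endpoints U" using U by (simp add: left_endpoints_def)
  have "card (left_endpoints U) = 1" using len fin by (simp add: components_def)
  with 0 have le: "left_endpoints U = {0}" by (metis card_1_singletonE singletonD)
  have closed: "{0..k} \<subseteq> U" if "k \<in> U" for k
    using ex_left_endpoint[OF that] by (auto simp: le component_from_def)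
  have "U = {..<Suc (Max U)}"
  proof (intro equalityI subsetI)
    fix k assume "k \<in> U"
    then show "k \<in> {..<Suc (Max U)}" using U by (simp add: less_Suc_eq_le)
  next
    fix k assume "k \<in> {..<Suc (Max U)}"
    moreover have "Max U \<in> U" using U by (intro Max_in) auto
    ultimately show "k \<in> U" using closed[of "Max U"] by auto
  qed
  then show ?thesis ..
qed

text \<open>
  For a form that need not be multiplicative this cannot be reduced to single words; instead the
  form is generalised in the induction, so that a fixed left factor can be absorbed into it.
\<close>

lemma conv_counit:
  assumes "clinear h"
  shows "h \<star> counit = h"
proof
  fix x
  show "(h \<star> counit) x = h x"
  proof (rule clinear_dt_eqI)
    show "clinear (h \<star> counit)" "clinear h" using assms by (simp_all add: clinear_conv clinear_counit)
    fix ws :: "'a word list"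
    show "(h \<star> counit) (barred ws) = h (barred ws)"
      using assms
    proof (induction ws arbitrary: h)
      case Nil
      then show ?case
        by (simp add: conv_def coproduct_1 tensor_eval_pure[OF Nil.prems clinear_counit]
            character_1[OF character_counit] one_double_tensor_def[symmetric])
    next
      case (Cons w ws)
      let ?h = "\<lambda>S x. h (barred (subword w S) * x)"
      have lin: "clinear (?h S)" for S
        using Cons.prems unfolding clinear_iff by (simp add: distrib_left)
      have zero: "component_words w S = [] \<longleftrightarrow> positions w \<subseteq> S" for S
        by (simp add: component_words_def components_eq_Nil)
      have "(h \<star> counit) (barred (w # ws)) =
          (\<Sum>S\<in>Pow (positions w). tensor_eval h counit (coproduct_term w S * coproduct (barred ws)))"
        by (simp add: conv_def coproduct_barred coproduct_word_def sum_distrib_right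
            clinear_sum[OF clinear_tensor_eval] Cons.prems clinear_counit)
      also have "\<dots> = (\<Sum>S\<in>Pow (positions w).
          (if component_words w S = [] then 1 else 0) * ?h S (barred ws))"
      proof (rule sum.cong[OF refl])
        fix S
        have "tensor_eval h counit (coproduct_term w S * coproduct (barred ws))
            = 1 * counit (barred (component_words w S)) * tensor_eval (?h S) counit (coproduct (barred ws))"
          unfolding coproduct_term_def
          by (rule tensor_eval_pure_mult)
            (simp_all add: Cons.prems lin clinear_counit character_mult[OF character_counit])
        also have "tensor_eval (?h S) counit (coproduct (barred ws)) = ?h S (barred ws)"
          using Cons.IH[OF lin[of S]] by (simp add: conv_def)
        finally show "tensor_eval h counit (coproduct_term w S * coproduct (barred ws))
            = (if component_words w S = [] then 1 else 0) * ?h S (barred ws)"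
          by (simp add: counit_barred)
      qed
      also have "\<dots> = (\<Sum>S\<in>{positions w}. ?h S (barred ws))"
        by (rule sum.mono_neutral_cong_right) (auto simp: zero)
      also have "\<dots> = h (barred (w # ws))"
        by (simp add: subword_eq_as_words as_words_letters times_barred)
      finally show ?case .
    qed
  qed
qed

text \<open>
  An infinitesimal character vanishes unless the right tensor factor is a single word. As the first
  position is not in \<open>S\<close>, this leaves the sets \<open>S\<close> whose complement is an initial interval and, in the
  words behind the first bar, only the full sets of positions.
\<close>

lemma right_half_shuffle_barred_Cons:
  assumes lin: "clinear f" and \<alpha>: "infinitesimal_character \<alpha>"
  shows "(f \<succ> \<alpha>) (barred (w # ws)) = (\<Sum>i<length (letters w).
    on_list \<alpha> (take (Suc i) (letters w)) * f (barred (as_words (drop (Suc i) (letters w)) @ ws)))"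
proof -
  let ?n = "length (letters w)"
  let ?\<S> = "{S. S \<subseteq> positions w \<and> 0 \<notin> S}"
  let ?F = "\<lambda>S. \<alpha> (barred (component_words w S)) * f (barred (subword w S @ ws))"
  have lin_\<alpha>: "clinear \<alpha>" and \<alpha>_long: "\<And>us. length us \<ge> 2 \<Longrightarrow> \<alpha> (barred us) = 0"
    and \<alpha>_1: "\<alpha> (barred []) = 0"
    using \<alpha> by (auto simp: infinitesimal_character_def one_double_tensor_def)
  have n: "?n > 0" by simp
  have \<alpha>_mult: "\<alpha> (barred us * y) = \<alpha> (barred us) * counit y" if "us \<noteq> []" for us y
  proof (induction y rule: double_tensor_induct)
    case (barred vs)
    show ?case
      using that by (cases us; cases vs) (auto simp: times_barred counit_barred \<alpha>_long)
  qed (simp_all add: distrib_left clinear_add[OF lin_\<alpha>] clinear_scale[OF lin_\<alpha>]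
      clinear_add[OF clinear_counit] clinear_scale[OF clinear_counit])
  have lin_f: "clinear (\<lambda>x. f (barred us * x))" for us
    using lin by (simp add: clinear_iff distrib_left)
  have summand: "tensor_eval f \<alpha> (coproduct_term w S * coproduct (barred ws)) = ?F S" if "S \<in> ?\<S>" for S
  proof -
    have "positions w - S \<noteq> {}" using that n by auto
    then have ne: "component_words w S \<noteq> []" by (simp add: component_words_def components_eq_Nil)
    have "tensor_eval f \<alpha> (coproduct_term w S * coproduct (barred ws)) =
        1 * \<alpha> (barred (component_words w S)) *
          tensor_eval (\<lambda>x. f (barred (subword w S) * x)) counit (coproduct (barred ws))"
      unfolding coproduct_term_def
      by (rule tensor_eval_pure_mult) (simp_all add: lin lin_\<alpha> lin_f clinear_counit \<alpha>_mult[OF ne])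
    also have "tensor_eval (\<lambda>x. f (barred (subword w S) * x)) counit (coproduct (barred ws))
        = f (barred (subword w S @ ws))"
      using conv_counit[OF lin_f, of "subword w S"] by (simp add: conv_def fun_eq_iff times_barred)
    finally show ?thesis by simp
  qed
  have "(f \<succ> \<alpha>) (barred (w # ws))
      = (\<Sum>S\<in>?\<S>. tensor_eval f \<alpha> (coproduct_term w S * coproduct (barred ws)))"
    by (simp add: right_half_shuffle_def coproduct_right_barred coproduct_word_right_def
        coproduct_barred sum_distrib_right clinear_sum[OF clinear_tensor_eval] lin lin_\<alpha>)
  also have "\<dots> = (\<Sum>S\<in>?\<S>. ?F S)" by (simp add: summand)
  also have "\<dots> = (\<Sum>S\<in>(\<lambda>i. {Suc i..<?n}) ` {..<?n}. ?F S)"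
  proof (rule sum.mono_neutral_right)
    show "finite ?\<S>" by (rule finite_subset[of _ "Pow (positions w)"]) auto
    show "(\<lambda>i. {Suc i..<?n}) ` {..<?n} \<subseteq> ?\<S>" by auto
    show "\<forall>S\<in>?\<S> - (\<lambda>i. {Suc i..<?n}) ` {..<?n}. ?F S = 0"
    proof
      fix S assume S: "S \<in> ?\<S> - (\<lambda>i. {Suc i..<?n}) ` {..<?n}"
      have "length (components (positions w - S)) \<noteq> 1"
      proof
        assume "length (components (positions w - S)) = 1"
        then obtain i where i: "positions w - S = {..<Suc i}"
          using single_component_eq_lessThan[of "positions w - S"] S n by auto
        have "i \<in> positions w - S" unfolding i by simp
        then have "i < ?n" by simp
        have "S = positions w - (positions w - S)" using S by auto
        also have "\<dots> = {Suc i..<?n}" unfolding i by auto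
        finally show False using S \<open>i < ?n\<close> by auto
      qed
      then have "length (component_words w S) \<noteq> 1" by (simp add: component_words_def)
      then have "component_words w S = [] \<or> length (component_words w S) \<ge> 2"
        by (cases "component_words w S") (auto simp: Suc_le_eq)
      then show "?F S = 0" using \<alpha>_long \<alpha>_1 by auto
    qed
  qed
  also have "\<dots> = (\<Sum>i<?n. ?F {Suc i..<?n})"
  proof (subst sum.reindex)
    show "inj_on (\<lambda>i. {Suc i..<?n}) {..<?n}"
    proof (rule inj_onI)
      fix i j assume ij: "i \<in> {..<?n}" "j \<in> {..<?n}" "{Suc i..<?n} = {Suc j..<?n}"
      have "card {Suc i..<?n} = card {Suc j..<?n}" using ij(3) by (rule arg_cong)
      with ij(1,2) show "i = j" by simp
    qed
  qed simp
  also have "\<dots> = (\<Sum>i<?n. on_list \<alpha> (take (Suc i) (letters w)) *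
      f (barred (as_words (drop (Suc i) (letters w)) @ ws)))"
  proof (rule sum.cong[OF refl])
    fix i assume "i \<in> {..<?n}"
    then have "positions w - {Suc i..<?n} = {..<Suc i}" by auto
    then have "component_words w {Suc i..<?n} = [Word (take (Suc i) (letters w))]"
      by (simp add: component_words_def components_lessThan del: lessThan_Suc)
    then show "?F {Suc i..<?n} = on_list \<alpha> (take (Suc i) (letters w)) *
        f (barred (as_words (drop (Suc i) (letters w)) @ ws))"
      by (simp add: on_list_nonempty subword_eq_as_words nths_atLeastLessThan_length)
  qed
  finally show ?thesis .
qed

lemma right_half_shuffle_on_list:
  assumes "clinear f" "infinitesimal_character \<alpha>" "as \<noteq> []"
  shows "on_list (f \<succ> \<alpha>) as =
    (\<Sum>i<length as. on_list \<alpha> (take (Suc i) as) * on_list f (drop (Suc i) as))"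
  using right_half_shuffle_barred_Cons[OF assms(1,2), of "Word as" "[]"] assms(3)
  by (simp add: on_list_nonempty) (simp add: on_list_def)

section \<open>The right half-shuffle exponential\<close>

lemma clinear_infinitesimal: "infinitesimal_character \<alpha> \<Longrightarrow> clinear \<alpha>"
  by (simp add: infinitesimal_character_def)

lemma infinitesimal_character_scale:
  "infinitesimal_character \<alpha> \<Longrightarrow> infinitesimal_character (\<lambda>x. c * \<alpha> x)"
  by (simp add: infinitesimal_character_def clinear_iff distrib_left)

abbreviation letter_count :: "'a word list \<Rightarrow> nat"
  where "letter_count ws \<equiv> (\<Sum>w\<leftarrow>ws. length (letters w))"

lemma letter_count_as_words: "letter_count (as_words as) = length as"
  by (simp add: as_words_def)

context
  fixes \<alpha> :: "'a::complex_vector form"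
  assumes \<alpha>: "infinitesimal_character \<alpha>"
begin

lemma clinear_right_half_power: "clinear (right_half_power \<alpha> n)"
proof (induction n)
  case 0
  show ?case unfolding right_half_power.simps by (rule clinear_counit)
next
  case (Suc n)
  then show ?case
    unfolding right_half_power.simps
    by (rule clinear_right_half_shuffle) (rule clinear_infinitesimal[OF \<alpha>])
qed

text \<open>
  Each half-shuffle with \<open>\<alpha>\<close> consumes at least one letter, so the exponential series is finite on
  every barred word.
\<close>

lemma right_half_power_eq_0: "letter_count ws < n \<Longrightarrow> right_half_power \<alpha> n (barred ws) = 0"
proof (induction n arbitrary: ws)
  case (Suc n)
  show ?case
  proof (cases ws)
    case Nil
    then show ?thesis
      using right_half_shuffle_1[OF clinear_right_half_power clinear_infinitesimal[OF \<alpha>]]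
      by (simp add: one_double_tensor_def)
  next
    case (Cons w ws')
    have "right_half_power \<alpha> n (barred (as_words (drop (Suc i) (letters w)) @ ws')) = 0"
      if "i < length (letters w)" for i
      using that Suc.prems Cons by (intro Suc.IH) (simp add: letter_count_as_words)
    then show ?thesis
      using right_half_shuffle_barred_Cons[OF clinear_right_half_power \<alpha>] Cons by simp
  qed
qed simp

lemma finite_right_half_power_support: "finite {n. right_half_power \<alpha> n x \<noteq> 0}"
proof (induction x rule: double_tensor_induct)
  case (barred ws)
  have "{n. right_half_power \<alpha> n (barred ws) \<noteq> 0} \<subseteq> {..letter_count ws}"
    using right_half_power_eq_0[of ws] by (auto simp: not_less[symmetric])
  then show ?case by (rule finite_subset) simp
next
  case (add z z')
  have "{n. right_half_power \<alpha> n (z + z') \<noteq> 0}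
      \<subseteq> {n. right_half_power \<alpha> n z \<noteq> 0} \<union> {n. right_half_power \<alpha> n z' \<noteq> 0}"
    by (auto simp: clinear_add[OF clinear_right_half_power])
  then show ?case using add by (rule finite_subset[OF _ finite_UnI])
next
  case (scale c z)
  have "{n. right_half_power \<alpha> n (c *\<^sub>C z) \<noteq> 0} \<subseteq> {n. right_half_power \<alpha> n z \<noteq> 0}"
    by (auto simp: clinear_scale[OF clinear_right_half_power])
  then show ?case using scale by (rule finite_subset)
qed

lemma clinear_right_half_exp: "clinear (\<E>\<^sub>\<succ> \<alpha>)"
proof (rule clinearI)
  fix x y :: "'a double_tensor" and c :: complex
  show "\<E>\<^sub>\<succ> \<alpha> (x + y) = \<E>\<^sub>\<succ> \<alpha> x + \<E>\<^sub>\<succ> \<alpha> y"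
    by (simp add: right_half_exp_def clinear_add[OF clinear_right_half_power]
        Sum_any.distrib finite_right_half_power_support)
  show "\<E>\<^sub>\<succ> \<alpha> (c *\<^sub>C x) = c *\<^sub>C \<E>\<^sub>\<succ> \<alpha> x"
    by (simp add: right_half_exp_def clinear_scale[OF clinear_right_half_power]
        Sum_any_right_distrib finite_right_half_power_support)
qed

lemma right_half_exp_barred:
  assumes "letter_count ws \<le> N"
  shows "\<E>\<^sub>\<succ> \<alpha> (barred ws) = (\<Sum>n\<le>N. right_half_power \<alpha> n (barred ws))"
  unfolding right_half_exp_def
proof (rule Sum_any.expand_superset)
  show "{n. right_half_power \<alpha> n (barred ws) \<noteq> 0} \<subseteq> {..N}"
    using right_half_power_eq_0[of ws] assms by (auto simp: not_less[symmetric])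
qed simp

lemma right_half_exp_1: "\<E>\<^sub>\<succ> \<alpha> 1 = 1"
  using right_half_exp_barred[of "[]" 0] by (simp add: one_double_tensor_def counit_barred)

lemma right_half_exp_barred_Cons:
  "\<E>\<^sub>\<succ> \<alpha> (barred (w # ws)) = (\<Sum>i<length (letters w).
    on_list \<alpha> (take (Suc i) (letters w)) * \<E>\<^sub>\<succ> \<alpha> (barred (as_words (drop (Suc i) (letters w)) @ ws)))"
proof -
  define N where "N = letter_count (w # ws)"
  let ?x = "\<lambda>i. barred (as_words (drop (Suc i) (letters w)) @ ws)"
  have exp: "\<E>\<^sub>\<succ> \<alpha> (?x i) = (\<Sum>n\<le>N. right_half_power \<alpha> n (?x i))" if "i < length (letters w)" for i
    by (rule right_half_exp_barred) (simp add: letter_count_as_words N_def)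
  have "\<E>\<^sub>\<succ> \<alpha> (barred (w # ws)) = (\<Sum>n\<le>Suc N. right_half_power \<alpha> n (barred (w # ws)))"
    by (rule right_half_exp_barred) (simp add: N_def)
  also have "\<dots> = (\<Sum>n\<le>N. right_half_power \<alpha> (Suc n) (barred (w # ws)))"
    by (simp add: sum.atMost_Suc_shift counit_barred del: sum.atMost_Suc right_half_power.simps(2))
  also have "\<dots> = (\<Sum>n\<le>N. \<Sum>i<length (letters w).
      on_list \<alpha> (take (Suc i) (letters w)) * right_half_power \<alpha> n (?x i))"
    by (simp add: right_half_shuffle_barred_Cons[OF clinear_right_half_power \<alpha>])
  also have "\<dots> = (\<Sum>i<length (letters w).
      on_list \<alpha> (take (Suc i) (letters w)) * \<E>\<^sub>\<succ> \<alpha> (?x i))"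
    by (subst sum.swap) (simp add: exp sum_distrib_left)
  finally show ?thesis .
qed

text \<open>
  The recursion \<open>right_half_exp_barred_Cons\<close> only removes letters at the front, so whatever follows
  behind a bar factors out.
\<close>

lemma right_half_exp_append:
  "\<E>\<^sub>\<succ> \<alpha> (barred (us @ vs)) = \<E>\<^sub>\<succ> \<alpha> (barred us) * \<E>\<^sub>\<succ> \<alpha> (barred vs)"
proof (induction us rule: measure_induct_rule[of letter_count])
  case (less us)
  show ?case
  proof (cases us)
    case Nil
    then show ?thesis using right_half_exp_1 by (simp add: one_double_tensor_def)
  next
    case (Cons w ws)
    have "\<E>\<^sub>\<succ> \<alpha> (barred ((as_words (drop (Suc i) (letters w)) @ ws) @ vs))
        = \<E>\<^sub>\<succ> \<alpha> (barred (as_words (drop (Suc i) (letters w)) @ ws)) * \<E>\<^sub>\<succ> \<alpha> (barred vs)"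
      if "i < length (letters w)" for i
      using that by (intro less.IH) (simp add: Cons letter_count_as_words)
    then show ?thesis
      by (simp add: Cons right_half_exp_barred_Cons sum_distrib_right mult.assoc)
  qed
qed

lemma character_right_half_exp: "character (\<E>\<^sub>\<succ> \<alpha>)"
proof -
  note lin = clinear_add[OF clinear_right_half_exp] clinear_scale[OF clinear_right_half_exp]
  have "\<E>\<^sub>\<succ> \<alpha> (x * y) = \<E>\<^sub>\<succ> \<alpha> x * \<E>\<^sub>\<succ> \<alpha> y" for x y
  proof (induction x rule: double_tensor_induct)
    case (barred us)
    show ?case
      by (induction y rule: double_tensor_induct)
        (simp_all add: times_barred right_half_exp_append distrib_left lin)
  qed (simp_all add: distrib_right lin)
  then show ?thesis by (simp add: character_def clinear_right_half_exp right_half_exp_1)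
qed

lemma right_half_exp_on_list:
  assumes "as \<noteq> []"
  shows "on_list (\<E>\<^sub>\<succ> \<alpha>) as =
    (\<Sum>i<length as. on_list \<alpha> (take (Suc i) as) * on_list (\<E>\<^sub>\<succ> \<alpha>) (drop (Suc i) as))"
  using right_half_exp_barred_Cons[of "Word as" "[]"] assms
  by (simp add: on_list_nonempty) (simp add: on_list_def)

end


section \<open>Inverses of characters\<close>

text \<open>
  The multiplicative extension of a function on words, meaningful when the function is linear in
  each letter.
\<close>

definition character_of :: "('a::complex_vector word \<Rightarrow> complex) \<Rightarrow> 'a form"
  where "character_of g = dt_ext (\<lambda>ws. \<Prod>w\<leftarrow>ws. g w)"

lemma
  assumes "\<And>xs ys. clinear (\<lambda>a. g (Word (xs @ a # ys)))"
  shows character_character_of: "character (character_of g)"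
    and character_of_word: "character_of g (word_tensor w) = g w"
proof -
  have ml: "letter_multilinear (\<lambda>ws. \<Prod>w\<leftarrow>ws. g w)"
    using assms by (simp add: letter_multilinear_def clinear_iff algebra_simps)
  note lin = clinear_dt_ext[OF ml, folded character_of_def]
  have on_barred: "character_of g (barred ws) = (\<Prod>w\<leftarrow>ws. g w)" for ws
    by (simp add: character_of_def dt_ext_barred[OF ml])
  show "character_of g (word_tensor w) = g w" by (simp add: on_barred)
  have "character_of g (x * y) = character_of g x * character_of g y" for x y
  proof (induction x rule: double_tensor_induct)
    case (barred us)
    show ?case
      by (induction y rule: double_tensor_induct)
        (simp_all add: times_barred on_barred distrib_left clinear_add[OF lin] clinear_scale[OF lin])
  qed (simp_all add: distrib_right clinear_add[OF lin] clinear_scale[OF lin])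
  then show "character (character_of g)"
    by (simp add: character_def lin one_double_tensor_def on_barred)
qed

lemma clinear_form_letter: "clinear f \<Longrightarrow> clinear (\<lambda>a. f (word_tensor (Word (xs @ a # ys))))"
  using clinear_barred[of "[]" xs ys "[]"] by (simp add: clinear_iff)

lemma conv_assoc:
  assumes "character \<Phi>" "character \<Psi>" "character X"
  shows "(\<Phi> \<star> \<Psi>) \<star> X = \<Phi> \<star> (\<Psi> \<star> X)"
proof (rule character_eqI)
  fix as
  have "on_list (\<Phi> \<star> \<Psi>) = gap_conv (on_list \<Phi>) (on_list \<Psi>) (on_list \<Psi>)"
    "on_list (\<Psi> \<star> X) = gap_conv (on_list \<Psi>) (on_list X) (on_list X)"
    by (rule ext, simp add: conv_on_list assms clinear_character)+
  then show "on_list ((\<Phi> \<star> \<Psi>) \<star> X) as = on_list (\<Phi> \<star> (\<Psi> \<star> X)) as"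
    by (simp add: conv_on_list assms clinear_character character_conv gap_conv_assoc)
qed (simp_all add: assms character_conv)

lemma counit_conv: "character \<Phi> \<Longrightarrow> counit \<star> \<Phi> = \<Phi>"
  by (rule character_eqI)
    (simp_all add: character_conv character_counit conv_on_list clinear_counit on_list_counit
      gap_conv_empty_word)

text \<open>
  A right inverse \<open>\<Psi>\<close> of \<open>\<Phi>\<close> is a fixed point of \<open>\<Psi> \<mapsto> \<Psi> + \<epsilon> - \<Phi> \<star> \<Psi>\<close> on words, where the right hand side
  depends only on the values of \<open>\<Psi>\<close> on shorter words. Iterating on the level of forms, rather than
  defining \<open>\<Psi>\<close> by recursion on words, keeps linearity in each letter without further proof.
\<close>

primrec inverse_approx :: "'a::complex_vector form \<Rightarrow> nat \<Rightarrow> 'a form"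
  where
    "inverse_approx \<Phi> 0 = counit"
  | "inverse_approx \<Phi> (Suc k) = character_of
      (\<lambda>w. inverse_approx \<Phi> k (word_tensor w) - (\<Phi> \<star> inverse_approx \<Phi> k) (word_tensor w))"

context
  fixes \<Phi> :: "'a::complex_vector form"
  assumes \<Phi>: "character \<Phi>"
begin

lemma approx_step_multilinear:
  assumes "character \<Psi>"
  shows "clinear (\<lambda>a. \<Psi> (word_tensor (Word (xs @ a # ys))) - (\<Phi> \<star> \<Psi>) (word_tensor (Word (xs @ a # ys))))"
  using clinear_form_letter[OF clinear_character[OF assms], of xs ys]
    clinear_form_letter[OF clinear_character[OF character_conv[OF \<Phi> assms]], of xs ys]
  by (simp add: clinear_iff algebra_simps)

lemma character_inverse_approx: "character (inverse_approx \<Phi> k)"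
proof (induction k)
  case (Suc k)
  show ?case
    unfolding inverse_approx.simps
    by (rule character_character_of) (rule approx_step_multilinear[OF Suc.IH])
qed (simp add: character_counit)

lemma inverse_approx_Suc:
  assumes "as \<noteq> []"
  shows "on_list (inverse_approx \<Phi> (Suc k)) as =
    - gap_sum (on_list \<Phi>) (on_list (inverse_approx \<Phi> k)) (\<lambda>u. 0)
        (on_list (inverse_approx \<Phi> k)) (on_list (inverse_approx \<Phi> k)) as"
proof -
  let ?R = "inverse_approx \<Phi> k"
  have "on_list (inverse_approx \<Phi> (Suc k)) as = on_list ?R as - on_list (\<Phi> \<star> ?R) as"
    using assms
    by (simp add: on_list_nonempty character_of_word approx_step_multilinear character_inverse_approx)
  also have "on_list (\<Phi> \<star> ?R) as = on_list ?R as
      + gap_sum (on_list \<Phi>) (on_list ?R) (\<lambda>u. 0) (on_list ?R) (on_list ?R) as"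
    by (subst conv_on_list[OF clinear_character[OF \<Phi>] character_inverse_approx])
      (subst gap_sum_split_whole, simp add: on_list_character_Nil[OF \<Phi>])
  finally show ?thesis by simp
qed

lemma inverse_approx_stable_step:
  "length as \<le> k \<Longrightarrow> on_list (inverse_approx \<Phi> (Suc k)) as = on_list (inverse_approx \<Phi> k) as"
proof (induction k arbitrary: as)
  case 0
  then show ?case
    by (simp add: on_list_character_Nil character_inverse_approx del: inverse_approx.simps)
next
  case (Suc k)
  show ?case
  proof (cases "as = []")
    case True
    then show ?thesis
      by (simp add: on_list_character_Nil character_inverse_approx del: inverse_approx.simps)
  next
    case False
    show ?thesis
      unfolding inverse_approx_Suc[OF False]
      by (rule arg_cong[where f = uminus], rule gap_sum_proper_cong)
        (rule Suc.IH, use Suc.prems in simp)+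
  qed
qed

lemma inverse_approx_stable:
  assumes "length as \<le> k"
  shows "on_list (inverse_approx \<Phi> k) as = on_list (inverse_approx \<Phi> (length as)) as"
  using assms
  by (induction k rule: dec_induct) (simp_all add: inverse_approx_stable_step del: inverse_approx.simps)

text \<open>
  The approximations are constant from the length of the word on, so their limit takes the value of
  approximation number \<open>n\<close> on words of length \<open>n\<close>. This number does not change when a letter is
  changed, which makes the limit linear in each letter.
\<close>

lemma right_inverse_exists: "\<exists>\<Psi>. character \<Psi> \<and> \<Phi> \<star> \<Psi> = counit"
proof -
  define g where "g w = inverse_approx \<Phi> (length (letters w)) (word_tensor w)" for w
  define \<Psi> where "\<Psi> = character_of g"
  have ml: "clinear (\<lambda>a. g (Word (xs @ a # ys)))" for xs ys
    using clinear_form_letter[OF clinear_character[OF character_inverse_approx]]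
    by (simp add: g_def del: inverse_approx.simps)
  have \<Psi>: "character \<Psi>" unfolding \<Psi>_def by (rule character_character_of[OF ml])
  have on_\<Psi>: "on_list \<Psi> as = on_list (inverse_approx \<Phi> k) as" if "length as \<le> k" for as k
  proof (cases "as = []")
    case True
    then show ?thesis by (simp add: on_list_character_Nil character_inverse_approx \<Psi>)
  next
    case False
    have "on_list \<Psi> as = on_list (inverse_approx \<Phi> (length as)) as"
      using False by (simp add: on_list_nonempty \<Psi>_def character_of_word[OF ml] g_def)
    then show ?thesis using inverse_approx_stable[OF that] by simp
  qed
  have "\<Phi> \<star> \<Psi> = counit"
  proof (rule character_eqI)
    fix as
    show "on_list (\<Phi> \<star> \<Psi>) as = on_list counit as"
    proof (cases "as = []")
      case True
      then show ?thesis
        by (simp add: on_list_character_Nil character_conv \<Phi> \<Psi> character_counit)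
    next
      case False
      let ?R = "inverse_approx \<Phi> (length as)"
      have "on_list (\<Phi> \<star> \<Psi>) as = on_list \<Psi> as
          + gap_sum (on_list \<Phi>) (on_list \<Psi>) (\<lambda>u. 0) (on_list \<Psi>) (on_list \<Psi>) as"
        by (subst conv_on_list[OF clinear_character[OF \<Phi>] \<Psi>])
          (subst gap_sum_split_whole, simp add: on_list_character_Nil[OF \<Phi>])
      also have "gap_sum (on_list \<Phi>) (on_list \<Psi>) (\<lambda>u. 0) (on_list \<Psi>) (on_list \<Psi>) as
          = gap_sum (on_list \<Phi>) (on_list ?R) (\<lambda>u. 0) (on_list ?R) (on_list ?R) as"
        by (rule gap_sum_proper_cong) (simp_all add: on_\<Psi>)
      also have "\<dots> = - on_list (inverse_approx \<Phi> (Suc (length as))) as"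
        by (simp add: inverse_approx_Suc[OF False] del: inverse_approx.simps)
      also have "\<dots> = - on_list \<Psi> as" using on_\<Psi>[of as "Suc (length as)"] by simp
      finally show ?thesis using False by (simp add: on_list_counit)
    qed
  qed (simp_all add: character_conv \<Phi> \<Psi> character_counit)
  with \<Psi> show ?thesis by blast
qed

end

text \<open>
  By associativity, a right inverse whose right inverse exists as well is two-sided.
\<close>

lemma conv_inverse:
  assumes \<Phi>: "character \<Phi>"
  shows "character (conv_inverse \<Phi>)" "\<Phi> \<star> conv_inverse \<Phi> = counit" "conv_inverse \<Phi> \<star> \<Phi> = counit"
proof -
  obtain \<Psi> where \<Psi>: "character \<Psi>" "\<Phi> \<star> \<Psi> = counit" using right_inverse_exists[OF \<Phi>] by blast
  obtain X where X: "character X" "\<Psi> \<star> X = counit" using right_inverse_exists[OF \<Psi>(1)] by blast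
  have "X = (\<Phi> \<star> \<Psi>) \<star> X" by (simp add: \<Psi> counit_conv X)
  also have "\<dots> = \<Phi>"
    by (simp add: conv_assoc \<Phi> \<Psi>(1) X conv_counit clinear_character)
  finally have left: "\<Psi> \<star> \<Phi> = counit" using X(2) by simp
  have "\<exists>!\<Psi>. character \<Psi> \<and> \<Phi> \<star> \<Psi> = counit \<and> \<Psi> \<star> \<Phi> = counit"
  proof (rule ex1I[of _ \<Psi>])
    fix \<Psi>' assume *: "character \<Psi>' \<and> \<Phi> \<star> \<Psi>' = counit \<and> \<Psi>' \<star> \<Phi> = counit"
    then have "\<Psi>' = (\<Psi> \<star> \<Phi>) \<star> \<Psi>'" by (simp add: left counit_conv)
    also have "\<dots> = \<Psi>" using * by (simp add: conv_assoc \<Phi> \<Psi>(1) conv_counit clinear_character)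
    finally show "\<Psi>' = \<Psi>" .
  qed (simp add: \<Psi> left)
  from theI'[OF this] show "character (conv_inverse \<Phi>)" "\<Phi> \<star> conv_inverse \<Phi> = counit"
    "conv_inverse \<Phi> \<star> \<Phi> = counit"
    by (simp_all add: conv_inverse_def)
qed

section \<open>Noncrossing partitions and the block of the first point\<close>

definition noncrossing_partitions :: "nat set \<Rightarrow> nat set set set"
  where "noncrossing_partitions A = {\<pi>. partition_on A \<pi> \<and> noncrossing \<pi>}"

lemma NC_eq_noncrossing_partitions: "NC n = noncrossing_partitions {..<n}"
  by (simp add: NC_def noncrossing_partitions_def)

lemma noncrossingD:
  assumes "noncrossing \<pi>" "V \<in> \<pi>" "W \<in> \<pi>" "a \<in> V" "b \<in> W" "c \<in> V" "d \<in> W" "a < b" "b < c" "c < d"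
  shows "V = W"
proof (rule ccontr)
  assume "V \<noteq> W"
  then have "\<exists>V\<in>\<pi>. \<exists>W\<in>\<pi>. V \<noteq> W \<and> (\<exists>a\<in>V. \<exists>b\<in>W. \<exists>c\<in>V. \<exists>d\<in>W. a < b \<and> b < c \<and> c < d)"
    by (intro bexI[of _ V] bexI[of _ W] bexI[of _ a] bexI[of _ b] bexI[of _ c] bexI[of _ d] conjI assms)
  with assms(1) show False unfolding noncrossing_def by contradiction
qed

lemma noncrossingI:
  assumes "\<And>V W a b c d. V \<in> \<pi> \<Longrightarrow> W \<in> \<pi> \<Longrightarrow> V \<noteq> W \<Longrightarrow> a \<in> V \<Longrightarrow> b \<in> W \<Longrightarrow> c \<in> V \<Longrightarrow> d \<in> W
    \<Longrightarrow> a < b \<Longrightarrow> b < c \<Longrightarrow> c < d \<Longrightarrow> False"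
  shows "noncrossing \<pi>"
  unfolding noncrossing_def
  by (rule notI, elim bexE conjE) (rule assms)

lemma inner_blocksI:
  assumes "V \<in> \<pi>" "W \<in> \<pi>" "W \<noteq> V" "a \<in> W" "b \<in> W" "\<forall>c\<in>V. a < c \<and> c < b"
  shows "V \<in> inner_blocks \<pi>"
  unfolding inner_blocks_def
  by (intro CollectI conjI bexI[of _ W] bexI[of _ a] bexI[of _ b] assms)

lemma inner_blocksE:
  assumes "V \<in> inner_blocks \<pi>"
  obtains W a b where "V \<in> \<pi>" "W \<in> \<pi>" "W \<noteq> V" "a \<in> W" "b \<in> W" "\<forall>c\<in>V. a < c \<and> c < b"
  using assms unfolding inner_blocks_def by (elim CollectE conjE bexE)

lemma finite_noncrossing_partitions: "finite A \<Longrightarrow> finite (noncrossing_partitions A)"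
  by (rule finite_subset[of _ "Pow (Pow A)"]) (auto simp: noncrossing_partitions_def partition_on_def)

lemma finite_noncrossing_partition: "\<pi> \<in> noncrossing_partitions A \<Longrightarrow> finite A \<Longrightarrow> finite \<pi>"
  by (auto simp: noncrossing_partitions_def intro: finite_elements)

text \<open>
  Separate weights \<open>t\<close> for inner and \<open>s\<close> for outer blocks cover two cases at once: with \<open>s = 1\<close> the sum
  over noncrossing partitions is the \<open>t\<close>-Boolean moment-cumulant formula, and with \<open>s = t\<close> it is the free
  one with all cumulants multiplied by \<open>t\<close>.
\<close>

definition nc_weight :: "complex \<Rightarrow> complex \<Rightarrow> (nat set \<Rightarrow> complex) \<Rightarrow> nat set set \<Rightarrow> complex"
  where "nc_weight s t f \<pi> = (\<Prod>V\<in>\<pi>. (if V \<in> inner_blocks \<pi> then t else s) * f V)"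

definition nc_moment :: "complex \<Rightarrow> complex \<Rightarrow> ('b list \<Rightarrow> complex) \<Rightarrow> 'b list \<Rightarrow> complex"
  where "nc_moment s t b w = (\<Sum>\<pi>\<in>NC (length w). nc_weight s t (\<lambda>V. b (nths w V)) \<pi>)"

lemma nc_moment_Nil: "nc_moment s t b [] = 1"
proof -
  have "NC 0 = {{}}" by (auto simp: NC_def partition_on_empty noncrossing_def)
  then show ?thesis by (simp add: nc_moment_def nc_weight_def)
qed

lemma sum_noncrossing_partitions_image:
  assumes e: "strict_mono (e :: nat \<Rightarrow> nat)"
  shows "(\<Sum>\<pi>\<in>noncrossing_partitions (e ` A). nc_weight s t f \<pi>)
    = (\<Sum>\<pi>\<in>noncrossing_partitions A. nc_weight s t (\<lambda>V. f (e ` V)) \<pi>)"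
proof -
  have inj: "inj e" using e by (rule strict_mono_imp_inj_on)
  note lt = strict_mono_less[OF e]
  have inj_im: "inj ((`) e)" by (rule injI) (simp add: inj_image_eq_iff[OF inj])
  have part: "partition_on (e ` A) ((`) e ` \<pi>) \<longleftrightarrow> partition_on A \<pi>" for A and \<pi> :: "nat set set"
  proof -
    have "\<Union> ((`) e ` \<pi>) = e ` \<Union> \<pi>" by blast
    moreover have "disjoint ((`) e ` \<pi>) \<longleftrightarrow> disjoint \<pi>"
      by (simp add: disjoint_def inj_image_eq_iff[OF inj] image_Int[OF inj, symmetric])
    ultimately show ?thesis by (auto simp: partition_on_def inj_image_eq_iff[OF inj])
  qed
  have nc: "noncrossing ((`) e ` \<pi>) \<longleftrightarrow> noncrossing \<pi>" for \<pi>
    by (simp add: noncrossing_def inj_image_eq_iff[OF inj] lt)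
  have inner: "e ` V \<in> inner_blocks ((`) e ` \<pi>) \<longleftrightarrow> V \<in> inner_blocks \<pi>" for V \<pi>
    by (simp add: inner_blocks_def inj_image_mem_iff[OF inj_im] inj_image_eq_iff[OF inj] lt)
  have "noncrossing_partitions (e ` A) = (`) ((`) e) ` noncrossing_partitions A"
  proof (intro equalityI subsetI)
    fix \<rho> assume \<rho>: "\<rho> \<in> noncrossing_partitions (e ` A)"
    then have "\<rho> \<subseteq> Pow (e ` A)" by (auto simp: noncrossing_partitions_def partition_on_def)
    then have "\<rho> \<subseteq> (`) e ` Pow A" by (simp only: image_Pow_surj[OF refl])
    then obtain \<pi> where "\<rho> = (`) e ` \<pi>" by (auto simp: subset_image_iff)
    then show "\<rho> \<in> (`) ((`) e) ` noncrossing_partitions A"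
      using \<rho> by (auto simp: noncrossing_partitions_def part nc)
  qed (auto simp: noncrossing_partitions_def part nc)
  moreover have "inj_on ((`) ((`) e)) (noncrossing_partitions A)"
    by (rule inj_onI) (simp add: inj_image_eq_iff[OF inj_im])
  moreover have "nc_weight s t f ((`) e ` \<pi>) = nc_weight s t (\<lambda>V. f (e ` V)) \<pi>" for \<pi>
    unfolding nc_weight_def
    by (subst prod.reindex) (auto simp: inner inj_on_def inj_image_eq_iff[OF inj])
  ultimately show ?thesis by (simp add: sum.reindex)
qed

lemma nths_take: "V \<subseteq> {..<m} \<Longrightarrow> m \<le> length w \<Longrightarrow> nths (take m w) V = nths w V"
proof -
  assume *: "V \<subseteq> {..<m}" "m \<le> length w"
  have "nths w V = nths (take m w @ drop m w) V" by simp
  also have "\<dots> = nths (take m w) V @ nths (drop m w) {j. j + m \<in> V}"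
    using * by (simp add: nths_append del: append_take_drop_id)
  also have "{j. j + m \<in> V} = {}" using * by auto
  finally show ?thesis by simp
qed

lemma nc_moment_interval:
  assumes "i + m \<le> length w"
  shows "(\<Sum>\<rho>\<in>noncrossing_partitions ((+) i ` {..<m}). nc_weight s t (\<lambda>V. b (nths w V)) \<rho>)
    = nc_moment s t b (nths w ((+) i ` {..<m}))"
proof -
  let ?w = "nths w ((+) i ` {..<m})"
  have w: "?w = take m (drop i w)" by (simp flip: nths_drop)
  then have len: "length ?w = m" using assms by simp
  have "nths w ((+) i ` V) = nths ?w V" if "\<pi> \<in> noncrossing_partitions {..<m}" "V \<in> \<pi>" for \<pi> V
  proof -
    have "V \<subseteq> {..<m}" using that by (auto simp: noncrossing_partitions_def partition_on_def)
    then show ?thesis using assms unfolding w by (simp add: nths_take flip: nths_drop)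
  qed
  then show ?thesis
    unfolding nc_moment_def len NC_eq_noncrossing_partitions
    by (subst sum_noncrossing_partitions_image)
      (auto simp: nc_weight_def strict_mono_def intro!: sum.cong prod.cong)
qed

lemma components_disjoint:
  assumes "J \<in> set (components U)" "J' \<in> set (components U)" "p \<in> J" "p \<in> J'" "finite U"
  shows "J = J'"
proof -
  have "set (components U) = component_from U ` left_endpoints U"
    using assms(5) by (simp add: components_def left_endpoints_def)
  then obtain m m' where m: "m \<in> left_endpoints U" "J = component_from U m"
      "m' \<in> left_endpoints U" "J' = component_from U m'"
    using assms(1,2) by auto
  then have "m = m'" using assms(3,4) component_from_unique[of m U m' p] by simp
  with m show ?thesis by simp
qed

lemma distinct_components: "finite U \<Longrightarrow> distinct (components U)"
proof -
  assume "finite U"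
  then have fin: "finite (left_endpoints U)" by (simp add: left_endpoints_def)
  have "inj_on (component_from U) (left_endpoints U)"
  proof (rule inj_onI)
    fix m m' assume *: "m \<in> left_endpoints U" "m' \<in> left_endpoints U" "component_from U m = component_from U m'"
    then have "m \<in> component_from U m" by (auto simp: component_from_def left_endpoints_def)
    with * show "m = m'" using component_from_unique[of m U m' m] by simp
  qed
  then show ?thesis using fin by (simp add: components_def distinct_map)
qed

lemma components_cover: "finite U \<Longrightarrow> \<Union> (set (components U)) = U"
proof -
  assume "finite U"
  then have "set (components U) = component_from U ` left_endpoints U"
    by (simp add: components_def left_endpoints_def)
  then show ?thesis using ex_left_endpoint[of _ U] by (auto simp: component_from_def)
qed

lemma component_convex:
  assumes "J \<in> set (components U)" "a \<in> J" "c \<in> J" "a \<le> b" "b \<le> c" "finite U"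
  shows "b \<in> J"
proof -
  obtain m where "J = component_from U m" using assms by (auto simp: components_def left_endpoints_def)
  then show ?thesis using assms by (auto simp: component_from_def)
qed

lemma component_eq_interval:
  assumes "J \<in> set (components U)" "finite U"
  shows "\<exists>i j. J = {i..j} \<and> i \<le> j \<and> Suc j \<notin> U"
proof -
  obtain m where m: "m \<in> left_endpoints U" "J = component_from U m"
    using assms by (auto simp: components_def left_endpoints_def)
  have J: "J \<noteq> {}" "J \<subseteq> U" using components_nonempty[OF assms] by auto
  then have fin: "finite J" using assms(2) finite_subset by blast
  have Max: "Max J \<in> J" using J fin by simp
  then have "Max J \<in> component_from U m" by (simp only: m(2))
  then have le: "m \<le> Max J" "{m..Max J} \<subseteq> U" unfolding component_from_def by blast+
  have "J = {m..Max J}"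
  proof (intro equalityI subsetI)
    fix k assume k: "k \<in> J"
    then have "m \<le> k" unfolding m(2) component_from_def by simp
    then show "k \<in> {m..Max J}" using Max_ge[OF fin k] by simp
  next
    fix k assume "k \<in> {m..Max J}"
    then have "m \<le> k \<and> {m..k} \<subseteq> U" using le by auto
    then show "k \<in> J" by (subst m(2)) (simp only: component_from_def mem_Collect_eq)
  qed
  moreover have "Suc (Max J) \<notin> U"
  proof
    assume "Suc (Max J) \<in> U"
    moreover have "{m..Suc (Max J)} = insert (Suc (Max J)) {m..Max J}" using le(1) by auto
    ultimately have "m \<le> Suc (Max J) \<and> {m..Suc (Max J)} \<subseteq> U" using le by simp
    then have "Suc (Max J) \<in> J" by (subst m(2)) (simp only: component_from_def mem_Collect_eq)
    then have "Suc (Max J) \<le> Max J" by (rule Max_ge[OF fin])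
    then show False by simp
  qed
  ultimately show ?thesis using le by blast
qed

lemma subset_of_component:
  assumes U: "finite U" and V: "V \<noteq> {}" and between: "\<And>a b c. a \<in> V \<Longrightarrow> c \<in> V \<Longrightarrow> a \<le> b \<Longrightarrow> b \<le> c \<Longrightarrow> b \<in> U"
  shows "\<exists>J\<in>set (components U). V \<subseteq> J"
proof -
  have "V \<subseteq> U" using between by blast
  then have fin: "finite V" using U finite_subset by blast
  define a where "a = Min V"
  have a: "a \<in> V" using fin V by (simp add: a_def)
  then obtain m where m: "m \<in> left_endpoints U" "a \<in> component_from U m"
    using ex_left_endpoint[of a U] \<open>V \<subseteq> U\<close> by blast
  have "V \<subseteq> component_from U m"
  proof
    fix c assume c: "c \<in> V"
    then have ac: "a \<le> c" using fin by (simp add: a_def)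
    have "b \<in> U" if "b \<in> {m..c}" for b
      using that m(2) between[OF a c, of b] by (cases "b \<le> a") (auto simp: component_from_def)
    then show "c \<in> component_from U m" using m(2) ac by (auto simp: component_from_def)
  qed
  then show ?thesis using m U by (auto simp: components_def left_endpoints_def)
qed

text \<open>
  In the following, \<open>S\<close> is the block of the first point of a noncrossing partition of \<open>{0..n-1}\<close>. The
  partition then amounts to a choice of a noncrossing partition on each component of the complement
  of \<open>S\<close>.
\<close>

context
  fixes n :: nat and S :: "nat set"
  assumes S: "S \<subseteq> {..<n}" "0 \<in> S"
begin

abbreviation (input) "gaps \<equiv> set (components ({..<n} - S))"

lemma gap_nonempty: "J \<in> gaps \<Longrightarrow> J \<noteq> {} \<and> J \<subseteq> {..<n} - S"
  by (rule components_nonempty) simp_all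

lemma gap_below_S:
  assumes J: "J \<in> gaps" and last: "n \<notin> Suc ` J"
  shows "\<exists>s\<in>S. \<forall>v\<in>J. v < s"
proof -
  obtain i j where ij: "J = {i..j}" "i \<le> j" "Suc j \<notin> {..<n} - S"
    using component_eq_interval[OF J] by auto
  then have "j < n" "Suc j \<noteq> n" using gap_nonempty[OF J] last by auto
  then have "Suc j \<in> S" using ij by auto
  then show ?thesis using ij by (intro bexI[of _ "Suc j"]) auto
qed

text \<open>
  A point \<open>b\<close> of \<open>S\<close> between two points \<open>a\<close>, \<open>c\<close> of another block would give the crossing \<open>0 < a < b < c\<close>.
\<close>

lemma noncrossing_block_in_gap:
  assumes \<pi>: "\<pi> \<in> NC n" "S \<in> \<pi>" and V: "V \<in> \<pi>" "V \<noteq> S"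
  shows "\<exists>J\<in>gaps. V \<subseteq> J"
proof (rule subset_of_component)
  have p: "partition_on {..<n} \<pi>" and nc: "noncrossing \<pi>" using \<pi> by (auto simp: NC_def)
  show "V \<noteq> {}" using p V by (auto simp: partition_on_def)
  have VS: "V \<inter> S = {}" "V \<subseteq> {..<n}" using p V \<pi> by (auto simp: partition_on_def disjoint_def)
  fix a b c assume abc: "a \<in> V" "c \<in> V" "a \<le> b" "b \<le> c"
  have "b \<notin> S"
  proof
    assume b: "b \<in> S"
    then have "a \<noteq> b" "b \<noteq> c" "a \<noteq> 0" using abc VS S by auto
    then have "0 < a" "a < b" "b < c" using abc by auto
    then have "S = V" using noncrossingD[OF nc \<pi>(2) V(1) S(2) abc(1) b abc(2)] by simp
    then show False using V(2) by simp
  qed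
  then show "b \<in> {..<n} - S" using abc VS by auto
qed simp

lemma blocks_in_gap:
  assumes \<pi>: "\<pi> \<in> NC n" "S \<in> \<pi>" and J: "J \<in> gaps"
  shows "{V \<in> \<pi>. V \<subseteq> J} \<in> noncrossing_partitions J"
proof -
  have p: "partition_on {..<n} \<pi>" and nc: "noncrossing \<pi>" using \<pi> by (auto simp: NC_def)
  have "\<exists>V\<in>\<pi>. p \<in> V \<and> V \<subseteq> J" if "p \<in> J" for p
  proof -
    have "p \<in> {..<n}" "p \<notin> S" using gap_nonempty[OF J] that by auto
    then obtain V where V: "V \<in> \<pi>" "p \<in> V" using p by (auto simp: partition_on_def)
    then have "V \<noteq> S" using \<open>p \<notin> S\<close> by auto
    then obtain J' where J': "J' \<in> gaps" "V \<subseteq> J'" using noncrossing_block_in_gap[OF \<pi> V(1)] by blast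
    then have "J' = J" using components_disjoint[OF J'(1) J] V that by auto
    then show ?thesis using V J' by auto
  qed
  then have "\<Union> {V \<in> \<pi>. V \<subseteq> J} = J" by auto
  then have "partition_on J {V \<in> \<pi>. V \<subseteq> J}"
    using p by (auto simp: partition_on_def disjoint_def)
  moreover have "noncrossing {V \<in> \<pi>. V \<subseteq> J}"
  proof (rule noncrossingI)
    fix V W a b c d
    assume "V \<in> {V \<in> \<pi>. V \<subseteq> J}" "W \<in> {V \<in> \<pi>. V \<subseteq> J}" "V \<noteq> W"
      and abcd: "a \<in> V" "b \<in> W" "c \<in> V" "d \<in> W" "a < b" "b < c" "c < d"
    then show False using noncrossingD[OF nc _ _ abcd] by simp
  qed
  ultimately show ?thesis by (simp add: noncrossing_partitions_def)
qed

text \<open>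
  Crossings between different gaps, or between a gap and \<open>S\<close>, are excluded because the gaps are
  intervals that do not meet \<open>S\<close>.
\<close>

lemma glue_gap_partitions:
  assumes h: "\<forall>J\<in>gaps. h J \<in> noncrossing_partitions J"
  shows "insert S (\<Union>J\<in>gaps. h J) \<in> NC n"
    and "\<And>J. J \<in> gaps \<Longrightarrow> {V \<in> insert S (\<Union>J\<in>gaps. h J). V \<subseteq> J} = h J"
    and "S \<notin> (\<Union>J\<in>gaps. h J)"
proof -
  let ?\<pi> = "insert S (\<Union>J\<in>gaps. h J)"
  have sub: "V \<subseteq> J" "V \<noteq> {}" if "J \<in> gaps" "V \<in> h J" for V J
    using h[rule_format, OF that(1)] that(2) by (auto simp: noncrossing_partitions_def partition_on_def)
  have same: "J = J'" if "J \<in> gaps" "J' \<in> gaps" "p \<in> J" "p \<in> J'" for J J' p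
    using components_disjoint[OF that] by simp
  have avoid: "p \<notin> S" "p < n" if "J \<in> gaps" "p \<in> J" for J p
    using gap_nonempty[OF that(1)] that(2) by auto
  show "S \<notin> (\<Union>J\<in>gaps. h J)"
  proof
    assume "S \<in> (\<Union>J\<in>gaps. h J)"
    then obtain J where J: "J \<in> gaps" "S \<in> h J" by blast
    then have "0 \<in> J" using sub S by blast
    then show False using avoid[OF J(1)] S by blast
  qed
  show "{V \<in> ?\<pi>. V \<subseteq> J} = h J" if J: "J \<in> gaps" for J
  proof (intro equalityI subsetI)
    fix V assume V: "V \<in> {V \<in> ?\<pi>. V \<subseteq> J}"
    then have "V \<noteq> S" using avoid[OF J] S by auto
    then obtain J' where J': "J' \<in> gaps" "V \<in> h J'" using V by auto
    then obtain p where "p \<in> V" using sub by blast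
    then have "J' = J" using same[OF J'(1) J, of p] sub(1)[OF J'] V by auto
    then show "V \<in> h J" using J' by simp
  qed (use J sub in auto)
  have "\<Union> ?\<pi> = {..<n}"
  proof -
    have "(\<Union>J\<in>gaps. \<Union> (h J)) = \<Union> gaps"
      using h by (intro SUP_cong[of gaps gaps _ "\<lambda>J. J", simplified]) (auto simp: noncrossing_partitions_def partition_on_def)
    then have "\<Union> ?\<pi> = S \<union> \<Union> gaps" by auto
    also have "\<Union> gaps = {..<n} - S" by (rule components_cover) simp
    finally show ?thesis using S by auto
  qed
  moreover have "disjoint ?\<pi>"
    unfolding disjoint_def
  proof (intro ballI impI, rule ccontr)
    fix V W assume VW: "V \<in> ?\<pi>" "W \<in> ?\<pi>" "V \<noteq> W" "V \<inter> W \<noteq> {}"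
    then obtain p where p: "p \<in> V" "p \<in> W" by blast
    show False
    proof (cases "V = S \<or> W = S")
      case True
      then show False using VW p sub avoid by blast
    next
      case False
      then obtain J J' where J: "J \<in> gaps" "V \<in> h J" "J' \<in> gaps" "W \<in> h J'" using VW by auto
      then have "J = J'" using same[OF J(1,3)] sub p by blast
      then show False
        using J VW h[rule_format, OF J(1)] by (auto simp: noncrossing_partitions_def partition_on_def disjoint_def)
    qed
  qed
  moreover have "{} \<notin> ?\<pi>" using sub S by auto
  moreover have "noncrossing ?\<pi>"
  proof (rule noncrossingI)
    fix V W a b c d
    assume VW: "V \<in> ?\<pi>" "W \<in> ?\<pi>" "V \<noteq> W" and abcd: "a \<in> V" "b \<in> W" "c \<in> V" "d \<in> W" "a < b" "b < c" "c < d"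
    have convex: "q \<in> J" if "J \<in> gaps" "p \<in> J" "r \<in> J" "p < q" "q < r" for J p q r
      using component_convex[OF that(1-3), of q] that by simp
    show False
    proof (cases "V = S")
      case True
      then obtain J where J: "J \<in> gaps" "W \<in> h J" using VW by auto
      then have "c \<in> J" using convex[OF J(1), of b d c] sub abcd by auto
      then show False using avoid[OF J(1)] True abcd by auto
    next
      case False
      then obtain J where J: "J \<in> gaps" "V \<in> h J" using VW by auto
      then have b: "b \<in> J" using convex[OF J(1), of a c b] sub abcd by auto
      then have "W \<noteq> S" using avoid[OF J(1)] abcd by auto
      then obtain J' where J': "J' \<in> gaps" "W \<in> h J'" using VW by auto
      then have "J' = J" using same[OF J'(1) J(1), of b] b sub abcd by auto
      then show False
        using noncrossingD[of "h J" V W a b c d] h[rule_format, OF J(1)] J J' VW abcd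
        by (simp add: noncrossing_partitions_def)
    qed
  qed
  ultimately show "?\<pi> \<in> NC n" by (simp add: NC_def partition_on_def)
qed

text \<open>
  A block in a gap that is followed by a point of \<open>S\<close> lies between that point and \<open>0\<close>. In the final
  gap, any block around \<open>V\<close> has a point to the right of \<open>V\<close>, so it lies in the same gap.
\<close>

lemma inner_blocks_in_gap:
  assumes \<pi>: "\<pi> \<in> NC n" "S \<in> \<pi>" and J: "J \<in> gaps" and V: "V \<in> \<pi>" "V \<subseteq> J"
  shows "V \<in> inner_blocks \<pi> \<longleftrightarrow> n \<notin> Suc ` J \<or> V \<in> inner_blocks {V \<in> \<pi>. V \<subseteq> J}"
proof -
  have p: "partition_on {..<n} \<pi>" using \<pi> by (auto simp: NC_def)
  then have V0: "V \<noteq> {}" using V by (auto simp: partition_on_def)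
  have VS: "V \<noteq> S" using V S gap_nonempty[OF J] by auto
  have "V \<in> inner_blocks \<pi>" if not_last: "n \<notin> Suc ` J"
  proof -
    obtain s where s: "s \<in> S" "\<forall>v\<in>J. v < s" using gap_below_S[OF J not_last] by blast
    have "0 \<notin> J" using gap_nonempty[OF J] S(2) by blast
    then have "0 < v" if "v \<in> J" for v using that by (cases v) simp_all
    then have "\<forall>c\<in>V. 0 < c \<and> c < s" using s V(2) by blast
    then show ?thesis by (rule inner_blocksI[OF V(1) \<pi>(2) VS[symmetric] S(2) s(1)])
  qed
  moreover have "V \<in> inner_blocks \<pi>" if "V \<in> inner_blocks {V \<in> \<pi>. V \<subseteq> J}"
    using that by (elim inner_blocksE) (rule inner_blocksI, auto)
  moreover have "V \<in> inner_blocks {V \<in> \<pi>. V \<subseteq> J}" if inner: "V \<in> inner_blocks \<pi>" and last: "n \<in> Suc ` J"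
  proof -
    obtain W a b where W: "W \<in> \<pi>" "W \<noteq> V" "a \<in> W" "b \<in> W" "\<forall>c\<in>V. a < c \<and> c < b"
      using inner by (rule inner_blocksE)
    obtain v where v: "v \<in> V" using V0 by blast
    obtain k where k: "k \<in> J" "Suc k = n" using last by auto
    have "b < n" using W p by (auto simp: partition_on_def)
    moreover have "v \<in> J" "v < b" using v V W(5) by auto
    ultimately have "b \<in> J" using component_convex[OF J, of v k b] k by simp
    moreover have "W \<noteq> S" using \<open>b \<in> J\<close> W(4) gap_nonempty[OF J] by auto
    then obtain J' where "J' \<in> gaps" "W \<subseteq> J'" using noncrossing_block_in_gap[OF \<pi> W(1)] by blast
    ultimately have "W \<subseteq> J" using components_disjoint[OF J, of J' b] W(4) by auto
    then show ?thesis using W V by (intro inner_blocksI[of V _ W a b]) simp_all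
  qed
  ultimately show ?thesis by blast
qed

lemma first_block_outer: "S \<notin> inner_blocks \<pi>"
  using S(2) by (auto elim: inner_blocksE)

lemma nc_weight_glue:
  assumes h: "\<forall>J\<in>gaps. h J \<in> noncrossing_partitions J"
  shows "nc_weight s t f (insert S (\<Union>J\<in>gaps. h J))
    = s * f S * (\<Prod>J\<in>gaps. nc_weight (if n \<in> Suc ` J then s else t) t f (h J))"
proof -
  let ?\<pi> = "insert S (\<Union>J\<in>gaps. h J)"
  note glue = glue_gap_partitions[OF h]
  have S\<pi>: "S \<in> ?\<pi>" by simp
  let ?c = "\<lambda>V. (if V \<in> inner_blocks ?\<pi> then t else s) * f V"
  have fin: "finite (h J)" if "J \<in> gaps" for J
  proof -
    have "finite J" using gap_nonempty[OF that] finite_subset[of J "{..<n}"] by auto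
    then show ?thesis by (rule finite_noncrossing_partition[OF h[rule_format, OF that]])
  qed
  have disj: "h J \<inter> h J' = {}" if J: "J \<in> gaps" "J' \<in> gaps" "J \<noteq> J'" for J J'
  proof (rule ccontr)
    assume "h J \<inter> h J' \<noteq> {}"
    then obtain V where "V \<in> h J" "V \<in> h J'" by blast
    then have "V \<subseteq> J" "V \<subseteq> J'" "V \<noteq> {}"
      using h[rule_format, OF J(1)] h[rule_format, OF J(2)] by (auto simp: noncrossing_partitions_def partition_on_def)
    then show False using components_disjoint[OF J(1,2)] J(3) by auto
  qed
  have "nc_weight s t f ?\<pi> = ?c S * (\<Prod>V\<in>(\<Union>J\<in>gaps. h J). ?c V)"
    unfolding nc_weight_def by (rule prod.insert) (use fin glue(3) in auto)
  also have "?c S = s * f S" using first_block_outer by simp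
  also have "(\<Prod>V\<in>(\<Union>J\<in>gaps. h J). ?c V) = (\<Prod>J\<in>gaps. \<Prod>V\<in>h J. ?c V)"
    by (rule prod.UNION_disjoint) (use fin disj in auto)
  also have "\<dots> = (\<Prod>J\<in>gaps. nc_weight (if n \<in> Suc ` J then s else t) t f (h J))"
  proof (rule prod.cong[OF refl])
    fix J assume J: "J \<in> gaps"
    have "V \<in> inner_blocks ?\<pi> \<longleftrightarrow> n \<notin> Suc ` J \<or> V \<in> inner_blocks (h J)" if "V \<in> h J" for V
    proof -
      have "V \<in> {V \<in> ?\<pi>. V \<subseteq> J}" using glue(2)[OF J] that by simp
      then have "V \<in> ?\<pi>" "V \<subseteq> J" by auto
      from inner_blocks_in_gap[OF glue(1) S\<pi> J this] show ?thesis by (simp only: glue(2)[OF J])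
    qed
    then show "(\<Prod>V\<in>h J. ?c V) = nc_weight (if n \<in> Suc ` J then s else t) t f (h J)"
      unfolding nc_weight_def by (intro prod.cong[OF refl]) auto
  qed
  finally show ?thesis .
qed

lemma sum_nc_weight_first_block:
  "(\<Sum>\<pi> | \<pi> \<in> NC n \<and> S \<in> \<pi>. nc_weight s t f \<pi>) = s * f S * (\<Prod>J\<in>gaps.
    \<Sum>\<rho>\<in>noncrossing_partitions J. nc_weight (if n \<in> Suc ` J then s else t) t f \<rho>)"
proof -
  have fin: "finite (noncrossing_partitions J)" if "J \<in> gaps" for J
    using gap_nonempty[OF that] finite_subset[of J "{..<n}"] by (auto intro!: finite_noncrossing_partitions)
  have "(\<Prod>J\<in>gaps. \<Sum>\<rho>\<in>noncrossing_partitions J. nc_weight (if n \<in> Suc ` J then s else t) t f \<rho>)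
      = (\<Sum>h\<in>PiE gaps noncrossing_partitions.
          \<Prod>J\<in>gaps. nc_weight (if n \<in> Suc ` J then s else t) t f (h J))"
    by (rule prod_sum_PiE) (use fin in auto)
  then have "s * f S * (\<Prod>J\<in>gaps. \<Sum>\<rho>\<in>noncrossing_partitions J. nc_weight (if n \<in> Suc ` J then s else t) t f \<rho>)
      = (\<Sum>h\<in>PiE gaps noncrossing_partitions. nc_weight s t f (insert S (\<Union>J\<in>gaps. h J)))"
    by (auto simp: sum_distrib_left nc_weight_glue PiE_mem intro!: sum.cong)
  also have "\<dots> = (\<Sum>\<pi> | \<pi> \<in> NC n \<and> S \<in> \<pi>. nc_weight s t f \<pi>)"
  proof (rule sum.reindex_bij_witness[where i = "\<lambda>\<pi>. \<lambda>J\<in>gaps. {V \<in> \<pi>. V \<subseteq> J}" and j = "\<lambda>h. insert S (\<Union>J\<in>gaps. h J)"])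
    fix h assume h: "h \<in> PiE gaps noncrossing_partitions"
    then have hJ: "\<forall>J\<in>gaps. h J \<in> noncrossing_partitions J" by (auto simp: PiE_mem)
    note glue = glue_gap_partitions[OF hJ]
    show "insert S (\<Union>J\<in>gaps. h J) \<in> {\<pi>. \<pi> \<in> NC n \<and> S \<in> \<pi>}" using glue(1) by simp
    show "(\<lambda>J\<in>gaps. {V \<in> insert S (\<Union>J\<in>gaps. h J). V \<subseteq> J}) = h"
    proof
      fix J
      show "(\<lambda>J\<in>gaps. {V \<in> insert S (\<Union>J\<in>gaps. h J). V \<subseteq> J}) J = h J"
        using glue(2)[of J] PiE_arb[OF h, of J] by (simp only: restrict_def split: if_splits) simp
    qed
  next
    fix \<pi> assume \<pi>: "\<pi> \<in> {\<pi>. \<pi> \<in> NC n \<and> S \<in> \<pi>}"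
    then show "(\<lambda>J\<in>gaps. {V \<in> \<pi>. V \<subseteq> J}) \<in> PiE gaps noncrossing_partitions"
      using blocks_in_gap[of \<pi>] by auto
    show "insert S (\<Union>J\<in>gaps. (\<lambda>J\<in>gaps. {V \<in> \<pi>. V \<subseteq> J}) J) = \<pi>"
      using \<pi> noncrossing_block_in_gap[of \<pi>] by auto
  qed simp
  finally show ?thesis by simp
qed

end

lemma sum_NC_by_first_block:
  assumes "n > 0"
  shows "(\<Sum>\<pi>\<in>NC n. F \<pi>) = (\<Sum>S | S \<subseteq> {..<n} \<and> 0 \<in> S. \<Sum>\<pi> | \<pi> \<in> NC n \<and> S \<in> \<pi>. F \<pi>)"
proof -
  let ?\<S> = "{S. S \<subseteq> {..<n} \<and> 0 \<in> S}"
  have "NC n = (\<Union>S\<in>?\<S>. {\<pi>. \<pi> \<in> NC n \<and> S \<in> \<pi>})"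
  proof (intro equalityI subsetI)
    fix \<pi> assume \<pi>: "\<pi> \<in> NC n"
    then have "\<Union> \<pi> = {..<n}" by (auto simp: NC_def partition_on_def)
    then obtain S where "S \<in> \<pi>" "0 \<in> S" "S \<subseteq> {..<n}" using assms by blast
    then show "\<pi> \<in> (\<Union>S\<in>?\<S>. {\<pi>. \<pi> \<in> NC n \<and> S \<in> \<pi>})" using \<pi> by auto
  qed auto
  then have "(\<Sum>\<pi>\<in>NC n. F \<pi>) = (\<Sum>\<pi>\<in>(\<Union>S\<in>?\<S>. {\<pi>. \<pi> \<in> NC n \<and> S \<in> \<pi>}). F \<pi>)" by simp
  also have "\<dots> = (\<Sum>S\<in>?\<S>. \<Sum>\<pi> | \<pi> \<in> NC n \<and> S \<in> \<pi>. F \<pi>)"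
  proof (rule sum.UNION_disjoint)
    show "finite ?\<S>" by (rule finite_subset[of _ "Pow {..<n}"]) auto
    show "\<forall>S\<in>?\<S>. finite {\<pi>. \<pi> \<in> NC n \<and> S \<in> \<pi>}" using finite_NC by simp
    have "S = S'" if "S \<in> \<pi>" "S' \<in> \<pi>" "0 \<in> S" "0 \<in> S'" "\<pi> \<in> NC n" for S S' \<pi>
      using that unfolding NC_def partition_on_def disjoint_def by blast
    then show "\<forall>S\<in>?\<S>. \<forall>S'\<in>?\<S>. S \<noteq> S' \<longrightarrow>
        {\<pi>. \<pi> \<in> NC n \<and> S \<in> \<pi>} \<inter> {\<pi>. \<pi> \<in> NC n \<and> S' \<in> \<pi>} = {}" by blast
  qed
  finally show ?thesis .
qed

text \<open>
  The blocks in the non-final gaps are all inner, so these gaps carry the weight with \<open>s = t\<close>.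
\<close>

lemma nc_moment_Cons:
  "nc_moment s t b (a # x) = s * gap_sum (\<lambda>v. b (a # v))
    (nc_moment t t b) (nc_moment s t b) (nc_moment t t b) (nc_moment s t b) x"
proof -
  let ?w = "a # x"
  let ?n = "length ?w"
  have "nc_moment s t b ?w = (\<Sum>S | S \<subseteq> {..<?n} \<and> 0 \<in> S. s * (b (nths ?w S) *
      (\<Prod>J\<leftarrow>components ({..<?n} - S).
        (if ?n \<in> Suc ` J then nc_moment s t b else nc_moment t t b) (nths ?w J))))"
    unfolding nc_moment_def[of s t b ?w]
  proof (subst sum_NC_by_first_block, goal_cases)
    case 2
    show ?case
    proof (rule sum.cong[OF refl])
      fix S assume "S \<in> {S. S \<subseteq> {..<?n} \<and> 0 \<in> S}"
      then have S: "S \<subseteq> {..<?n}" "0 \<in> S" by auto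
      have moment: "(\<Sum>\<rho>\<in>noncrossing_partitions J. nc_weight s' t (\<lambda>V. b (nths ?w V)) \<rho>)
          = nc_moment s' t b (nths ?w J)" if J: "J \<in> set (components ({..<?n} - S))" for J s'
      proof -
        obtain i j where ij: "J = {i..j}" "i \<le> j" using component_eq_interval[OF J] by auto
        have "J \<subseteq> {..<?n}" using components_nonempty[OF J] by auto
        then have j: "j < ?n" using ij by auto
        have shift: "J = (+) i ` {..<Suc j - i}"
        proof (intro equalityI subsetI)
          fix k assume "k \<in> J"
          then show "k \<in> (+) i ` {..<Suc j - i}" using ij by (intro image_eqI[of _ _ "k - i"]) auto
        qed (use ij in auto)
        show ?thesis unfolding shift by (rule nc_moment_interval) (use ij j in auto)
      qed
      have "(\<Sum>\<pi> | \<pi> \<in> NC ?n \<and> S \<in> \<pi>. nc_weight s t (\<lambda>V. b (nths ?w V)) \<pi>)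
          = s * b (nths ?w S) * (\<Prod>J\<in>set (components ({..<?n} - S)).
              nc_moment (if ?n \<in> Suc ` J then s else t) t b (nths ?w J))"
        unfolding sum_nc_weight_first_block[OF S] using moment by (simp cong: prod.cong)
      also have "(\<Prod>J\<in>set (components ({..<?n} - S)).
              nc_moment (if ?n \<in> Suc ` J then s else t) t b (nths ?w J))
          = (\<Prod>J\<leftarrow>components ({..<?n} - S).
              nc_moment (if ?n \<in> Suc ` J then s else t) t b (nths ?w J))"
        by (rule prod.distinct_set_conv_list) (simp add: distinct_components)
      finally show "(\<Sum>\<pi> | \<pi> \<in> NC ?n \<and> S \<in> \<pi>. nc_weight s t (\<lambda>V. b (nths ?w V)) \<pi>)
          = s * (b (nths ?w S) * (\<Prod>J\<leftarrow>components ({..<?n} - S).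
              (if ?n \<in> Suc ` J then nc_moment s t b else nc_moment t t b) (nths ?w J)))"
        by (simp add: if_distrib[of "\<lambda>s'. nc_moment s' t b"] mult.assoc)
    qed
  qed simp
  also have "\<dots> = s * gap_sum (\<lambda>v. b (a # v))
      (nc_moment t t b) (nc_moment s t b) (nc_moment t t b) (nc_moment s t b) x"
    unfolding sum_distrib_left[symmetric]
    by (rule arg_cong[where f = "(*) s"], rule gap_sum_eq_sum_positions_from_first)
      (simp_all add: nc_moment_Nil)
  finally show ?thesis .
qed

section \<open>The cumulants of the half-shuffle conjugate\<close>

lemma nc_weight_one_outer:
  assumes "finite \<pi>"
  shows "nc_weight 1 t f \<pi> = t ^ inner \<pi> * (\<Prod>V\<in>\<pi>. f V)"
proof -
  have "(\<Prod>V\<in>\<pi>. if V \<in> inner_blocks \<pi> then t else 1) = (\<Prod>V\<in>\<pi> \<inter> inner_blocks \<pi>. t)"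
    by (rule prod.inter_restrict[OF assms, symmetric])
  also have "\<pi> \<inter> inner_blocks \<pi> = inner_blocks \<pi>" by (auto simp: inner_blocks_def)
  finally show ?thesis by (simp add: nc_weight_def prod.distrib inner_def)
qed

text \<open>
  The moment-cumulant formula determines the cumulants, since every partition other than the
  one-block partition has only shorter blocks.
\<close>

lemma t_boolean_cumulant_unique:
  assumes "\<And>as. as \<noteq> [] \<Longrightarrow> \<phi> (prod_list as) = nc_moment 1 (of_real t) b as"
    and "as \<noteq> []"
  shows "b as = t_boolean_cumulant \<phi> t as"
  using assms(2)
proof (induction as rule: measure_induct_rule[of length])
  case (less as)
  let ?one = "{{..<length as}}"
  let ?N = "NC (length as)"
  let ?W = "\<lambda>b \<pi>. of_real t ^ inner \<pi> * (\<Prod>V\<in>\<pi>. b (nths as V)) :: complex"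
  have one: "?one \<in> ?N"
    using less.prems
    by (simp add: NC_def partition_on_def noncrossing_def eq_commute[of "{}"] lessThan_empty_iff)
  have "finite \<pi>" if "\<pi> \<in> ?N" for \<pi>
    using that finite_noncrossing_partition[of \<pi> "{..<length as}"] by (simp add: NC_eq_noncrossing_partitions)
  then have "\<phi> (prod_list as) = (\<Sum>\<pi>\<in>?N. ?W b \<pi>)"
    using assms(1)[OF less.prems] by (simp add: nc_moment_def nc_weight_one_outer)
  also have "\<dots> = ?W b ?one + (\<Sum>\<pi>\<in>?N - {?one}. ?W b \<pi>)"
    by (rule sum.remove[OF finite_NC one])
  also have "?W b ?one = b as"
  proof -
    have "inner ?one = 0" by (simp add: inner_def inner_blocks_def)
    then show ?thesis by (simp add: nths_all)
  qed
  also have "(\<Sum>\<pi>\<in>?N - {?one}. ?W b \<pi>) = (\<Sum>\<pi>\<in>?N - {?one}. ?W (t_boolean_cumulant \<phi> t) \<pi>)"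
  proof (rule sum.cong[OF refl])
    fix \<pi> assume \<pi>: "\<pi> \<in> ?N - {?one}"
    have "b (nths as V) = t_boolean_cumulant \<phi> t (nths as V)" if V: "V \<in> \<pi>" for V
    proof (rule less.IH)
      show "length (nths as V) < length as" by (rule length_nths_block[OF \<pi> V refl])
      have "V \<noteq> {}" "V \<subseteq> {..<length as}" using \<pi> V by (auto simp: NC_def partition_on_def)
      then show "nths as V \<noteq> []" by (rule nths_nonempty)
    qed
    then show "?W b \<pi> = ?W (t_boolean_cumulant \<phi> t) \<pi>" by simp
  qed
  finally show ?case by (subst t_boolean_cumulant.simps) simp
qed

text \<open>
  The comparison of Boolean and free cumulants described at the beginning, with \<open>F\<close>, \<open>M\<close>, \<open>B\<close>, \<open>b\<close> in the
  roles of \<open>\<Phi>\<^sub>t\<close>, \<open>\<Phi>\<close>, \<open>\<beta>\<close>, \<open>\<beta>\<^sub>t\<close>.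
\<close>

lemma nc_moment_of_conjugate:
  fixes F M B b :: "'b list \<Rightarrow> complex"
  assumes F_Nil: "F [] = 1" and M_Nil: "M [] = 1"
    and F: "\<And>a x. F (a # x) = t * (\<Sum>i\<le>length x. B (a # take i x) * F (drop i x))"
    and M: "\<And>a x. M (a # x) = (\<Sum>i\<le>length x. B (a # take i x) * M (drop i x))"
    and conj: "\<And>a x. (\<Sum>i\<le>length x. B (a # take i x) * F (drop i x)) = gap_conv (\<lambda>v. b (a # v)) F F x"
  shows "M w = nc_moment 1 t b w"
proof -
  have F_eq: "F w = nc_moment t t b w" for w
  proof (induction w rule: measure_induct_rule[of length])
    case (less w)
    show ?case
    proof (cases w)
      case Nil
      then show ?thesis by (simp add: F_Nil nc_moment_Nil)
    next
      case (Cons a x)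
      have "gap_conv (\<lambda>v. b (a # v)) F F x
          = gap_conv (\<lambda>v. b (a # v)) (nc_moment t t b) (nc_moment t t b) x"
        by (rule gap_sum_cong) (use less.IH Cons in simp_all)
      then show ?thesis by (simp add: Cons F conj nc_moment_Cons)
    qed
  qed
  \<comment> \<open>\<open>I a x\<close> is the part of the sum in which the block of the first letter also contains the last
    letter of \<open>a # x\<close>, i.e. the part from the partitions with a single outer block.\<close>
  define I where "I a x = gap_sum (\<lambda>v. b (a # v)) F empty_indicator F empty_indicator x" for a x
  have I_eq: "I a x = B (a # x)" for a x
  proof (induction x rule: measure_induct_rule[of length])
    case (less x)
    have "{..length x} = insert (length x) {..<length x}" by auto
    then have split: "(\<Sum>i\<le>length x. h i) = h (length x) + (\<Sum>i<length x. h i)" for h :: "nat \<Rightarrow> complex"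
      by simp
    \<comment> \<open>The two sums agree in all summands with \<open>i < length x\<close>, and the last summands are \<open>I a x\<close> and
      \<open>B (a # x)\<close>.\<close>
    have "(\<Sum>i\<le>length x. I a (take i x) * F (drop i x)) = (\<Sum>i\<le>length x. B (a # take i x) * F (drop i x))"
      unfolding conj I_def by (rule gap_sum_cut[symmetric])
    moreover have "(\<Sum>i<length x. I a (take i x) * F (drop i x)) = (\<Sum>i<length x. B (a # take i x) * F (drop i x))"
      by (rule sum.cong[OF refl]) (use less.IH in simp)
    ultimately show ?case by (simp add: split F_Nil)
  qed
  show ?thesis
  proof (induction w rule: measure_induct_rule[of length])
    case (less w)
    show ?case
    proof (cases w)
      case Nil
      then show ?thesis by (simp add: M_Nil nc_moment_Nil)
    next
      case (Cons a x)
      have "nc_moment t t b = F" by (rule ext) (simp add: F_eq)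
      then have "nc_moment 1 t b w = (\<Sum>i\<le>length x. I a (take i x) * nc_moment 1 t b (drop i x))"
        unfolding Cons nc_moment_Cons I_def by (subst gap_sum_cut) simp
      also have "\<dots> = (\<Sum>i\<le>length x. B (a # take i x) * M (drop i x))"
        by (rule sum.cong[OF refl]) (use less.IH Cons in \<open>simp add: I_eq\<close>)
      finally show ?thesis by (simp add: Cons M)
    qed
  qed
qed

text \<open>
  The form \<open>\<Phi> \<succ> \<beta>\<close> is not a character, as it vanishes on the unit, but it acts like \<open>\<Phi>\<close> on everything behind
  the first word.
\<close>

lemma right_half_shuffle_character_mult:
  assumes \<Phi>: "character \<Phi>" and \<beta>: "infinitesimal_character \<beta>"
  shows "(\<Phi> \<succ> \<beta>) (word_tensor w * x) = (\<Phi> \<succ> \<beta>) (word_tensor w) * \<Phi> x"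
proof (induction x rule: double_tensor_induct)
  case (barred ws)
  have "\<Phi> (barred (us @ ws)) = \<Phi> (barred us) * \<Phi> (barred ws)" for us
    by (simp add: character_mult[OF \<Phi>] flip: times_barred)
  then show ?case
    by (simp add: times_barred right_half_shuffle_barred_Cons[OF clinear_character[OF \<Phi>] \<beta>]
        sum_distrib_right mult.assoc)
next
  case (add z z')
  then show ?case
    by (simp add: distrib_left clinear_add[OF clinear_character[OF \<Phi>]]
        clinear_add[OF clinear_right_half_shuffle[OF clinear_character[OF \<Phi>] clinear_infinitesimal[OF \<beta>]]])
next
  case (scale c z)
  then show ?case
    by (simp add: clinear_scale[OF clinear_character[OF \<Phi>]]
        clinear_scale[OF clinear_right_half_shuffle[OF clinear_character[OF \<Phi>] clinear_infinitesimal[OF \<beta>]]])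
qed

text \<open>
  Behind the first word, \<open>\<Phi> \<succ> \<beta> \<prec> \<Phi>\<^sup>-\<^sup>1\<close> takes the values of \<open>\<Phi> \<star> \<Phi>\<^sup>-\<^sup>1\<close>, the counit, which vanishes on
  nonempty barred words.
\<close>

lemma infinitesimal_conjugate:
  assumes \<Phi>: "character \<Phi>" and \<beta>: "infinitesimal_character \<beta>"
  shows "infinitesimal_character (\<Phi> \<succ> \<beta> \<prec> conv_inverse \<Phi>)"
proof -
  note inv = conv_inverse[OF \<Phi>]
  have lin: "clinear (\<Phi> \<succ> \<beta>)"
    by (rule clinear_right_half_shuffle[OF clinear_character[OF \<Phi>] clinear_infinitesimal[OF \<beta>]])
  have "(\<Phi> \<succ> \<beta> \<prec> conv_inverse \<Phi>) (barred ws) = 0" if len: "length ws \<ge> 2" for ws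
  proof -
    obtain w ws' where ws: "ws = w # ws'" "ws' \<noteq> []" using len by (cases ws; cases "tl ws") auto
    have "(\<Phi> \<succ> \<beta> \<prec> conv_inverse \<Phi>) (barred ws) =
        (\<Phi> \<succ> \<beta> \<prec> conv_inverse \<Phi>) (word_tensor w) * counit (barred ws')"
      using left_half_shuffle_barred_Cons[OF lin clinear_character[OF \<Phi>] inv(1)
          right_half_shuffle_character_mult[OF \<Phi> \<beta>], of w ws'] by (simp only: ws(1) inv(2))
    then show ?thesis using ws(2) by (simp add: counit_barred)
  qed
  then show ?thesis
    unfolding infinitesimal_character_def
    using clinear_left_half_shuffle[OF lin clinear_character[OF inv(1)]]
      left_half_shuffle_1[OF lin clinear_character[OF inv(1)]] by blast
qed

text \<open>
  This is the identity \<open>\<Phi> \<succ> \<beta> = (\<Phi> \<succ> \<beta> \<prec> \<Phi>\<^sup>-\<^sup>1) \<prec> \<Phi>\<close> on words, an instance of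
  \<open>(f \<prec> g) \<prec> h = f \<prec> (g \<star> h)\<close>.
\<close>

lemma conjugate_on_list:
  assumes \<Phi>: "character \<Phi>" and \<beta>: "infinitesimal_character \<beta>"
  shows "on_list (\<Phi> \<succ> \<beta>) (a # x) =
    gap_conv (\<lambda>v. on_list (\<Phi> \<succ> \<beta> \<prec> conv_inverse \<Phi>) (a # v)) (on_list \<Phi>) (on_list \<Phi>) x"
proof -
  note inv = conv_inverse[OF \<Phi>]
  let ?R = "on_list (conv_inverse \<Phi>)"
  have lin: "clinear (\<Phi> \<succ> \<beta>)"
    by (rule clinear_right_half_shuffle[OF clinear_character[OF \<Phi>] clinear_infinitesimal[OF \<beta>]])
  have unit: "gap_conv ?R (on_list \<Phi>) (on_list \<Phi>) = empty_indicator"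
    using conv_on_list[OF clinear_character[OF inv(1)] \<Phi>] by (simp add: inv(3) on_list_counit fun_eq_iff)
  have "gap_conv (gap_conv (\<lambda>v. on_list (\<Phi> \<succ> \<beta>) (a # v)) ?R ?R) (on_list \<Phi>) (on_list \<Phi>) x
      = on_list (\<Phi> \<succ> \<beta>) (a # x)"
    by (simp only: gap_conv_assoc unit gap_conv_empty_gaps)
  then show ?thesis by (simp add: left_half_shuffle_on_list[OF lin inv(1)])
qed

theorem proposition7p2:
  fixes \<phi> :: "'a::complex_algebra_1 \<Rightarrow> complex"
    and \<Phi> \<beta> \<beta>t :: "'a form"
    and t :: real
  assumes "clinear \<phi>" and "\<phi> 1 = 1"
    and "character \<Phi>" and "\<And>w. \<Phi> (word_tensor w) = \<phi> (prod_list (letters w))"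
    and "infinitesimal_character \<beta>" and "\<Phi> = \<E>\<^sub>\<succ> \<beta>"
    and "t \<in> {0..1}"
  defines "\<beta>t \<equiv> \<E>\<^sub>\<succ> (\<lambda>x. of_real t * \<beta> x) \<succ> \<beta> \<prec> conv_inverse (\<E>\<^sub>\<succ> (\<lambda>x. of_real t * \<beta> x))"
  shows "infinitesimal_character \<beta>t
    \<and> (\<forall>w. \<beta>t (word_tensor w) = t_boolean_cumulant \<phi> t (letters w))"
proof (intro conjI allI)
  note \<beta> = assms(5)
  define \<Phi>t where "\<Phi>t = \<E>\<^sub>\<succ> (\<lambda>x. of_real t * \<beta> x)"
  have t\<beta>: "infinitesimal_character (\<lambda>x. of_real t * \<beta> x)"
    by (rule infinitesimal_character_scale[OF \<beta>])
  have \<Phi>t: "character \<Phi>t" unfolding \<Phi>t_def by (rule character_right_half_exp[OF t\<beta>])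
  have \<beta>t: "\<beta>t = \<Phi>t \<succ> \<beta> \<prec> conv_inverse \<Phi>t" by (simp add: \<beta>t_def \<Phi>t_def)
  show "infinitesimal_character \<beta>t" unfolding \<beta>t by (rule infinitesimal_conjugate[OF \<Phi>t \<beta>])
  have moment: "on_list \<Phi> as = nc_moment 1 (of_real t) (on_list \<beta>t) as" for as
  proof (rule nc_moment_of_conjugate[where F = "on_list \<Phi>t" and B = "on_list \<beta>"])
    show "on_list \<Phi>t [] = 1" "on_list \<Phi> [] = 1"
      by (simp_all add: on_list_Nil character_1 \<Phi>t assms(3))
    fix a :: 'a and x
    have "on_list (\<lambda>x. of_real t * \<beta> x) as = of_real t * on_list \<beta> as" for as
      by (simp add: on_list_def)
    then show "on_list \<Phi>t (a # x) =
        of_real t * (\<Sum>i\<le>length x. on_list \<beta> (a # take i x) * on_list \<Phi>t (drop i x))"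
      using right_half_exp_on_list[OF t\<beta>, of "a # x"]
      by (simp add: \<Phi>t_def lessThan_Suc_atMost sum_distrib_left mult.assoc)
    show "on_list \<Phi> (a # x) = (\<Sum>i\<le>length x. on_list \<beta> (a # take i x) * on_list \<Phi> (drop i x))"
      using right_half_exp_on_list[OF \<beta>, of "a # x"]
      by (simp add: assms(6) lessThan_Suc_atMost)
    show "(\<Sum>i\<le>length x. on_list \<beta> (a # take i x) * on_list \<Phi>t (drop i x)) =
        gap_conv (\<lambda>v. on_list \<beta>t (a # v)) (on_list \<Phi>t) (on_list \<Phi>t) x"
      unfolding \<beta>t conjugate_on_list[OF \<Phi>t \<beta>, symmetric]
      by (simp add: right_half_shuffle_on_list[OF clinear_character[OF \<Phi>t] \<beta>] lessThan_Suc_atMost)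
  qed
  fix w
  have "on_list \<beta>t (letters w) = t_boolean_cumulant \<phi> t (letters w)"
  proof (rule t_boolean_cumulant_unique)
    fix as :: "'a list" assume "as \<noteq> []"
    then show "\<phi> (prod_list as) = nc_moment 1 (of_real t) (on_list \<beta>t) as"
      unfolding moment[symmetric] using assms(4)[of "Word as"] by (simp add: on_list_nonempty)
  qed simp
  then show "\<beta>t (word_tensor w) = t_boolean_cumulant \<phi> t (letters w)" by (simp add: on_list_letters)
qed

end
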